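(* Let $T$ be a tree with spread $k$ and diameter $d$. Let $T'$ be the $s$-subdivision of $T$ for some positive integer $s\ge 72d^2/k^3$. Then $(T')^3$ is stackable.
   Context: The spread of a tree is the minimum distance between two distinct leaves. The $s$-subdivision of a graph is obtained by replacing every edge by a path of length $s$. $(T')^3$ is the Cartesian cube $T'\,\square\, T'\,\square\, T'$, where $G\,\square\, H$ has vertex set $V(G)\times V(H)$ and $(v,w)\sim(v',w')$ iff ($v=v'$ and $ww'\in E(H)$) or ($vv'\in E(G)$ and $w=w'$). Cup stacking on a finite connected graph: initially one cup on every vertex; a move takes all $r\ge1$ cups from a vertex $x$ onto a vertex $y\neq x$ that already carries at least one cup and satisfies $d(x,y)=r$ (shortest-path distance). The graph is stackable if for every vertex $t$ some sequence of moves ends with all cups on $t$. *)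

theory Defs
  imports "Graph_Theory.Digraph_Component" "HOL-Library.Multiset"
begin

text \<open>
  Finite simple graphs are rendered as \<^locale>\<open>pair_graph\<close>: finite, loop-free, symmetric digraphs
  without parallel arcs, where an edge $uv$ is the pair of arcs $(u,v)$, $(v,u)$.

  The predicate \<^const>\<open>tree\<close> of the library cannot be used for these, since it counts the closed
  walk $u, v, u$ along a single edge as a cycle.  A cycle of an undirected graph is a
  \<^const>\<open>pre_digraph.cycle\<close> of length at least 3.
\<close>

definition is_tree :: "'a pair_pre_digraph \<Rightarrow> bool" where
  "is_tree G \<longleftrightarrow> pair_graph G \<and> connected (with_proj G) \<and>
     \<not> (\<exists>p. pre_digraph.cycle (with_proj G) p \<and> length p \<ge> 3)"

definition gdist :: "'a pair_pre_digraph \<Rightarrow> 'a \<Rightarrow> 'a \<Rightarrow> nat" where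
  "gdist G u v = (LEAST n. \<exists>p. pre_digraph.awalk (with_proj G) u p v \<and> length p = n)"

definition graph_diameter :: "'a pair_pre_digraph \<Rightarrow> nat" where
  "graph_diameter G = Max {gdist G u v | u v. u \<in> pverts G \<and> v \<in> pverts G}"

text \<open>In a symmetric digraph the out-degree is the degree of the undirected graph.\<close>

definition leaves :: "'a pair_pre_digraph \<Rightarrow> 'a set" where
  "leaves G = {v \<in> pverts G. out_degree (with_proj G) v = 1}"

definition spread :: "'a pair_pre_digraph \<Rightarrow> nat" where
  "spread G = Min {gdist G u v | u v. u \<in> leaves G \<and> v \<in> leaves G \<and> u \<noteq> v}"

text \<open>
  The vertices of the $s$-subdivision are named by barycentric coordinates: the vertex at distance
  $i$ from $u$ on the path replacing the edge $uv$ is the multiset with $s - i$ copies of $u$ and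
  $i$ copies of $v$.  This does not depend on the orientation of the edge, and for $s > 0$ the
  original vertex $u$ becomes the multiset of $s$ copies of $u$, for every edge at $u$.
\<close>

definition subdiv_point :: "nat \<Rightarrow> 'a \<Rightarrow> 'a \<Rightarrow> nat \<Rightarrow> 'a multiset" where
  "subdiv_point s u v i = replicate_mset (s - i) u + replicate_mset i v"

lemma subdiv_point_commute:
  "i \<le> s \<Longrightarrow> subdiv_point s v u (s - i) = subdiv_point s u v i"
  by (simp add: subdiv_point_def)

definition s_subdivision :: "nat \<Rightarrow> 'a pair_pre_digraph \<Rightarrow> 'a multiset pair_pre_digraph" where
  "s_subdivision s G =
     \<lparr> pverts = {replicate_mset s v | v. v \<in> pverts G}
                \<union> {subdiv_point s u v i | u v i. (u, v) \<in> parcs G \<and> i \<le> s},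
       parcs = {(subdiv_point s u v i, subdiv_point s u v (Suc i)) | u v i.
                  (u, v) \<in> parcs G \<and> i < s}
               \<union> {(subdiv_point s u v (Suc i), subdiv_point s u v i) | u v i.
                  (u, v) \<in> parcs G \<and> i < s} \<rparr>"

definition cart_prod ::
    "'a pair_pre_digraph \<Rightarrow> 'b pair_pre_digraph \<Rightarrow> ('a \<times> 'b) pair_pre_digraph"
    (infixl \<open>\<box>\<close> 70) where
  "G \<box> H =
     \<lparr> pverts = pverts G \<times> pverts H,
       parcs = {((v, w), (v', w')) | v w v' w'.
                  v = v' \<and> v \<in> pverts G \<and> (w, w') \<in> parcs H \<or>
                  (v, v') \<in> parcs G \<and> w = w' \<and> w \<in> pverts H} \<rparr>"

text \<open>A configuration of cups assigns to every vertex the number of cups on it.\<close>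

definition initial_cups :: "'a pair_pre_digraph \<Rightarrow> 'a \<Rightarrow> nat" where
  "initial_cups G = (\<lambda>v. if v \<in> pverts G then 1 else 0)"

definition all_cups_on :: "'a pair_pre_digraph \<Rightarrow> 'a \<Rightarrow> 'a \<Rightarrow> nat" where
  "all_cups_on G t = (\<lambda>v. if v = t then card (pverts G) else 0)"

definition cup_move :: "'a pair_pre_digraph \<Rightarrow> ('a \<Rightarrow> nat) \<Rightarrow> ('a \<Rightarrow> nat) \<Rightarrow> bool" where
  "cup_move G c c' \<longleftrightarrow>
     (\<exists>x \<in> pverts G. \<exists>y \<in> pverts G. y \<noteq> x \<and> c x \<ge> 1 \<and> c y \<ge> 1 \<and> gdist G x y = c x \<and>
        c' = c(x := 0, y := c y + c x))"

definition stackable :: "'a pair_pre_digraph \<Rightarrow> bool" where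
  "stackable G \<longleftrightarrow>
     (\<forall>t \<in> pverts G. (cup_move G)\<^sup>*\<^sup>* (initial_cups G) (all_cups_on G t))"

end

theory Submission
  imports Defs
begin

text \<open>
  A set of vertices can be moved onto a vertex $y$ if it splits into piles, each gathered on a
  vertex whose distance to $y$ is the size of the pile.  Zigzagging gathers a geodesic on any
  of its vertices, so a row of $n$ vertices whose nearest point to $y$ has distance $h \le n$
  can (almost always) be moved onto $y$ in one or two piles.

  Put $K = sk$, $D = sd$ and $L = \lceil K/2 \rceil$.  Following each vertex of $T'$, rooted at a
  coordinate of the target $t$, to the nearest leaf below it splits $T'$ into descending paths of
  at least $L$ vertices, apart from at most one path bending at the root.  The cube is thus
  cut into blocks of parallel rows of length $n \ge L$.  A row whose nearest point has
  distance $g$ to $t$ contains a vertex at distance $an$ from $t$, where $a = \lceil g/n \rceil$,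
  and $a$ neighbouring rows gathered there can move to $t$.  It remains to partition the rows
  of a block into clusters of the right sizes: since $an \le 3D$, the hypothesis $K^3 \ge 72 D^2$
  gives $a^2 \le L$, so a block is large enough to write the number of its rows as a sum of
  admissible cluster sizes.
\<close>

section \<open>Feeding a vertex\<close>

text \<open>The constant is \<open>72 = 8 * 9\<close>: passing from \<open>K\<close> to
  \<open>L\<close> costs \<open>2^3\<close>, and bounding distances in the cube by
  \<open>3 * D\<close> costs \<open>3^2\<close>, so the hypothesis becomes
  \<open>(3 * D)^2 \<le> L^3\<close>. The cross section of a block has sides from \<open>f\<close>
  to \<open>2 * f - 1\<close>, with \<open>f\<close> about \<open>L / 4\<close>. Its rows are then
  at most \<open>n\<close> apart: away from a middle position any row can join any cluster, and only
  two consecutive cluster sizes occur.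

  The obstacle is arithmetic. If both sizes \<open>a\<close> and \<open>a + 1\<close> have enough
  centres, they are coprime and represent every number in the relevant range. If nearly all rows
  demand one size \<open>b\<close>, the number of rows modulo \<open>b\<close> stands in the way,
  and splitting a row between two clusters repairs this. Both remedies take rows of the order
  \<open>a^2\<close>, against at least \<open>f^2\<close> available.

  A row bent at the root cannot be the long direction of a block. When all three coordinates of
  \<open>t\<close> have one, what remains is close to \<open>t\<close> in two coordinates, and bent
  rows of length at least \<open>2 * L\<close> reach \<open>t\<close> directly.\<close>

inductive feeds :: "('w \<Rightarrow> 'w \<Rightarrow> nat) \<Rightarrow> 'w set \<Rightarrow> 'w \<Rightarrow> bool" for dst where
  feeds_empty: "feeds dst {} y"
| feeds_pile: "\<lbrakk>feeds dst B y; feeds dst C z; z \<notin> C; y \<notin> insert z C; B \<inter> insert z C = {};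
    Suc (card C) = dst z y\<rbrakk> \<Longrightarrow> feeds dst (B \<union> insert z C) y"

lemma feeds_finite: "feeds dst B y \<Longrightarrow> finite B"
  by (induction rule: feeds.induct) auto

lemma feeds_not_self: "feeds dst B y \<Longrightarrow> y \<notin> B"
  by (induction rule: feeds.induct) auto

text \<open>A pile on \<open>z\<close> moves once, when its size equals its distance to
  \<open>y\<close>; what already lies on \<open>y\<close> never matters, because \<open>y\<close>
  only receives. Hence \<open>c y\<close> is any positive number, which lets piles arrive one after
  another.\<close>

lemma feeds_moves:
  assumes "feeds (gdist G) B y" "insert y B \<subseteq> pverts G" "\<And>v. v \<in> B \<Longrightarrow> c v = 1" "c y \<ge> 1"
  shows "(cup_move G)\<^sup>*\<^sup>* c (\<lambda>v. if v \<in> B then 0 else if v = y then c y + card B else c v)"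
  using assms
proof (induction arbitrary: c rule: feeds.induct)
  case (feeds_empty y)
  have eq: "(\<lambda>v. if v \<in> {} then 0 else if v = y then c y + card {} else c v) = c"
    by (simp add: fun_eq_iff)
  show ?case unfolding eq by simp
next
  case (feeds_pile B y C z)
  have fin: "finite B" "finite C" and nB: "y \<notin> B"
    using feeds_pile.hyps(1,2) by (auto dest: feeds_finite feeds_not_self)
  define c1 where "c1 = (\<lambda>v. if v \<in> B then 0 else if v = y then c y + card B else c v)"
  define c2 where "c2 = (\<lambda>v. if v \<in> C then 0 else if v = z then c1 z + card C else c1 v)"
  define c3 where "c3 = c2(z := 0, y := c2 y + c2 z)"
  have s1: "(cup_move G)\<^sup>*\<^sup>* c c1"
    unfolding c1_def by (rule feeds_pile.IH(1)) (use feeds_pile.prems in auto)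
  have s2: "(cup_move G)\<^sup>*\<^sup>* c1 c2"
    unfolding c2_def
  proof (rule feeds_pile.IH(2))
    show "c1 v = 1" if "v \<in> C" for v
      using that feeds_pile.prems feeds_pile.hyps unfolding c1_def by auto
    show "1 \<le> c1 z"
      using feeds_pile.prems(2)[of z] feeds_pile.hyps unfolding c1_def by auto
  qed (use feeds_pile.prems in auto)
  have c1z: "c1 z = 1" using feeds_pile.prems(2)[of z] feeds_pile.hyps unfolding c1_def by auto
  have c2z: "c2 z = Suc (card C)" using c1z feeds_pile.hyps unfolding c2_def by auto
  have c2y: "c2 y = c y + card B" using feeds_pile.hyps nB unfolding c2_def c1_def by auto
  have s3: "cup_move G c2 c3"
    unfolding cup_move_def c3_def
    by (rule bexI[of _ z], rule bexI[of _ y])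
      (use feeds_pile.prems feeds_pile.hyps c2z c2y in auto)
  have "card (B \<union> insert z C) = card B + Suc (card C)"
    using fin feeds_pile.hyps by (subst card_Un_disjoint) auto
  then have "c3 = (\<lambda>v. if v \<in> B \<union> insert z C then 0
      else if v = y then c y + card (B \<union> insert z C) else c v)"
    using feeds_pile.hyps c2y c2z nB unfolding c3_def by (auto simp: fun_eq_iff c2_def c1_def)
  moreover have "(cup_move G)\<^sup>*\<^sup>* c c3"
  proof -
    have s3': "(cup_move G)\<^sup>*\<^sup>* c2 c3" by (rule r_into_rtranclp[of "cup_move G" c2 c3, OF s3])
    show ?thesis by (rule rtranclp_trans[OF rtranclp_trans[OF s1 s2] s3'])
  qed
  ultimately show ?case by simp
qed

lemma stackable_if_feeds:
  assumes "finite (pverts G)" "\<And>t. t \<in> pverts G \<Longrightarrow> feeds (gdist G) (pverts G - {t}) t"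
  shows "stackable G"
  unfolding stackable_def
proof
  fix t assume t: "t \<in> pverts G"
  have "(cup_move G)\<^sup>*\<^sup>* (initial_cups G) (\<lambda>v. if v \<in> pverts G - {t} then 0
      else if v = t then initial_cups G t + card (pverts G - {t}) else initial_cups G v)"
    by (rule feeds_moves[OF assms(2)[OF t]]) (use t in \<open>auto simp: initial_cups_def\<close>)
  moreover have "(\<lambda>v. if v \<in> pverts G - {t} then 0
      else if v = t then initial_cups G t + card (pverts G - {t}) else initial_cups G v)
      = all_cups_on G t"
    using t assms(1) card_Suc_Diff1[OF assms(1) t] by (auto simp: fun_eq_iff initial_cups_def all_cups_on_def)
  ultimately show "(cup_move G)\<^sup>*\<^sup>* (initial_cups G) (all_cups_on G t)" by simp
qed

lemma feeds_Un:
  assumes "feeds dst A y" "feeds dst B y" "A \<inter> B = {}"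
  shows "feeds dst (A \<union> B) y"
  using assms(2,1,3)
proof (induction rule: feeds.induct)
  case (feeds_pile B y C z)
  have "feeds dst ((A \<union> B) \<union> insert z C) y"
    by (rule feeds.feeds_pile[OF _ feeds_pile.hyps(2)]) (use feeds_pile in auto)
  then show ?case by (simp add: Un_assoc)
qed simp

lemma feeds_UN:
  assumes "finite I" "\<And>i. i \<in> I \<Longrightarrow> feeds dst (A i) y"
    "\<And>i j. i \<in> I \<Longrightarrow> j \<in> I \<Longrightarrow> i \<noteq> j \<Longrightarrow> A i \<inter> A j = {}"
  shows "feeds dst (\<Union>i\<in>I. A i) y"
  using assms
proof (induction I rule: finite_induct)
  case empty
  show ?case by (simp add: feeds_empty)
next
  case (insert i I)
  have "A i \<inter> A j = {}" if "j \<in> I" for j using that insert by (metis insertCI)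
  then have "feeds dst (A i \<union> (\<Union>i\<in>I. A i)) y"
    using insert by (intro feeds_Un) auto
  then show ?case by simp
qed

lemma feeds_pile_only:
  assumes "feeds dst C z" "z \<notin> C" "y \<notin> insert z C" "Suc (card C) = dst z y"
  shows "feeds dst (insert z C) y"
  using feeds_pile[OF feeds_empty assms(1,2,3) _ assms(4)] by simp

section \<open>Gathering geodesics\<close>

definition ad :: "nat \<Rightarrow> nat \<Rightarrow> nat" where
  "ad i j = (if i \<le> j then j - i else i - j)"

lemma ad_simps [simp]: "ad i i = 0" "ad 0 i = i" "ad i 0 = i"
  by (auto simp: ad_def)

lemma ad_eq_0 [simp]: "ad i j = 0 \<longleftrightarrow> i = j"
  by (auto simp: ad_def)

definition geodesic :: "('w \<Rightarrow> 'w \<Rightarrow> nat) \<Rightarrow> (nat \<Rightarrow> 'w) \<Rightarrow> nat set \<Rightarrow> bool" where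
  "geodesic dst x I \<longleftrightarrow> (\<forall>i\<in>I. \<forall>j\<in>I. dst (x i) (x j) = ad i j)"

lemma geodesicD: "geodesic dst x I \<Longrightarrow> i \<in> I \<Longrightarrow> j \<in> I \<Longrightarrow> dst (x i) (x j) = ad i j"
  by (simp add: geodesic_def)

lemma geodesic_subset: "geodesic dst x I \<Longrightarrow> J \<subseteq> I \<Longrightarrow> geodesic dst x J"
  unfolding geodesic_def by blast

lemma geodesic_inj: "geodesic dst x I \<Longrightarrow> inj_on x I"
  unfolding geodesic_def inj_on_def by (metis ad_eq_0)

text \<open>The zigzag: gather all but one end of the path on the other end, whose distance to the
  remaining vertex is then exactly the number of cups gathered.\<close>

lemma geodesic_feeds_ends:
  assumes "geodesic dst x {a..a + n}"
  shows "feeds dst (x ` {a<..a + n}) (x a) \<and> feeds dst (x ` {a..<a + n}) (x (a + n))"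
  using assms
proof (induction n arbitrary: a)
  case 0
  then show ?case by (simp add: feeds_empty)
next
  case (Suc n)
  note inj = geodesic_inj[OF Suc.prems]
  have g1: "geodesic dst x {Suc a..Suc a + n}" and g2: "geodesic dst x {a..a + n}"
    by (rule geodesic_subset[OF Suc.prems]; auto)+
  have i1: "x ` {a<..a + Suc n} = insert (x (a + Suc n)) (x ` {Suc a..<Suc a + n})"
    by (subst image_insert[symmetric], rule arg_cong[of _ _ "image x"]) auto
  have i2: "x ` {a..<a + Suc n} = insert (x a) (x ` {a<..a + n})"
    by (subst image_insert[symmetric], rule arg_cong[of _ _ "image x"]) auto
  have notin: "x u \<notin> x ` B" if "u \<in> {a..a + Suc n}" "B \<subseteq> {a..a + Suc n}" "u \<notin> B" for u B
    using that inj_on_image_mem_iff[OF inj] by blast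
  have cards: "card (x ` {Suc a..<Suc a + n}) = n" "card (x ` {a<..a + n}) = n"
    by (subst card_image; (rule inj_on_subset[OF inj])?; auto)+
  have "feeds dst (insert (x (a + Suc n)) (x ` {Suc a..<Suc a + n})) (x a)"
  proof (rule feeds_pile_only)
    show "feeds dst (x ` {Suc a..<Suc a + n}) (x (a + Suc n))" using Suc.IH[OF g1] by simp
    show "Suc (card (x ` {Suc a..<Suc a + n})) = dst (x (a + Suc n)) (x a)"
      using cards geodesicD[OF Suc.prems, of "a + Suc n" a] by (simp add: ad_def)
    show "x a \<notin> insert (x (a + Suc n)) (x ` {Suc a..<Suc a + n})"
      using notin[of a "{a<..a + Suc n}"] unfolding i1
      by (meson atLeastAtMost_iff greaterThanAtMost_iff le_add1 less_imp_le_nat less_irrefl order_refl subsetI)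
  qed (rule notin; auto)
  moreover have "feeds dst (insert (x a) (x ` {a<..a + n})) (x (a + Suc n))"
  proof (rule feeds_pile_only)
    show "feeds dst (x ` {a<..a + n}) (x a)" using Suc.IH[OF g2] by simp
    show "Suc (card (x ` {a<..a + n})) = dst (x a) (x (a + Suc n))"
      using cards geodesicD[OF Suc.prems, of a "a + Suc n"] by (simp add: ad_def)
    show "x (a + Suc n) \<notin> insert (x a) (x ` {a<..a + n})"
      using notin[of "a + Suc n" "{a..<a + Suc n}"] unfolding i2
      by (meson atLeastAtMost_iff atLeastLessThan_iff le_add1 less_imp_le_nat less_irrefl order_refl subsetI)
  qed (rule notin; auto)
  ultimately show ?case using i1 i2 by simp
qed

text \<open>The parts on either side of \<open>x r\<close> zigzag onto it independently.\<close>

lemma geodesic_feeds: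
  assumes g: "geodesic dst x {a..<b}" and r: "r \<in> {a..<b}"
  shows "feeds dst (x ` {a..<b} - {x r}) (x r)"
proof -
  note inj = geodesic_inj[OF g]
  have "feeds dst (x ` {a..<r}) (x r)"
    using geodesic_feeds_ends[of dst x a "r - a"] r geodesic_subset[OF g, of "{a..r}"]
    by (simp add: subset_iff)
  moreover have "feeds dst (x ` {r<..b - 1}) (x r)"
    using geodesic_feeds_ends[of dst x r "b - 1 - r"] r geodesic_subset[OF g, of "{r..b - 1}"]
    by (fastforce simp: subset_iff)
  moreover have "x ` {a..<r} \<inter> x ` {r<..b - 1} = {}"
    using inj r by (subst inj_on_image_Int[OF inj, symmetric]) auto
  moreover have "x ` {a..<b} - {x r} = x ` {a..<r} \<union> x ` {r<..b - 1}"
  proof -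
    have "x ` {a..<b} - x ` {r} = x ` ({a..<b} - {r})"
      using inj r by (intro inj_on_image_set_diff[symmetric]) auto
    moreover have "{a..<b} - {r} = {a..<r} \<union> {r<..b - 1}" using r by auto
    ultimately show ?thesis by (simp add: image_Un)
  qed
  ultimately show ?thesis using feeds_Un by metis
qed

lemma segment_feeds:
  assumes g: "geodesic dst x {a..<b}" and z: "z \<in> {a..<b}"
    and "dst (x z) y = b - a" "y \<notin> x ` {a..<b}"
  shows "feeds dst (x ` {a..<b}) y"
proof -
  have ins: "insert (x z) (x ` {a..<b} - {x z}) = x ` {a..<b}" using z by auto
  have "card (x ` {a..<b}) = b - a" using card_image[OF geodesic_inj[OF g]] by simp
  then have "Suc (card (x ` {a..<b} - {x z})) = dst (x z) y"
    using z assms(3) by (simp add: card_Diff_singleton_if) linarith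
  then show ?thesis
    using feeds_pile_only[OF geodesic_feeds[OF g z]] assms(4) ins by (metis Diff_iff singletonI)
qed

text \<open>Distances to \<open>y\<close> are smallest at \<open>x r\<close>, namely
  \<open>h\<close>, and grow by one per step. If some vertex has distance \<open>n\<close>, the
  whole row is one pile; otherwise it is cut next to \<open>x r\<close> into two. In the excluded
  case no distance exceeds \<open>2 * h\<close>, so one pile is impossible; two piles would have
  \<open>h\<close> and \<open>h + 1\<close> vertices, and the smaller one misses the middle, the
  only vertex at distance \<open>h\<close>.\<close>

lemma row_feeds:
  assumes g: "geodesic dst x {0..<n}" and y: "y \<notin> x ` {0..<n}"
    and d: "\<And>i. i < n \<Longrightarrow> dst (x i) y = h + ad i r" and r: "r < n" and h: "1 \<le> h" "h \<le> n"
    and nb: "\<not> (n = 2 * h + 1 \<and> r = h)"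
  shows "feeds dst (x ` {0..<n}) y"
proof -
  have seg: "feeds dst (x ` {a..<b}) y"
    if "a \<le> z" "z < b" "b \<le> n" "h + ad z r = b - a" for a b z
    by (rule segment_feeds[of _ _ _ _ z])
      (use that y d[of z] in \<open>auto intro: geodesic_subset[OF g]\<close>)
  have split: "feeds dst (x ` {0..<n}) y"
    if "feeds dst (x ` {0..<k}) y" "feeds dst (x ` {k..<n}) y" "k \<le> n" for k
  proof -
    have "x ` {0..<k} \<inter> x ` {k..<n} = {}"
      using that(3) by (subst inj_on_image_Int[OF geodesic_inj[OF g], symmetric]) auto
    moreover have "x ` {0..<n} = x ` {0..<k} \<union> x ` {k..<n}"
      using that(3) by (simp add: image_Un[symmetric] ivl_disj_un)
    ultimately show ?thesis using feeds_Un that by metis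
  qed
  consider "r < h" | "h \<le> r" "n < r + h + 1" | "h \<le> r" "r + h + 2 \<le> n" | "h < r" "n = r + h + 1"
    using nb by linarith
  then show ?thesis
  proof cases
    case 1
    then show ?thesis using h r by (intro seg[of 0 "r + n - h"]) (auto simp: ad_def)
  next
    case 2
    then show ?thesis using h r by (intro seg[of 0 "r + h - n"]) (auto simp: ad_def)
  next
    case 3
    then show ?thesis using h r
      by (intro split[of "r + 1"] seg[of _ "h - 1"] seg[of _ "n - 1 - h"]) (auto simp: ad_def)
  next
    \<comment> \<open>Cut after \<open>r\<close>, the right part would have \<open>h\<close>
      vertices, none of them at distance \<open>h\<close>; so \<open>x r\<close> moves over to
      it.\<close>
    case 4
    then show ?thesis using h r
      by (intro split[of r] seg[of _ h] seg[of _ "r + 1"]) (auto simp: ad_def)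
  qed
qed

section \<open>Blocks of rows\<close>

text \<open>Rows of a block are interchangeable, so clusters need only the right sizes and distinct
  centres. The choice is greedy: the other centres are set aside while one class is filled.\<close>

lemma centre_assignment:
  assumes "finite Z" "finite E" "Z \<subseteq> E" "\<And>z. z \<in> Z \<Longrightarrow> dem z \<ge> (1::nat)" "sum dem Z = card E"
  shows "\<exists>C. (\<forall>z\<in>Z. z \<in> C z \<and> C z \<subseteq> E \<and> card (C z) = dem z) \<and>
    (\<forall>z\<in>Z. \<forall>z'\<in>Z. z \<noteq> z' \<longrightarrow> C z \<inter> C z' = {}) \<and> (\<Union>z\<in>Z. C z) = E"
  using assms
proof (induction Z arbitrary: E rule: finite_induct)
  case empty
  then show ?case by simp
next
  case (insert z Z)
  \<comment> \<open>Each remaining centre demands at least itself, so enough elements are left for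
    \<open>z\<close> after the centres are set aside.\<close>
  have le: "card Z \<le> sum dem Z"
    using sum_mono[of Z "\<lambda>_. 1" dem] insert.prems(3) by simp
  have "card (E - insert z Z) = card E - card (insert z Z)"
    using insert by (intro card_Diff_subset) auto
  then have "dem z - 1 \<le> card (E - insert z Z)"
    using insert.prems(4) insert.hyps le by simp
  then obtain Y where Y: "Y \<subseteq> E - insert z Z" "card Y = dem z - 1"
    by (meson obtain_subset_with_card_n)
  have fY: "finite Y" using Y(1) insert.prems(1) finite_subset by blast
  have cY: "card (insert z Y) = dem z"
    using Y fY insert.prems(3)[of z] by (subst card_insert_disjoint) auto
  have sub: "insert z Y \<subseteq> E" using Y(1) insert.prems(2) by auto
  have "card (E - insert z Y) = card E - dem z"
    using card_Diff_subset[OF _ sub] fY cY by simp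
  then have "sum dem Z = card (E - insert z Y)" using insert.prems(4) insert.hyps by simp
  moreover have "Z \<subseteq> E - insert z Y" using insert.prems(2) insert.hyps Y(1) by auto
  ultimately obtain C where C: "\<forall>x\<in>Z. x \<in> C x \<and> C x \<subseteq> E - insert z Y \<and> card (C x) = dem x"
    "\<forall>x\<in>Z. \<forall>x'\<in>Z. x \<noteq> x' \<longrightarrow> C x \<inter> C x' = {}" "(\<Union>x\<in>Z. C x) = E - insert z Y"
    using insert.IH[of "E - insert z Y"] insert.prems by auto
  show ?case
    using C cY sub insert.hyps by (intro exI[of _ "C(z := insert z Y)"]) auto
qed

text \<open>The number \<open>y\<close> of larger coins must be congruent to \<open>m\<close> modulo
  \<open>a\<close>, as \<open>a + 1\<close> is congruent to 1. Take the largest such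
  \<open>y\<close> that the supply \<open>v\<close> and the value \<open>m\<close> allow; it is
  fewer than \<open>a\<close> short of their bound \<open>M\<close>. The lower bounds on
  \<open>m\<close> and \<open>v\<close> keep \<open>y\<close> from becoming negative; the upper
  bound on \<open>m\<close> keeps \<open>x\<close> within \<open>u\<close> when the supply
  \<open>v\<close> is the limit.\<close>

lemma two_coin_sum:
  fixes a m u v :: nat
  assumes "1 \<le> a" "a \<le> u" "a \<le> v" "(a - 1) * (a + 1) \<le> m" "m + a * a \<le> a * u + (a + 1) * v + 1"
  shows "\<exists>x y. x \<le> u \<and> y \<le> v \<and> x * a + y * (a + 1) = m"
proof -
  define M where "M = min v (m div (a + 1))"
  have Mge: "a - 1 \<le> M"
    using assms unfolding M_def by (simp add: less_eq_div_iff_mult_less_eq)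
  define r where "r = (int M - int m) mod int a"
  have r: "0 \<le> r" "r < int a" using assms(1) unfolding r_def by auto
  define y where "y = M - nat r"
  have y_int: "int y = int M - r" using r Mge unfolding y_def by auto
  have yle: "y \<le> v" "y * (a + 1) \<le> m"
    using div_times_less_eq_dividend[of m "a + 1"] mult_le_mono1[of y "m div (a + 1)" "a + 1"]
    unfolding y_def M_def by linarith+
  have "int a dvd int M - int m - r" unfolding r_def by (simp add: dvd_minus_mod)
  then have "int a dvd - (int M - int m - r)" by (rule dvd_minus_iff[THEN iffD2])
  moreover have "- (int M - int m - r) = int m - int y" using y_int by simp
  ultimately have "int a dvd int m - int y" by metis
  then have "int a dvd (int m - int y) - int y * int a" by (rule dvd_diff) simp
  then have "int a dvd int (m - y * (a + 1))" using yle(2) by (simp add: of_nat_diff algebra_simps)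
  then obtain x where x: "m - y * (a + 1) = a * x" by (auto simp only: int_dvd_int_iff elim: dvdE)
  have eq: "x * a + y * (a + 1) = m" using x yle(2) by (simp add: mult.commute)
  have yM: "M + 1 \<le> y + a" using y_int r by linarith
  have "x \<le> u"
  proof (cases "v \<le> m div (a + 1)")
    case True
    then have "(v + 1) * (a + 1) \<le> (y + a) * (a + 1)"
      using yM unfolding M_def by (intro mult_le_mono1) simp
    then have "v * a + v + 1 \<le> y * a + y + a * a" by (simp add: algebra_simps)
    moreover have "x * a + y * a + y = m" using eq by (simp add: algebra_simps)
    moreover have "m + a * a \<le> u * a + v * a + v + 1" using assms(5) by (simp add: algebra_simps)
    ultimately have "x * a \<le> u * a" by linarith
    then show ?thesis using assms(1) by simp
  next
    \<comment> \<open>Here the value \<open>m\<close> is the limit, so less than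
      \<open>a * (a + 1)\<close> remains for the smaller coins.\<close>
    case False
    then have "(m div (a + 1) + 1) * (a + 1) \<le> (y + a) * (a + 1)"
      using yM unfolding M_def by (intro mult_le_mono1) simp
    moreover have "m < (m div (a + 1) + 1) * (a + 1)"
      by (metis add.commute add_gr_0 dividend_less_div_times less_numeral_extra(1) mult.commute plus_1_eq_Suc mult_Suc)
    ultimately have "x * a + y * (a + 1) < (y + a) * (a + 1)" using eq by simp
    then have "x * a < (a + 1) * a" by (simp add: algebra_simps)
    then have "x < a + 1" using mult_less_cancel2 by blast
    then show ?thesis using assms(2) by simp
  qed
  then show ?thesis using yle(1) eq by blast
qed

text \<open>\<open>rho (i, j)\<close> is the row of the cell \<open>(i, j)\<close>, numbered away
  from \<open>t\<close>; \<open>c\<close> is the distance from \<open>t\<close> to the block,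
  attained in the cell \<open>(p, q)\<close>. From \<open>n_ge\<close> one gets
  \<open>N1 + N2 - 2 \<le> n\<close>, so rows are at most \<open>n\<close> apart. The last
  conditions in \<open>N1\<close> and \<open>N2\<close> leave \<open>f\<close> indices on one side
  of \<open>p\<close> and of \<open>q\<close>, room for the diagonals used later.
  \<open>R_less\<close> is the form that the hypothesis on \<open>s\<close> takes in a
  block.\<close>

locale grid_block =
  fixes dst :: "'w \<Rightarrow> 'w \<Rightarrow> nat" and t :: 'w and rho :: "nat \<times> nat \<Rightarrow> nat \<Rightarrow> 'w"
    and N1 N2 n c p q f R :: nat
  assumes rho_dst: "\<lbrakk>i < N1; j < N2; x < n; i' < N1; j' < N2; x' < n\<rbrakk> \<Longrightarrow>
      dst (rho (i, j) x) (rho (i', j') x') = ad i i' + ad j j' + ad x x'"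
    and rho_t: "\<lbrakk>i < N1; j < N2; x < n\<rbrakk> \<Longrightarrow> dst (rho (i, j) x) t = c + ad i p + ad j q + x"
    and rho_eq_t: "\<lbrakk>i < N1; j < N2; x < n\<rbrakk> \<Longrightarrow> dst (rho (i, j) x) t = 0 \<longleftrightarrow> rho (i, j) x = t"
    and pq: "p < N1" "q < N2" and f10: "10 \<le> f"
    and N1: "f \<le> N1" "N1 < 2 * f" "f \<le> p + 1 \<or> p + f \<le> N1"
    and N2: "f \<le> N2" "N2 < 2 * f" "f \<le> q + 1 \<or> q + f \<le> N2"
    and n_ge: "4 * f \<le> n + 4"
    and t_dst_le: "\<lbrakk>i < N1; j < N2; x < n\<rbrakk> \<Longrightarrow> dst (rho (i, j) x) t \<le> R"
    and R_less: "R * R < 4 * f * (n * n)"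
begin

definition "cells = {0..<N1} \<times> {0..<N2}"
definition "hdist e e' = ad (fst e) (fst e') + ad (snd e) (snd e')"
definition "lev e = c + ad (fst e) p + ad (snd e) q"
definition "row e = rho e ` {0..<n}"
definition "rows A = (\<Union>e\<in>A. row e)"

lemma n36: "36 \<le> n" using n_ge f10 by simp

lemma cells_finite [simp]: "finite cells" by (simp add: cells_def)

lemma card_cells: "card cells = N1 * N2" by (simp add: cells_def)

lemma dst_cells:
  "e \<in> cells \<Longrightarrow> e' \<in> cells \<Longrightarrow> x < n \<Longrightarrow> x' < n \<Longrightarrow> dst (rho e x) (rho e' x') = hdist e e' + ad x x'"
  by (cases e, cases e') (auto simp: cells_def hdist_def rho_dst)

lemma dst_t: "e \<in> cells \<Longrightarrow> x < n \<Longrightarrow> dst (rho e x) t = lev e + x"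
  by (cases e) (auto simp: cells_def lev_def rho_t)

lemma dst_t_eq_0: "e \<in> cells \<Longrightarrow> x < n \<Longrightarrow> rho e x = t \<longleftrightarrow> lev e + x = 0"
  using dst_t by (cases e) (auto simp: cells_def rho_eq_t[symmetric])

lemma lev_x_le: "e \<in> cells \<Longrightarrow> x < n \<Longrightarrow> lev e + x \<le> R"
  using dst_t t_dst_le by (cases e) (fastforce simp: cells_def)

lemma hdist_eq_0: "hdist e e' = 0 \<longleftrightarrow> e = e'"
  by (auto simp: hdist_def prod_eq_iff)

lemma hdist_le: "e \<in> cells \<Longrightarrow> e' \<in> cells \<Longrightarrow> hdist e e' \<le> n"
  using N1 N2 n_ge by (cases e, cases e') (auto simp: hdist_def cells_def ad_def)

lemma rho_inj:
  assumes "e \<in> cells" "e' \<in> cells" "x < n" "x' < n" "rho e x = rho e' x'"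
  shows "e = e' \<and> x = x'"
proof -
  have "hdist e e' + ad x x' = hdist e e + ad x x"
    using dst_cells[of e e' x x'] dst_cells[of e e x x] assms by simp
  then show ?thesis by (simp add: hdist_def prod_eq_iff)
qed

lemma geo: "e \<in> cells \<Longrightarrow> geodesic dst (rho e) {0..<n}"
  unfolding geodesic_def using dst_cells hdist_eq_0 by simp

lemma row_card: "e \<in> cells \<Longrightarrow> card (row e) = n"
  unfolding row_def using geodesic_inj[OF geo] by (simp add: card_image)

lemma row_finite [simp]: "finite (row e)" by (simp add: row_def)

lemma row_disjoint: "e \<in> cells \<Longrightarrow> e' \<in> cells \<Longrightarrow> e \<noteq> e' \<Longrightarrow> row e \<inter> row e' = {}"
  unfolding row_def using rho_inj[of e e'] by auto

lemma rows_disjoint: "A \<subseteq> cells \<Longrightarrow> B \<subseteq> cells \<Longrightarrow> A \<inter> B = {} \<Longrightarrow> rows A \<inter> rows B = {}"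
  unfolding rows_def using row_disjoint by blast

lemma rows_Un: "rows (A \<union> B) = rows A \<union> rows B" by (auto simp: rows_def)

lemma rows_card: "A \<subseteq> cells \<Longrightarrow> card (rows A) = card A * n"
proof -
  assume A: "A \<subseteq> cells"
  have "card (rows A) = (\<Sum>e\<in>A. card (row e))"
    unfolding rows_def using A row_disjoint finite_subset[OF A cells_finite]
    by (intro card_UN_disjoint) (simp, simp, blast)
  also have "\<dots> = (\<Sum>e\<in>A. n)" using A row_card by (intro sum.cong) blast+
  finally show ?thesis by simp
qed

lemma rows_finite: "A \<subseteq> cells \<Longrightarrow> finite (rows A)"
  unfolding rows_def using finite_subset[OF _ cells_finite] by auto

text \<open>The exception in \<open>row_feeds\<close> has the nearest vertex in the middle of the
  row; away from that position every other row of the block can be collected.\<close>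

lemma row_feeds_centre:
  assumes "e \<in> cells" "e' \<in> cells" "e \<noteq> e'" "y < n" "2 * y + 1 \<noteq> n"
  shows "feeds dst (row e) (rho e' y)"
  unfolding row_def
proof (rule row_feeds[of _ _ _ _ "hdist e e'" y])
  show "dst (rho e i) (rho e' y) = hdist e e' + ad i y" if "i < n" for i
    using that assms dst_cells by simp
  show "1 \<le> hdist e e'" using assms(3) hdist_eq_0[of e e'] by linarith
  show "rho e' y \<notin> rho e ` {0..<n}"
  proof
    assume "rho e' y \<in> rho e ` {0..<n}"
    then obtain k where k: "k \<in> {0..<n}" "rho e' y = rho e k" by (rule imageE)
    then show False using rho_inj[OF assms(2,1,4) _ k(2)] assms(3) by auto
  qed
qed (use assms geo[of e] hdist_le[of e e'] in auto)

lemma rows_feed_centre: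
  assumes "A \<subseteq> cells" "e' \<in> cells" "e' \<notin> A" "y < n" "2 * y + 1 \<noteq> n \<or> A = {}"
  shows "feeds dst (rows A) (rho e' y)"
  unfolding rows_def
proof (rule feeds_UN)
  show "finite A" using assms(1) finite_subset[OF _ cells_finite] by blast
  show "feeds dst (row e) (rho e' y)" if "e \<in> A" for e
    using that assms by (intro row_feeds_centre) auto
  show "row i \<inter> row j = {}" if "i \<in> A" "j \<in> A" "i \<noteq> j" for i j
    using that assms(1) row_disjoint by blast
qed

lemma pile_feeds_t:
  assumes "feeds dst X (rho e y)" "e \<in> cells" "y < n" "Suc (card X) = lev e + y" "t \<notin> X"
  shows "feeds dst (insert (rho e y) X) t"
proof (rule feeds_pile_only[OF assms(1) feeds_not_self[OF assms(1)]])
  show "t \<notin> insert (rho e y) X" using assms dst_t_eq_0[of e y] by auto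
  show "Suc (card X) = dst (rho e y) t" using assms dst_t by simp
qed

text \<open>A cluster of one row needs no transfer between rows, so the middle position is harmless
  for it.\<close>

lemma cluster_feeds_t:
  assumes C: "C \<subseteq> cells" "e \<in> C" and y: "y < n" "card C * n = lev e + y" "2 * y + 1 \<noteq> n \<or> card C = 1"
    and t: "t \<notin> rows C"
  shows "feeds dst (rows C) t"
proof -
  have e: "e \<in> cells" using C by auto
  have fC: "finite C" using C(1) finite_subset[OF _ cells_finite] by blast
  define X where "X = rows (C - {e}) \<union> (row e - {rho e y})"
  have re: "rho e y \<in> row e" using y by (auto simp: row_def)
  have rC: "rows C = rows (C - {e}) \<union> row e" using C(2) by (auto simp: rows_def)
  have disj: "rows (C - {e}) \<inter> row e = {}"
    using rows_disjoint[of "C - {e}" "{e}"] C by (auto simp: rows_def)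
  have "C - {e} = {}" if "card C = 1" using that C(2) by (metis Diff_cancel card_1_singletonE singletonD)
  then have "feeds dst (rows (C - {e})) (rho e y)"
    using C y e by (intro rows_feed_centre) auto
  moreover have "feeds dst (row e - {rho e y}) (rho e y)"
    unfolding row_def using geodesic_feeds[OF geo[OF e]] y by simp
  ultimately have fX: "feeds dst X (rho e y)" unfolding X_def using disj by (intro feeds_Un) auto
  have ins: "insert (rho e y) X = rows C" unfolding X_def rC using re by auto
  have "card (insert (rho e y) X) = Suc (card X)"
    using feeds_finite[OF fX] feeds_not_self[OF fX] by simp
  then have "Suc (card X) = lev e + y" using rows_card[OF C(1)] y(2) ins by simp
  then show ?thesis using pile_feeds_t[OF fX e y(1)] t ins by auto
qed

text \<open>Two clusters share the row of \<open>e2\<close>: the part \<open>{a..<b}\<close> goes to \<open>e1\<close>, the rest stays.\<close>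

lemma shared_clusters_feed_t:
  assumes C: "C1 \<subseteq> cells" "C2 \<subseteq> cells" "C1 \<inter> C2 = {}" "e1 \<in> C1" "e2 \<in> C2"
    and split: "{a..<b} \<union> {a'..<b'} = {0..<n}" "{a..<b} \<inter> {a'..<b'} = {}"
    and y1: "y1 < n" "2 * y1 + 1 \<noteq> n" "card C1 * n + (b - a) = lev e1 + y1"
    and z: "z \<in> {a..<b}" "hdist e2 e1 + ad z y1 = b - a"
    and y2: "y2 \<in> {a'..<b'}" "2 * y2 + 1 \<noteq> n" "(card C2 - 1) * n + (b' - a') = lev e2 + y2"
    and t: "t \<notin> rows (C1 \<union> C2)"
  shows "feeds dst (rows (C1 \<union> C2)) t"
proof -
  have e: "e1 \<in> cells" "e2 \<in> cells" "e1 \<noteq> e2" using C by auto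
  have sub: "{a..<b} \<subseteq> {0..<n}" "{a'..<b'} \<subseteq> {0..<n}" using split(1) by blast+
  have y2n: "y2 < n" using sub y2 by auto
  define S where "S = rho e2 ` {a..<b}"
  define S' where "S' = rho e2 ` {a'..<b'}"
  note inj2 = geodesic_inj[OF geo[OF e(2)]]
  have SS: "S \<inter> S' = {}" "S \<union> S' = row e2"
    unfolding S_def S'_def row_def using split inj_on_image_Int[OF inj2 sub] by (auto simp: image_Un[symmetric])
  have cS: "card S = b - a" "card S' = b' - a'"
    unfolding S_def S'_def using inj_on_subset[OF inj2] sub by (simp_all add: card_image)
  have row_eq: "row v = rows {v}" for v by (simp add: rows_def)
  have r1: "rows (C1 - {e1}) \<inter> row e1 = {}" "rows C1 \<inter> row e2 = {}" "rows (C2 - {e2}) \<inter> row e2 = {}"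
    "rows C1 \<inter> rows C2 = {}"
    unfolding row_eq by (rule rows_disjoint; use C in blast)+
  have r2: "rows C1 = rows (C1 - {e1}) \<union> row e1" "rows C2 = rows (C2 - {e2}) \<union> row e2"
    unfolding row_eq rows_Un[symmetric] using C by (simp_all add: insert_absorb)
  note r1 = r1 r2
  have fin: "finite C1" "finite C2" using C finite_subset[OF _ cells_finite] by blast+
  \<comment> \<open>\<open>X\<close> and \<open>X'\<close> are the two piles without their gathering
    vertices. The part \<open>S\<close> of the shared row is first gathered on
    \<open>rho e2 z\<close>, whose distance to \<open>rho e1 y1\<close> is
    \<open>card S\<close>.\<close>
  define X where "X = rows (C1 - {e1}) \<union> (row e1 - {rho e1 y1}) \<union> S"
  define X' where "X' = rows (C2 - {e2}) \<union> (S' - {rho e2 y2})"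
  have re: "rho e1 y1 \<in> row e1" "rho e2 y2 \<in> S'" using y1 y2 by (auto simp: row_def S'_def)
  have "feeds dst (rows (C1 - {e1})) (rho e1 y1)" using C y1 e by (intro rows_feed_centre) auto
  moreover have "feeds dst (row e1 - {rho e1 y1}) (rho e1 y1)"
    unfolding row_def using geodesic_feeds[OF geo[OF e(1)]] y1 by simp
  moreover have "feeds dst S (rho e1 y1)"
    unfolding S_def
  proof (rule segment_feeds[OF _ z(1)])
    show "geodesic dst (rho e2) {a..<b}" using geo[OF e(2)] sub(1) by (rule geodesic_subset)
    show "dst (rho e2 z) (rho e1 y1) = b - a" using dst_cells[of e2 e1 z y1] e y1 z sub by auto
    show "rho e1 y1 \<notin> rho e2 ` {a..<b}"
    proof
      assume "rho e1 y1 \<in> rho e2 ` {a..<b}"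
      then obtain k where k: "k \<in> {a..<b}" "rho e1 y1 = rho e2 k" by (rule imageE)
      have "k < n" using k(1) sub(1) by (meson atLeastLessThan_iff subsetD)
      then show False using rho_inj[OF e(1,2) y1(1) _ k(2)] e(3) by blast
    qed
  qed
  ultimately have fX: "feeds dst X (rho e1 y1)"
    unfolding X_def using r1 SS by (intro feeds_Un) auto
  have "feeds dst (rows (C2 - {e2})) (rho e2 y2)" using C y2 y2n e by (intro rows_feed_centre) auto
  moreover have "feeds dst (S' - {rho e2 y2}) (rho e2 y2)"
    unfolding S'_def using geodesic_feeds[OF geodesic_subset[OF geo[OF e(2)] sub(2)]] y2 by simp
  ultimately have fX': "feeds dst X' (rho e2 y2)"
    unfolding X'_def using r1 SS by (intro feeds_Un) auto
  have ins: "insert (rho e1 y1) X = rows C1 \<union> S" "insert (rho e2 y2) X' = rows (C2 - {e2}) \<union> S'"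
    unfolding X_def X'_def using re r1(5) by auto
  have "card (rows C1 \<union> S) = card C1 * n + (b - a)"
    using r1(2) SS(2) rows_card[OF C(1)] cS(1) rows_finite[OF C(1)]
    by (subst card_Un_disjoint) (auto simp: S_def)
  then have c1: "Suc (card X) = lev e1 + y1"
    using card_insert_disjoint[OF feeds_finite[OF fX] feeds_not_self[OF fX]] ins(1) y1(3) by simp
  have "card (rows (C2 - {e2}) \<union> S') = (card C2 - 1) * n + (b' - a')"
  proof -
    have sub2: "C2 - {e2} \<subseteq> cells" using C(2) by blast
    show ?thesis
      using r1(3) SS(2) rows_card[OF sub2] cS(2) rows_finite[OF sub2] C fin
      by (subst card_Un_disjoint) (auto simp: S'_def)
  qed
  then have c2: "Suc (card X') = lev e2 + y2"
    using card_insert_disjoint[OF feeds_finite[OF fX'] feeds_not_self[OF fX']] ins(2) y2(3) by simp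
  have all: "rows (C1 \<union> C2) = (rows C1 \<union> S) \<union> (rows (C2 - {e2}) \<union> S')"
    using SS r1(6) rows_Un by auto
  have tX: "t \<notin> X" "t \<notin> X'" using t unfolding all ins[symmetric] by auto
  have "feeds dst (rows C1 \<union> S) t" "feeds dst (rows (C2 - {e2}) \<union> S') t"
    using pile_feeds_t[OF fX e(1) y1(1) c1 tX(1)] pile_feeds_t[OF fX' e(2) y2n c2 tX(2)] ins by simp_all
  moreover have "(rows C1 \<union> S) \<inter> (rows (C2 - {e2}) \<union> S') = {}"
    using r1 SS by auto
  ultimately show ?thesis unfolding all by (rule feeds_Un)
qed

text \<open>The row of a centre \<open>e\<close> has a vertex at distance \<open>b * n\<close> from \<open>t\<close>, at position \<open>b * n - lev e\<close>.
  The middle position is avoided because of the exceptional case in \<open>row_feeds\<close>.\<close>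

definition "centre b e \<longleftrightarrow> e \<in> cells \<and> lev e \<le> b * n \<and> b * n < lev e + n"
definition "off_mid b e \<longleftrightarrow> 2 * (b * n - lev e) + 1 \<noteq> n"

lemma t_notin: "0 < c \<Longrightarrow> A \<subseteq> cells \<Longrightarrow> t \<notin> rows A"
  using dst_t_eq_0 by (force simp: rows_def row_def lev_def)

lemma lev_ge: "c \<le> lev e" by (simp add: lev_def)

text \<open>A vertex at distance \<open>b * n\<close> from \<open>t\<close> exists, hence
  \<open>b * n \<le> R\<close>. Through \<open>R_less\<close> the hypothesis on \<open>s\<close>
  thus becomes a bound on cluster sizes.\<close>

lemma centre_le: "centre b e \<Longrightarrow> b * b < 4 * f"
proof -
  assume b: "centre b e"
  then have "lev e + (b * n - lev e) \<le> R"
    unfolding centre_def by (intro lev_x_le) auto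
  then have "b * n \<le> R" using b by (simp add: centre_def)
  then have "(b * n) * (b * n) \<le> R * R" by (intro mult_mono) auto
  then have "(b * n) * (b * n) < (4 * f) * (n * n)" using R_less by linarith
  moreover have "(b * n) * (b * n) = (b * b) * (n * n)" by (simp add: algebra_simps)
  ultimately have "(b * b) * (n * n) < (4 * f) * (n * n)" by simp
  then show ?thesis using mult_less_cancel2 by blast
qed

lemma clusters_feed_t:
  assumes "0 < c" "Z \<subseteq> cells" "\<And>z. z \<in> Z \<Longrightarrow> centre (dem z) z \<and> (off_mid (dem z) z \<or> dem z = 1)"
    and s: "sum dem Z = card cells"
  shows "feeds dst (rows cells) t"
proof -
  have fZ: "finite Z" using assms(2) finite_subset[OF _ cells_finite] by blast
  have "1 \<le> dem z" if "z \<in> Z" for z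
    using assms(1) assms(3)[OF that] lev_ge[of z] by (cases "dem z") (auto simp: centre_def)
  then obtain C where C: "\<forall>z\<in>Z. z \<in> C z \<and> C z \<subseteq> cells \<and> card (C z) = dem z"
    "\<forall>z\<in>Z. \<forall>z'\<in>Z. z \<noteq> z' \<longrightarrow> C z \<inter> C z' = {}" "(\<Union>z\<in>Z. C z) = cells"
    using centre_assignment[OF fZ cells_finite assms(2) _ s] by blast
  have "feeds dst (\<Union>z\<in>Z. rows (C z)) t"
  proof (rule feeds_UN[OF fZ])
    fix z assume z: "z \<in> Z"
    have Cz: "z \<in> C z" "C z \<subseteq> cells" "card (C z) = dem z" using C(1) z by auto
    show "feeds dst (rows (C z)) t"
      by (rule cluster_feeds_t[of _ z "dem z * n - lev z"])
        (use assms(3)[OF z] Cz t_notin[OF assms(1) Cz(2)] in \<open>auto simp: centre_def off_mid_def\<close>)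
  next
    fix z z' assume "z \<in> Z" "z' \<in> Z" "z \<noteq> z'"
    then have "C z \<inter> C z' = {}" "C z \<subseteq> cells" "C z' \<subseteq> cells" using C(1,2) by auto
    then show "rows (C z) \<inter> rows (C z') = {}" by (intro rows_disjoint)
  qed
  moreover have "(\<Union>z\<in>Z. rows (C z)) = rows cells" unfolding C(3)[symmetric] by (auto simp: rows_def)
  ultimately show ?thesis by simp
qed

text \<open>\<open>A\<close> and \<open>B\<close> are pools of admissible centres. Any
  \<open>x\<close> and \<open>y\<close> of them will do; all other rows, whatever their level, are
  distributed among the chosen clusters.\<close>

lemma two_sizes_feed_t:
  assumes "0 < c" "A \<subseteq> {e. centre a e \<and> (off_mid a e \<or> a = 1)}"
    "B \<subseteq> {e. centre (a + 1) e \<and> off_mid (a + 1) e}"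
    and x: "x \<le> card A" "y \<le> card B" "x * a + y * (a + 1) = card cells"
  shows "feeds dst (rows cells) t"
proof -
  have AB: "A \<subseteq> cells" "B \<subseteq> cells" using assms(2,3) by (auto simp: centre_def)
  have "\<not> (centre a e \<and> centre (a + 1) e)" for e by (auto simp: centre_def)
  then have disj: "A \<inter> B = {}" using assms(2,3) by blast
  note AB = AB disj
  obtain X where X: "X \<subseteq> A" "card X = x" using x(1) by (meson obtain_subset_with_card_n)
  obtain Y where Y: "Y \<subseteq> B" "card Y = y" using x(2) by (meson obtain_subset_with_card_n)
  have fin: "finite X" "finite Y" using X Y AB finite_subset[OF _ cells_finite] by (meson order_trans)+
  define dem where "dem = (\<lambda>z. if z \<in> X then a else a + 1)"
  have "sum dem (X \<union> Y) = sum dem X + sum dem Y"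
    using fin X Y AB by (intro sum.union_disjoint) auto
  also have "sum dem X = x * a" using X by (simp add: dem_def)
  also have "sum dem Y = (\<Sum>z\<in>Y. a + 1)"
    using X Y AB by (intro sum.cong) (auto simp: dem_def)
  also have "\<dots> = y * (a + 1)" using Y by simp
  finally have s: "sum dem (X \<union> Y) = card cells" using x(3) by simp
  show ?thesis
  proof (rule clusters_feed_t[OF assms(1) _ _ s])
    show "X \<union> Y \<subseteq> cells" using X Y AB by auto
    show "centre (dem z) z \<and> (off_mid (dem z) z \<or> dem z = 1)" if "z \<in> X \<union> Y" for z
    proof (cases "z \<in> X")
      case True
      then show ?thesis using X(1) assms(2) by (auto simp: dem_def)
    next
      case False
      then have "z \<in> B" using that Y(1) by auto
      then show ?thesis using False assms(3) by (auto simp: dem_def)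
    qed
  qed
qed

end

section \<open>Counting centres, and blocks with two cluster sizes\<close>

lemma ad_fibre: "{j. ad j q = k} \<subseteq> {q + k, q - k}"
  by (auto simp: ad_def)

lemma card_ad_fibre: "finite A \<Longrightarrow> card {j \<in> A. ad j q = k} \<le> 2"
proof -
  assume "finite A"
  have "card {j \<in> A. ad j q = k} \<le> card {q + k, q - k}"
    using ad_fibre[of q k] by (intro card_mono) auto
  also have "\<dots> \<le> 2" by (simp add: card_insert_if)
  finally show ?thesis .
qed

lemma ad_attained: "k \<le> ad i p \<Longrightarrow> i < N \<Longrightarrow> p < N \<Longrightarrow> \<exists>i'<N. ad i' p = k"
  by (rule exI[of _ "if p \<le> i then p + k else p - k"]) (auto simp: ad_def split: if_splits)

context grid_block
begin

text \<open>A level and a first coordinate leave at most two second coordinates. The centres of a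
  given size in the middle position share one level, so this bounds how many are lost.\<close>

lemma card_lev_eq: "card {e \<in> cells. lev e = g} \<le> 2 * N1"
proof -
  have "{e \<in> cells. lev e = g} \<subseteq> (SIGMA i:{0..<N1}. {j \<in> {0..<N2}. ad j q = g - c - ad i p})"
    by (auto simp: cells_def lev_def)
  then have "card {e \<in> cells. lev e = g}
      \<le> card (SIGMA i:{0..<N1}. {j \<in> {0..<N2}. ad j q = g - c - ad i p})"
    by (intro card_mono) auto
  also have "\<dots> = (\<Sum>i\<in>{0..<N1}. card {j \<in> {0..<N2}. ad j q = g - c - ad i p})"
    by (rule card_SigmaI) auto
  also have "\<dots> \<le> (\<Sum>i\<in>{0..<N1}. 2)" by (intro sum_mono card_ad_fibre) auto
  finally show ?thesis by simp
qed

text \<open>A discrete intermediate value argument along a path from \<open>(p, q)\<close> that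
  changes one coordinate at a time.\<close>

lemma lev_attained: "e \<in> cells \<Longrightarrow> c \<le> g \<Longrightarrow> g \<le> lev e \<Longrightarrow> \<exists>e'\<in>cells. lev e' = g"
proof -
  assume e: "e \<in> cells" "c \<le> g" "g \<le> lev e"
  obtain i j where ij: "e = (i, j)" "i < N1" "j < N2" using e(1) by (auto simp: cells_def)
  show ?thesis
  proof (cases "g - c \<le> ad i p")
    case True
    then obtain i' where "i' < N1" "ad i' p = g - c" using ad_attained[of "g - c" i p N1] ij pq by auto
    then show ?thesis using pq e by (intro bexI[of _ "(i', q)"]) (auto simp: lev_def cells_def)
  next
    case False
    then have "g - c - ad i p \<le> ad j q" using e ij by (auto simp: lev_def)
    then obtain j' where "j' < N2" "ad j' q = g - c - ad i p"
      using ad_attained[of "g - c - ad i p" j q N2] ij pq by auto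
    then show ?thesis using e False ij by (intro bexI[of _ "(i, j')"]) (auto simp: lev_def cells_def)
  qed
qed

lemma lev_le: "e \<in> cells \<Longrightarrow> lev e \<le> c + n"
  using N1 N2 n_ge pq by (cases e) (auto simp: lev_def cells_def ad_def)

lemma corner: "(p, q) \<in> cells" "lev (p, q) = c"
  using pq by (auto simp: cells_def lev_def)

lemma card_centre_le: "card {e. centre b e} \<le> card {e. centre b e \<and> off_mid b e} + 2 * N1"
proof -
  have fin: "finite {e. centre b e \<and> P e}" for P
    by (rule finite_subset[OF _ cells_finite]) (auto simp: centre_def)
  have "{e. centre b e} \<subseteq> {e. centre b e \<and> off_mid b e} \<union> {e \<in> cells. lev e = b * n - (n - 1) div 2}"
    by (auto simp: off_mid_def centre_def)
  then have "card {e. centre b e} \<le> card ({e. centre b e \<and> off_mid b e} \<union> {e \<in> cells. lev e = b * n - (n - 1) div 2})"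
    using fin by (intro card_mono) auto
  also have "\<dots> \<le> card {e. centre b e \<and> off_mid b e} + card {e \<in> cells. lev e = b * n - (n - 1) div 2}"
    by (rule card_Un_le)
  finally show ?thesis using card_lev_eq[of "b * n - (n - 1) div 2"] by linarith
qed

lemma finite_centre [simp]: "finite {e. centre b e}" "finite {e. centre b e \<and> P e}"
  by (rule finite_subset[OF _ cells_finite]; auto simp: centre_def)+

text \<open>Levels lie between \<open>c\<close> and \<open>c + n\<close>, a range that meets only
  two of the half-open intervals between consecutive multiples of \<open>n\<close>.\<close>

lemma cells_split:
  assumes "(a - 1) * n < c" "c \<le> a * n" "1 \<le> a"
  shows "cells = {e. centre a e} \<union> {e. centre (a + 1) e}" "{e. centre a e} \<inter> {e. centre (a + 1) e} = {}"
proof -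
  have an: "a * n = (a - 1) * n + n" using assms(3) by (cases a) auto
  show "cells = {e. centre a e} \<union> {e. centre (a + 1) e}"
  proof (rule set_eqI)
    fix e show "e \<in> cells \<longleftrightarrow> e \<in> {e. centre a e} \<union> {e. centre (a + 1) e}"
      using assms lev_ge[of e] lev_le[of e] an by (auto simp: centre_def)
  qed
  show "{e. centre a e} \<inter> {e. centre (a + 1) e} = {}" by (auto simp: centre_def)
qed

text \<open>Rows at level at most \<open>n\<close> are moved to \<open>t\<close> directly, the others in pairs.\<close>

lemma near_block_feeds_t:
  assumes c: "0 < c" "c \<le> n"
  shows "feeds dst (rows cells) t"
proof -
  define V1 where "V1 = {e. centre 2 e}"
  define M1 where "M1 = {e. centre 2 e \<and> off_mid 2 e}"
  have split: "cells = {e. centre 1 e} \<union> V1" "{e. centre 1 e} \<inter> V1 = {}"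
    using cells_split[of 1] c by (simp_all add: V1_def numeral_2_eq_2)
  have card_sum: "card cells = card {e. centre 1 e} + card V1"
    using split by (simp add: card_Un_disjoint V1_def)
  \<comment> \<open>Among the cells of demand 2, \<open>A i\<close> holds those unusable as centres
    and \<open>B i\<close> the usable ones. \<open>A i\<close> lies in one fibre of the distance to
    \<open>q\<close>, so it has at most two elements; five consecutive cells near it still have
    level above \<open>n\<close>, so at least three of them are usable.\<close>
  define A where "A i = {j \<in> {0..<N2}. n < lev (i, j) \<and> \<not> off_mid 2 (i, j)}" for i
  define B where "B i = {j \<in> {0..<N2}. n < lev (i, j) \<and> off_mid 2 (i, j)}" for i
  have lev2: "lev e \<le> 2 * n" if "e \<in> cells" for e using lev_le[OF that] c by simp
  have M: "M1 = (SIGMA i:{0..<N1}. B i)" "V1 = (SIGMA i:{0..<N1}. A i \<union> B i)"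
    using lev2 by (auto simp: M1_def V1_def A_def B_def centre_def cells_def)
  have AB: "card (A i) \<le> card (B i)" if i: "i < N1" for i
  proof (cases "A i = {}")
    case False
    then obtain j where j: "j < N2" "n < lev (i, j)" "\<not> off_mid 2 (i, j)" by (auto simp: A_def)
    have A_sub: "A i \<subseteq> {k \<in> {0..<N2}. ad k q = ad j q}"
    proof
      fix k assume "k \<in> A i"
      then have k: "k < N2" "\<not> off_mid 2 (i, k)" by (auto simp: A_def)
      have "lev (i, k) = lev (i, j)"
        using k j n36 lev2[of "(i, k)"] lev2[of "(i, j)"] i by (auto simp: off_mid_def cells_def)
      then show "k \<in> {k \<in> {0..<N2}. ad k q = ad j q}" using k by (simp add: lev_def)
    qed
    have "card (A i) \<le> card {k \<in> {0..<N2}. ad k q = ad j q}" by (rule card_mono[OF _ A_sub]) auto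
    then have A2: "card (A i) \<le> 2" using card_ad_fibre[of "{0..<N2}" q "ad j q"] by simp
    define I where "I = (if j < 5 then {j..j + 4} else {j - 4..j})"
    have I: "card I = 5" "I \<subseteq> {0..<N2}" using j(1) N2 f10 by (auto simp: I_def)
    have "I \<subseteq> A i \<union> B i"
    proof
      fix k assume k: "k \<in> I"
      have "2 * (2 * n - lev (i, j)) + 1 = n" using j(3) by (simp add: off_mid_def)
      then have "n + 4 < lev (i, j)" using n36 by linarith
      moreover have "ad j q \<le> ad k q + 4" using k by (auto simp: I_def ad_def split: if_splits)
      ultimately have "n < lev (i, k)" by (simp add: lev_def)
      then show "k \<in> A i \<union> B i" using k I(2) by (auto simp: A_def B_def)
    qed
    then have "card I \<le> card (A i \<union> B i)" by (intro card_mono) (auto simp: A_def B_def)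
    also have "\<dots> \<le> card (A i) + card (B i)" by (rule card_Un_le)
    finally show ?thesis using A2 I by linarith
  qed simp
  have "card V1 = (\<Sum>i\<in>{0..<N1}. card (A i \<union> B i))"
    unfolding M(2) by (rule card_SigmaI) (auto simp: A_def B_def)
  also have "\<dots> \<le> (\<Sum>i\<in>{0..<N1}. 2 * card (B i))"
  proof (rule sum_mono)
    fix i assume "i \<in> {0..<N1}"
    then show "card (A i \<union> B i) \<le> 2 * card (B i)"
      using AB[of i] card_Un_le[of "A i" "B i"] by simp
  qed
  also have "\<dots> = 2 * card M1"
    unfolding M(1) by (subst card_SigmaI) (auto simp: A_def B_def sum_distrib_left)
  finally have V1M1: "card V1 \<le> 2 * card M1" .
  have n0: "1 \<le> card {e. centre 1 e}"
  proof -
    have "(p, q) \<in> {e. centre 1 e}" using corner c by (simp add: centre_def)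
    then have "0 < card {e. centre 1 e}" by (metis card_gt_0_iff empty_iff finite_centre(1))
    then show ?thesis by simp
  qed
  \<comment> \<open>If \<open>V1\<close> has odd size, the last pair borrows a row of level at most
    \<open>n\<close>, which exists by \<open>n0\<close>.\<close>
  define y where "y = (card V1 + 1) div 2"
  show ?thesis
  proof (rule two_sizes_feed_t[OF c(1), of "{e. centre 1 e}" 1 M1 "card cells - 2 * y" y])
    show "card cells - 2 * y \<le> card {e. centre 1 e}" "y \<le> card M1"
      using V1M1 n0 card_sum unfolding y_def by linarith+
  next
    have "2 * y \<le> card cells" using n0 card_sum unfolding y_def by linarith
    then show "(card cells - 2 * y) * 1 + y * (1 + 1) = card cells" by simp
  qed (auto simp: M1_def numeral_2_eq_2)
qed

text \<open>To apply \<open>two_coin_sum\<close>, enough centres must survive the exclusion of the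
  middle position, for each size and in total.\<close>

lemma mixed_block_feeds_t:
  assumes c: "0 < c" "(a - 1) * n < c" "c \<le> a * n" "2 \<le> a"
    and V: "a \<le> card {e. centre a e}" "a \<le> card {e. centre (a + 1) e}"
  shows "feeds dst (rows cells) t"
proof -
  define u where "u = card {e. centre a e \<and> off_mid a e}"
  define v where "v = card {e. centre (a + 1) e \<and> off_mid (a + 1) e}"
  have an: "a * n = (a - 1) * n + n" using c(4) by (cases a) auto
  have "{e. centre a e} \<noteq> {}" "{e. centre (a + 1) e} \<noteq> {}"
    using V c(4) by (metis card.empty le_0_eq le_trans not_numeral_le_zero)+
  then obtain e0 e1 where e0: "centre a e0" and e1: "centre (a + 1) e1" by auto
  have aa: "a * a < 4 * f" using centre_le e0 by blast
  have af: "a + 4 \<le> f"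
  proof (cases "a \<le> 6")
    case False
    then have "7 * a \<le> a * a" by (intro mult_le_mono1) simp
    then show ?thesis using aa False by linarith
  qed (use f10 in simp)
  have split: "card cells = card {e. centre a e} + card {e. centre (a + 1) e}"
    using cells_split[of a] c by (simp add: card_Un_disjoint)
  \<comment> \<open>If no centre of size \<open>b'\<close> is in the middle position, none is lost.
    Otherwise the middle level occurs, and by \<open>lev_attained\<close> so do the levels
    \<open>J\<close> between it and the boundary \<open>a * n\<close>, each giving a usable
    centre.\<close>
  have off: "b \<le> card {e. centre b' e \<and> off_mid b' e}"
    if b: "b \<le> card {e. centre b' e}" "b \<le> card J" "finite J"
      and J: "\<And>e g. centre b' e \<Longrightarrow> \<not> off_mid b' e \<Longrightarrow> g \<in> J \<Longrightarrow>
        \<exists>e'\<in>cells. lev e' = g \<and> centre b' e' \<and> off_mid b' e'" for b b' J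
  proof (cases "\<exists>e. centre b' e \<and> \<not> off_mid b' e")
    case True
    then have "J \<subseteq> lev ` {e. centre b' e \<and> off_mid b' e}" using J by blast
    then have "card J \<le> card {e. centre b' e \<and> off_mid b' e}" by (rule surj_card_le[rotated]) simp
    then show ?thesis using b by linarith
  next
    case False
    then have "{e. centre b' e \<and> off_mid b' e} = {e. centre b' e}" by auto
    then show ?thesis using b by simp
  qed
  have half: "a \<le> n div 2 - 1" using af n_ge by linarith
  have u: "a \<le> u" unfolding u_def
  proof (rule off[OF V(1), of "{a * n - (n div 2 - 2)..a * n}"])
    show "a \<le> card {a * n - (n div 2 - 2)..a * n}" using half an by simp
    fix e g assume e: "centre a e" "\<not> off_mid a e" and g: "g \<in> {a * n - (n div 2 - 2)..a * n}"
    have "lev e \<le> g" using e g n36 by (auto simp: off_mid_def centre_def)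
    then have "c \<le> g" using lev_ge[of e] by simp
    then obtain e' where "e' \<in> cells" "lev e' = g"
      using lev_attained[of e1 g] e1 g by (auto simp: centre_def)
    then show "\<exists>e'\<in>cells. lev e' = g \<and> centre a e' \<and> off_mid a e'"
      using g n36 an by (intro bexI[of _ e']) (auto simp: centre_def off_mid_def)
  qed auto
  have v: "a \<le> v" unfolding v_def
  proof (rule off[OF V(2), of "{a * n + 1..a * n + (n div 2 - 1)}"])
    show "a \<le> card {a * n + 1..a * n + (n div 2 - 1)}" using half by simp
    fix e g assume e: "centre (a + 1) e" "\<not> off_mid (a + 1) e" and g: "g \<in> {a * n + 1..a * n + (n div 2 - 1)}"
    have "g \<le> lev e" using e g n36 by (auto simp: off_mid_def centre_def)
    then obtain e' where "e' \<in> cells" "lev e' = g"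
      using lev_attained[of e g] e g c by (auto simp: centre_def)
    then show "\<exists>e'\<in>cells. lev e' = g \<and> centre (a + 1) e' \<and> off_mid (a + 1) e'"
      using g n36 an by (intro bexI[of _ e']) (auto simp: centre_def off_mid_def)
  qed auto
  have uv: "card cells \<le> u + v + 4 * N1"
    using split card_centre_le[of a] card_centre_le[of "a + 1"] unfolding u_def v_def by linarith
  \<comment> \<open>At most \<open>4 * N1\<close> centres are excluded, out of at least
    \<open>10 * N1\<close> rows. For \<open>a \<ge> 2\<close> and \<open>a + 4 \<le> N1\<close> the
    surplus \<open>(a - 1) * card cells\<close> pays for them and for the \<open>a * a\<close> in
    \<open>two_coin_sum\<close>.\<close>
  have m: "10 * N1 \<le> card cells" using card_cells N2 f10 by simp
  have mono: "a * card cells \<le> a * (u + v + 4 * N1)" using uv by simp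
  have "(a - 1) * (10 * N1) \<le> (a - 1) * card cells" using m by simp
  moreover have "a * card cells = (a - 1) * card cells + card cells" using c(4) by (cases a) auto
  moreover have "4 * (a * N1) + a * a \<le> (a - 1) * (10 * N1)"
  proof -
    obtain k where k: "a = k + 2" using c(4) by (metis add.commute le_add_diff_inverse)
    have "k * (k + 6) \<le> k * N1" using af N1 k by (intro mult_le_mono2) linarith
    moreover have "a * a = k * (k + 4) + 4" by (simp add: k algebra_simps)
    ultimately show ?thesis using N1 f10 by (simp add: k algebra_simps)
  qed
  moreover have "a * (u + v + 4 * N1) = a * u + a * v + 4 * (a * N1)" by (simp add: algebra_simps)
  ultimately have "card cells + a * a \<le> a * u + a * v" using mono by linarith
  then have key: "card cells + a * a \<le> a * u + (a + 1) * v + 1" by (simp add: algebra_simps)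
  have "(a - 1) * (a + 1) \<le> N1 * N2" using af N1 N2 by (intro mult_le_mono) linarith+
  then have "\<exists>x y. x \<le> u \<and> y \<le> v \<and> x * a + y * (a + 1) = card cells"
    using c(4) u v key card_cells by (intro two_coin_sum) auto
  then obtain x y where "x \<le> u" "y \<le> v" "x * a + y * (a + 1) = card cells" by blast
  then show ?thesis unfolding u_def v_def by (intro two_sizes_feed_t[OF c(1)]) auto
qed

end

text \<open>Here \<open>b\<close> is a cluster size. The first bound keeps the diagonals up to index
  \<open>b + 3\<close> inside the block; the second makes room for \<open>b - 1\<close> pairs of
  clusters with up to \<open>2 * b + 1\<close> rows per pair. Small \<open>b\<close> are settled by
  \<open>10 \<le> f\<close>, the others by \<open>7 * b \<le> b * b\<close>.\<close>

lemma square_bound: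
  fixes b f :: nat
  assumes "b * b < 4 * f" "10 \<le> f"
  shows "b + 4 \<le> f" "(b - 1) * (2 * b + 1) \<le> f * f"
proof -
  have "b + 4 \<le> f \<and> (b - 1) * (2 * b + 1) \<le> f * f"
  proof (cases "b \<le> 6")
    case True
    then have "(b - 1) * (2 * b + 1) \<le> 5 * 13" by (intro mult_le_mono) auto
    moreover have "10 * 10 \<le> f * f" using assms(2) by (intro mult_le_mono)
    ultimately show ?thesis using True assms(2) by linarith
  next
    case False
    then have "7 * b \<le> b * b" by (intro mult_le_mono1) simp
    then have f: "7 * b \<le> 4 * f" using assms(1) by linarith
    then have "(7 * b) * (7 * b) \<le> (4 * f) * (4 * f)" by (rule mult_le_mono) (rule f)
    then have "49 * (b * b) \<le> 16 * (f * f)" by (simp add: algebra_simps)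
    moreover have "(b - 1) * (2 * b + 1) \<le> 3 * (b * b)"
    proof -
      have "(b - 1) * (2 * b + 1) \<le> b * (3 * b)" using False by (intro mult_le_mono) auto
      then show ?thesis by simp
    qed
    ultimately show ?thesis using f False by linarith
  qed
  then show "b + 4 \<le> f" "(b - 1) * (2 * b + 1) \<le> f * f" by auto
qed

section \<open>Blocks in which one cluster size dominates\<close>

context grid_block
begin

text \<open>The direction is chosen on a side of \<open>p\<close> with \<open>f\<close> indices, so
  each step raises the level by one.\<close>

definition "ray1 k = (if p + f \<le> N1 then p + k else p - k)"
definition "ray2 k = (if q + f \<le> N2 then q + k else q - k)"

lemma ray1: "k < f \<Longrightarrow> ray1 k < N1" "k < f \<Longrightarrow> ad (ray1 k) p = k"
  "k + 1 < f \<Longrightarrow> ad (ray1 (k + 1)) (ray1 k) = 1"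
  using N1 pq by (auto simp: ray1_def ad_def)

lemma ray1_inj: "ray1 k = ray1 l \<Longrightarrow> k < f \<Longrightarrow> l < f \<Longrightarrow> k = l"
  using ray1(2) by metis

lemma ray2: "k < f \<Longrightarrow> ray2 k < N2" "k < f \<Longrightarrow> ad (ray2 k) q = k"
  using N2 pq by (auto simp: ray2_def ad_def)

lemma ray_cell: "k < f \<Longrightarrow> l < f \<Longrightarrow> (ray1 k, ray2 l) \<in> cells \<and> lev (ray1 k, ray2 l) = c + k + l"
  using ray1 ray2 by (auto simp: cells_def lev_def)

text \<open>The cells \<open>(ray1 i, ray2 (k - i))\<close> share the level \<open>c + k\<close>,
  and being a centre of size \<open>b\<close> depends on the level alone. There are
  \<open>k + 1 \<ge> b\<close> of them, too many to be exceptions.\<close>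

lemma diagonal_centre:
  assumes W: "card {e \<in> cells. \<not> centre b e} < b" and k: "b \<le> k + 1" "k < f"
  shows "c + k \<le> b * n \<and> b * n < c + k + n"
proof (rule ccontr)
  assume neg: "\<not> (c + k \<le> b * n \<and> b * n < c + k + n)"
  have "(\<lambda>i. (ray1 i, ray2 (k - i))) ` {0..k} \<subseteq> {e \<in> cells. \<not> centre b e}"
    using neg k ray_cell by (fastforce simp: centre_def)
  then have "card ((\<lambda>i. (ray1 i, ray2 (k - i))) ` {0..k}) \<le> card {e \<in> cells. \<not> centre b e}"
    by (intro card_mono) auto
  moreover have "inj_on (\<lambda>i. (ray1 i, ray2 (k - i))) {0..k}"
    using ray1(2) k(2) by (intro inj_onI) (metis Pair_inject atLeastAtMost_iff le_less_trans)
  ultimately show False using W k by (simp add: card_image)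
qed

text \<open>All but fewer than \<open>b\<close> cells need clusters of \<open>b\<close> rows, so the number of rows modulo \<open>b\<close>
  has to be corrected by pairs of clusters of \<open>b + 1/2\<close> or \<open>b - 1/2\<close> rows each.  Whether the
  half is added or removed depends on the position \<open>P\<close> of the centre in its row.\<close>

lemma constant_block_feeds_t:
  assumes c: "0 < c" and b: "2 \<le> b" and W: "card {e \<in> cells. \<not> centre b e} < b" and ex: "centre b e"
  shows "feeds dst (rows cells) t"
proof -
  note bf = square_bound[OF centre_le[OF ex] f10]
  define m where "m = card cells"
  have m: "10 * N1 \<le> m" "f * f \<le> m"
    using card_cells N1 N2 f10 mult_le_mono[of f N1 f N2] by (auto simp: m_def)
  define h where "h = (n + 1) div 2"
  have h: "n \<le> 2 * h" "2 * h \<le> n + 1" "18 \<le> h" "h \<le> n" using n36 by (auto simp: h_def)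
  \<comment> \<open>The position of the gathering vertex in rows of level
    \<open>c + (b - 1)\<close>; it drops by one with each further diagonal.\<close>
  define P where "P = b * n - (c + (b - 1))"
  have P: "c + (b - 1) \<le> b * n" "c + (b + 3) \<le> b * n" "b * n < c + (b - 1) + n"
    using diagonal_centre[OF W, of "b - 1"] diagonal_centre[OF W, of "b + 3"] bf b by auto
  \<comment> \<open>Sharing a row shifts the gathering positions by about half a row, upwards from
    the lower half and downwards from the upper half. At most three diagonals further on,
    \<open>P - j\<close> and \<open>P - j - 1\<close> are clear of the middle and of the
    ends.\<close>
  obtain j where j: "j \<le> 3"
    "(1 \<le> P - j - 1 \<and> P - j \<le> h - 2) \<or> (h + 1 \<le> P - j - 1 \<and> P - j \<le> n - 2)"
  proof -
    have "4 \<le> P" "P \<le> n - 1" using P b unfolding P_def by linarith+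
    then consider "P \<le> h - 2" | "P = h - 1" | "P = h" | "P = h + 1" | "h + 2 \<le> P" "P \<le> n - 2" | "P = n - 1"
      by linarith
    then show ?thesis
    proof cases
      case 1
      then have "1 \<le> P - 0 - 1 \<and> P - 0 \<le> h - 2" using \<open>4 \<le> P\<close> h n36 by linarith
      then show ?thesis by (intro that[of 0] disjI1) simp_all
    next
      case 2
      then have "1 \<le> P - 1 - 1 \<and> P - 1 \<le> h - 2" using h n36 by linarith
      then show ?thesis by (intro that[of 1] disjI1) simp_all
    next
      case 3
      then have "1 \<le> P - 2 - 1 \<and> P - 2 \<le> h - 2" using h n36 by linarith
      then show ?thesis by (intro that[of 2] disjI1) simp_all
    next
      case 4
      then have "1 \<le> P - 3 - 1 \<and> P - 3 \<le> h - 2" using h n36 by linarith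
      then show ?thesis by (intro that[of 3] disjI1) simp_all
    next
      case 5
      then have "h + 1 \<le> P - 0 - 1 \<and> P - 0 \<le> n - 2" using h n36 by linarith
      then show ?thesis by (intro that[of 0] disjI2) simp_all
    next
      case 6
      then have "h + 1 \<le> P - 1 - 1 \<and> P - 1 \<le> n - 2" using h n36 by linarith
      then show ?thesis by (intro that[of 1] disjI2) simp_all
    qed
  qed
  define d where "d = b - 1 + j"
  \<comment> \<open>Paired centres lie side by side on consecutive diagonals. Correcting a residue
    modulo \<open>b\<close> takes at most \<open>b - 1\<close> pairs, and the diagonal
    \<open>d\<close> is long enough for them.\<close>
  define e1 where "e1 k = (ray1 k, ray2 (d - k))" for k
  define e2 where "e2 k = (ray1 (k + 1), ray2 (d - k))" for k
  define p1 where "p1 = P - j"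
  have df: "d + 1 < f" using bf(1) j(1) b by (simp add: d_def)
  have e1: "e1 k \<in> cells" "lev (e1 k) = c + d" and e2: "e2 k \<in> cells" "lev (e2 k) = c + d + 1"
    and e12: "hdist (e2 k) (e1 k) = 1" if "k < b - 1" for k
    using that ray_cell[of k "d - k"] ray_cell[of "k + 1" "d - k"] df ray1(3)[of k]
    by (auto simp: e1_def e2_def d_def hdist_def)
  have p1: "c + d + p1 = b * n" "5 \<le> p1 + 4" "p1 < n" and p2: "c + d + 1 + (p1 - 1) = b * n"
    using P j b unfolding p1_def P_def d_def by linarith+
  have inj: "inj_on e1 {0..<b - 1}" "inj_on e2 {0..<b - 1}"
  proof -
    have "k = l" if kl: "k < b - 1" "l < b - 1" "ray1 (k + i) = ray1 (l + i)" "i \<le> 1" for k l i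
      using ray1_inj[OF kl(3)] kl df by (simp add: d_def)
    from this[of _ _ 0] this[of _ _ 1] show "inj_on e1 {0..<b - 1}" "inj_on e2 {0..<b - 1}"
      by (auto intro!: inj_onI simp: e1_def e2_def)
  qed
  \<comment> \<open>The rows left over by \<open>y\<close> pairs of clusters are divided into
    clusters of size \<open>b\<close>; the assumption \<open>pair\<close> is discharged below by
    sharing a row within each pair.\<close>
  have build: "feeds dst (rows cells) t"
    if y: "y \<le> b - 1" and s: "y * (d1 + d2) \<le> m" "b dvd m - y * (d1 + d2)" and dpos: "1 \<le> d1" "1 \<le> d2"
      and pair: "\<And>k C1 C2. \<lbrakk>k < y; C1 \<subseteq> cells; C2 \<subseteq> cells; C1 \<inter> C2 = {}; e1 k \<in> C1; e2 k \<in> C2;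
        card C1 = d1; card C2 = d2\<rbrakk> \<Longrightarrow> feeds dst (rows (C1 \<union> C2)) t" for y d1 d2
  proof -
    define Y where "Y = {0..<y}"
    have Yb: "k < b - 1" if "k \<in> Y" for k using that y by (auto simp: Y_def)
    have injY: "inj_on e1 Y" "inj_on e2 Y"
      using inj_on_subset[OF inj(1)] inj_on_subset[OF inj(2)] y by (auto simp: Y_def)
    obtain x where x: "m - y * (d1 + d2) = b * x" using s(2) by (auto elim: dvdE)
    have disj12: "e1 ` Y \<inter> e2 ` Y = {}"
    proof -
      have "e1 k \<noteq> e2 l" if kl: "k \<in> Y" "l \<in> Y" for k l
      proof
        assume "e1 k = e2 l"
        then show False using e1(2)[OF Yb[OF kl(1)]] e2(2)[OF Yb[OF kl(2)]] by simp
      qed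
      then show ?thesis by blast
    qed
    have Ycells: "e1 ` Y \<subseteq> cells" "e2 ` Y \<subseteq> cells" using e1(1) e2(1) Yb by blast+
    define V where "V = {e. centre b e \<and> off_mid b e} - (e1 ` Y \<union> e2 ` Y)"
    \<comment> \<open>Exceptions, middle positions and paired centres account for at most
      \<open>3 * (b - 1) + 2 * N1\<close> cells, less than half of them, while
      \<open>b \<ge> 2\<close> makes \<open>x\<close> at most half.\<close>
    have "x \<le> card V"
    proof -
      have "card cells \<le> card {e \<in> cells. \<not> centre b e} + card {e. centre b e}"
        using card_Un_le[of "{e \<in> cells. \<not> centre b e}" "{e. centre b e}"]
          card_mono[of "{e \<in> cells. \<not> centre b e} \<union> {e. centre b e}" cells] by fastforce
      then have m1: "m \<le> (b - 1) + card {e. centre b e \<and> off_mid b e} + 2 * N1"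
        using W card_centre_le[of b] by (simp add: m_def)
      have "card (e1 ` Y \<union> e2 ` Y) \<le> card (e1 ` Y) + card (e2 ` Y)" by (rule card_Un_le)
      also have "\<dots> \<le> y + y"
        using card_image_le[of Y e1] card_image_le[of Y e2] by (simp add: Y_def)
      finally have "card (e1 ` Y \<union> e2 ` Y) \<le> 2 * (b - 1)" using y by simp
      moreover have "card {e. centre b e \<and> off_mid b e} - card (e1 ` Y \<union> e2 ` Y) \<le> card V"
        unfolding V_def by (rule diff_card_le_card_Diff) (simp add: Y_def)
      ultimately have "m \<le> 3 * (b - 1) + 2 * N1 + card V" using m1 by linarith
      moreover have "2 * x \<le> b * x" using b by simp
      then have "2 * x \<le> m" using x by linarith
      ultimately show ?thesis using m(1) bf(1) N1(1) b by linarith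
    qed
    then obtain X where X: "X \<subseteq> V" "card X = x" by (meson obtain_subset_with_card_n)
    have Xc: "X \<subseteq> {e. centre b e \<and> off_mid b e}" "X \<inter> e1 ` Y = {}" "X \<inter> e2 ` Y = {}"
      using X(1) by (auto simp: V_def)
    have fX: "finite X" using finite_subset[OF Xc(1)] by simp
    have Xcells: "X \<subseteq> cells" using Xc(1) by (auto simp: centre_def)
    define dem where "dem z = (if z \<in> e1 ` Y then d1 else if z \<in> e2 ` Y then d2 else b)" for z
    define Z where "Z = X \<union> (e1 ` Y \<union> e2 ` Y)"
    have fY: "finite (e1 ` Y)" "finite (e2 ` Y)" by (auto simp: Y_def)
    have "sum dem Z = sum dem X + (sum dem (e1 ` Y) + sum dem (e2 ` Y))"
      unfolding Z_def using fX fY Xc disj12 by (subst sum.union_disjoint; (subst sum.union_disjoint)?; auto)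
    also have "sum dem X = (\<Sum>z\<in>X. b)"
      using Xc by (intro sum.cong) (auto simp: dem_def)
    also have "\<dots> = x * b" using X(2) by simp
    also have "sum dem (e1 ` Y) = (\<Sum>z\<in>e1 ` Y. d1)" by (intro sum.cong) (auto simp: dem_def)
    also have "\<dots> = y * d1" using injY by (simp add: card_image Y_def)
    also have "sum dem (e2 ` Y) = (\<Sum>z\<in>e2 ` Y. d2)"
      using disj12 by (intro sum.cong) (auto simp: dem_def)
    also have "\<dots> = y * d2" using injY by (simp add: card_image Y_def)
    finally have sZ: "sum dem Z = card cells"
      using x s(1) by (simp add: m_def algebra_simps)
    have fZ: "finite Z" and Zc: "Z \<subseteq> cells" using fX fY Xcells Ycells by (auto simp: Z_def)
    have dem_pos: "1 \<le> dem z" for z using dpos b by (simp add: dem_def)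
    obtain C where C: "\<forall>z\<in>Z. z \<in> C z \<and> C z \<subseteq> cells \<and> card (C z) = dem z"
      "\<forall>z\<in>Z. \<forall>z'\<in>Z. z \<noteq> z' \<longrightarrow> C z \<inter> C z' = {}" "(\<Union>z\<in>Z. C z) = cells"
      using centre_assignment[OF fZ cells_finite Zc dem_pos sZ] by blast
    have "feeds dst (\<Union>z\<in>X. rows (C z)) t"
    proof (rule feeds_UN[OF fX])
      fix z assume z: "z \<in> X"
      have dz: "dem z = b" using z Xc by (auto simp: dem_def)
      have zb: "centre b z" "off_mid b z" using z Xc(1) by auto
      have Cz: "z \<in> C z" "C z \<subseteq> cells" "card (C z) = b" using C(1) z dz by (auto simp: Z_def)
      show "feeds dst (rows (C z)) t"
        by (rule cluster_feeds_t[of _ z "b * n - lev z"])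
          (use zb Cz t_notin[OF c Cz(2)] in \<open>auto simp: centre_def off_mid_def\<close>)
    next
      fix z z' assume "z \<in> X" "z' \<in> X" "z \<noteq> z'"
      then have "C z \<inter> C z' = {}" "C z \<subseteq> cells" "C z' \<subseteq> cells" using C by (auto simp: Z_def)
      then show "rows (C z) \<inter> rows (C z') = {}" using rows_disjoint by blast
    qed
    moreover have "feeds dst (\<Union>k\<in>Y. rows (C (e1 k) \<union> C (e2 k))) t"
    proof (rule feeds_UN)
      fix k assume k: "k \<in> Y"
      have ne: "e1 k \<noteq> e2 k" using disj12 k by auto
      have in_Z: "e1 k \<in> Z" "e2 k \<in> Z" using k by (auto simp: Z_def)
      show "feeds dst (rows (C (e1 k) \<union> C (e2 k))) t"
      proof (rule pair[of k])
        show "C (e1 k) \<inter> C (e2 k) = {}" using C(2) in_Z ne by blast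
        show "card (C (e1 k)) = d1" "card (C (e2 k)) = d2"
          using C(1) in_Z k disj12 by (auto simp: dem_def)
      qed (use C(1) in_Z k in \<open>auto simp: Y_def\<close>)
    next
      fix k k' assume k: "k \<in> Y" "k' \<in> Y" "k \<noteq> k'"
      have in_Z: "e1 k \<in> Z" "e2 k \<in> Z" "e1 k' \<in> Z" "e2 k' \<in> Z" using k by (auto simp: Z_def)
      have "e1 k \<noteq> e1 k'" "e2 k \<noteq> e2 k'" using k inj_onD[OF injY(1)] inj_onD[OF injY(2)] by blast+
      moreover have "e1 k \<noteq> e2 k'" "e2 k \<noteq> e1 k'" using k disj12 by blast+
      ultimately have "(C (e1 k) \<union> C (e2 k)) \<inter> (C (e1 k') \<union> C (e2 k')) = {}"
        using C(2) in_Z by blast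
      moreover have "C (e1 k) \<union> C (e2 k) \<subseteq> cells" "C (e1 k') \<union> C (e2 k') \<subseteq> cells"
        using C(1) in_Z by auto
      ultimately show "rows (C (e1 k) \<union> C (e2 k)) \<inter> rows (C (e1 k') \<union> C (e2 k')) = {}"
        by (intro rows_disjoint)
    qed (simp add: Y_def)
    moreover have "(\<Union>z\<in>X. rows (C z)) \<inter> (\<Union>k\<in>Y. rows (C (e1 k) \<union> C (e2 k))) = {}"
    proof -
      have "C z \<inter> (C (e1 k) \<union> C (e2 k)) = {}" if "z \<in> X" "k \<in> Y" for z k
      proof -
        have "z \<noteq> e1 k" "z \<noteq> e2 k" "z \<in> Z" "e1 k \<in> Z" "e2 k \<in> Z" using that Xc by (auto simp: Z_def)
        then show ?thesis using C(2) by blast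
      qed
      moreover have "C z \<subseteq> cells" if "z \<in> Z" for z using C(1) that by blast
      ultimately have "rows (C z) \<inter> rows (C (e1 k) \<union> C (e2 k)) = {}" if "z \<in> X" "k \<in> Y" for z k
        using that by (intro rows_disjoint) (auto simp: Z_def)
      then show ?thesis by blast
    qed
    moreover have "(\<Union>z\<in>X. rows (C z)) \<union> (\<Union>k\<in>Y. rows (C (e1 k) \<union> C (e2 k))) = rows cells"
    proof -
      have "rows cells = (\<Union>z\<in>Z. rows (C z))" unfolding C(3)[symmetric] by (auto simp: rows_def)
      also have "\<dots> = (\<Union>z\<in>X. rows (C z)) \<union> ((\<Union>k\<in>Y. rows (C (e1 k))) \<union> (\<Union>k\<in>Y. rows (C (e2 k))))"
        by (simp add: Z_def Un_commute)
      finally show ?thesis by (simp add: rows_Un UN_Un_distrib)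
    qed
    ultimately show ?thesis using feeds_Un[of dst "\<Union>z\<in>X. rows (C z)" t "\<Union>k\<in>Y. rows (C (e1 k) \<union> C (e2 k))"] by simp
  qed
  define r where "r = m mod b"
  have r: "r \<le> b - 1" using b by (simp add: r_def less_Suc_eq_le[symmetric])
  have mult_bound: "y * s \<le> m" if "y \<le> b - 1" "s \<le> 2 * b + 1" for y s
    using mult_le_mono[OF that] bf(2) m(2) by linarith
  from j(2) show ?thesis
  proof
    assume lo: "1 \<le> P - j - 1 \<and> P - j \<le> h - 2"
    then have lo': "2 \<le> p1" "p1 + 2 \<le> h" using h by (auto simp: p1_def)
    \<comment> \<open>A pair takes \<open>2 * b + 1\<close> rows, congruent to 1 modulo
      \<open>b\<close>, so \<open>r\<close> pairs remove the residue. The first \<open>h\<close>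
      vertices of the row of \<open>e2 k\<close> go to \<open>e1 k\<close>, and both gathering
      positions move up.\<close>
    show ?thesis
    proof (rule build[of r b "b + 1"])
      have le: "r * (b + (b + 1)) \<le> m" by (rule mult_bound[OF r]) simp
      then show "r * (b + (b + 1)) \<le> m" .
      have "m = m div b * b + r" by (simp add: r_def)
      then have "m - r * (b + (b + 1)) = m div b * b - r * 2 * b" using le by (simp add: algebra_simps)
      also have "\<dots> = (m div b - r * 2) * b" by (simp add: diff_mult_distrib)
      finally show "b dvd m - r * (b + (b + 1))" by simp
    next
      fix k C1 C2
      assume k: "k < r" and C: "C1 \<subseteq> cells" "C2 \<subseteq> cells" "C1 \<inter> C2 = {}" "e1 k \<in> C1" "e2 k \<in> C2"
        "card C1 = b" "card C2 = b + 1"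
      have kb: "k < b - 1" using k r by simp
      show "feeds dst (rows (C1 \<union> C2)) t"
      proof (rule shared_clusters_feed_t[OF C(1-5)])
        show "{0..<h} \<union> {h..<n} = {0..<n}" "{0..<h} \<inter> {h..<n} = {}" using h by auto
        show "p1 + h < n" using lo'(2) h(2) by linarith
        show "2 * (p1 + h) + 1 \<noteq> n" 
        proof -
          have "n < 2 * (p1 + h) + 1" using h(1) lo'(1) by simp
          then show ?thesis by simp
        qed
        show "card C1 * n + (h - 0) = lev (e1 k) + (p1 + h)" using C(6) e1(2)[OF kb] p1 by simp
        \<comment> \<open>One step between the rows and \<open>h - 1\<close> steps along them make
          the distance \<open>h\<close>, the size of the part that changes sides.\<close>
        show "p1 + 1 \<in> {0..<h}" "hdist (e2 k) (e1 k) + ad (p1 + 1) (p1 + h) = h - 0"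
          using lo' e12[OF kb] by (auto simp: ad_def)
        show "p1 - 1 + (n - h) \<in> {h..<n}" using lo' h by auto
        show "2 * (p1 - 1 + (n - h)) + 1 \<noteq> n"
        proof -
          obtain w e where "n = h + w" "p1 = 2 + e" using h(4) lo'(1) by (auto simp: le_iff_add)
          then show ?thesis using h(2) by simp
        qed
        show "(card C2 - 1) * n + (n - h) = lev (e2 k) + (p1 - 1 + (n - h))"
          using C(7) e2(2)[OF kb] p2 by simp
        show "t \<notin> rows (C1 \<union> C2)" using C(1,2) by (intro t_notin[OF c]) blast
      qed
    qed (use r b in auto)
  next
    assume hi: "h + 1 \<le> P - j - 1 \<and> P - j \<le> n - 2"
    then have hi': "h + 2 \<le> p1" "p1 + 2 \<le> n" using h by (auto simp: p1_def)
    \<comment> \<open>A pair now takes \<open>2 * b - 1\<close> rows, congruent to -1, so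
      \<open>y\<close> is the negative of \<open>m\<close> modulo \<open>b\<close>. The last
      \<open>h\<close> vertices of the row of \<open>e2 k\<close> go to \<open>e1 k\<close>, and
      both gathering positions move down.\<close>
    define y where "y = (if r = 0 then 0 else b - r)"
    have y: "y \<le> b - 1" by (auto simp: y_def)
    have m_y: "b dvd m + y"
    proof (cases "r = 0")
      case False
      have "m + y = m div b * b + (r + (b - r))" using False by (simp add: y_def r_def)
      also have "r + (b - r) = b" using r by simp
      finally show ?thesis by simp
    qed (auto simp: y_def r_def)
    show ?thesis
    proof (rule build[of y "b - 1" b])
      have le: "y * (b - 1 + b) \<le> m" by (rule mult_bound[OF y]) simp
      then show "y * (b - 1 + b) \<le> m" .
      have "y * (b - 1 + b) + y = b * (2 * y)" using b by (cases b) (auto simp: algebra_simps)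
      then have "m - y * (b - 1 + b) = (m + y) - b * (2 * y)" by linarith
      then show "b dvd m - y * (b - 1 + b)" using m_y by (simp add: dvd_diff_nat)
    next
      fix k C1 C2
      assume k: "k < y" and C: "C1 \<subseteq> cells" "C2 \<subseteq> cells" "C1 \<inter> C2 = {}" "e1 k \<in> C1" "e2 k \<in> C2"
        "card C1 = b - 1" "card C2 = b"
      have kb: "k < b - 1" using k y by simp
      have bn: "b * n = (b - 1) * n + n" using b by (cases b) auto
      show "feeds dst (rows (C1 \<union> C2)) t"
      proof (rule shared_clusters_feed_t[OF C(1-5)])
        show "{n - h..<n} \<union> {0..<n - h} = {0..<n}" "{n - h..<n} \<inter> {0..<n - h} = {}" using h by auto
        show "p1 - (n - h) < n" using hi'(2) by linarith
        show "2 * (p1 - (n - h)) + 1 \<noteq> n"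
        proof -
          obtain w e where "n = h + w" "p1 = h + 2 + e" using h(4) hi'(1) by (auto simp: le_iff_add)
          then show ?thesis using h(1,2) hi'(2) by simp
        qed
        show "card C1 * n + (n - (n - h)) = lev (e1 k) + (p1 - (n - h))"
          using C(6) e1(2)[OF kb] p1 bn hi' h by simp
        show "p1 - (n - h) + h - 1 \<in> {n - h..<n}" using hi' h by auto
        show "hdist (e2 k) (e1 k) + ad (p1 - (n - h) + h - 1) (p1 - (n - h)) = n - (n - h)"
          using hi' h e12[OF kb] by (auto simp: ad_def)
        show "p1 - 1 - h \<in> {0..<n - h}" using hi' h(4) by auto
        show "2 * (p1 - 1 - h) + 1 \<noteq> n"
        proof -
          obtain w e where "n = h + w" "p1 = h + 2 + e" using h(4) hi'(1) by (auto simp: le_iff_add)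
          then show ?thesis using h(1,2) hi'(2) by simp
        qed
        show "(card C2 - 1) * n + (n - h - 0) = lev (e2 k) + (p1 - 1 - h)"
          using C(7) e2(2)[OF kb] p2 bn hi' h by simp
        show "t \<notin> rows (C1 \<union> C2)" using C(1,2) by (intro t_notin[OF c]) blast
      qed
    qed (use y b in auto)
  qed
qed

text \<open>If \<open>t\<close> lies in the block, every other row has \<open>hdist\<close> at most
  \<open>n\<close> to its row and is moved to it directly. Otherwise \<open>a\<close>, which is
  \<open>c / n\<close> rounded up, is the smaller of the two possible sizes; the cases are
  \<open>a = 1\<close>, fewer than \<open>a\<close> centres of one size, and at least
  \<open>a\<close> of both.\<close>

theorem block_feeds_t: "feeds dst (rows cells - {t}) t"
proof (cases "c = 0")
  case True
  have t: "rho (p, q) 0 = t" using dst_t_eq_0[OF corner(1), of 0] corner(2) True n36 by simp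
  have row_t: "feeds dst (row (p, q) - {t}) t"
    using geodesic_feeds[OF geo[OF corner(1)], of 0] n36 t by (simp add: row_def)
  have notin: "t \<notin> row e" if "e \<in> cells" "e \<noteq> (p, q)" for e
    using row_disjoint[OF that(1) corner(1) that(2)] t n36 by (force simp: row_def)
  have "feeds dst (rows (cells - {(p, q)})) (rho (p, q) 0)"
    by (rule rows_feed_centre) (use corner n36 in auto)
  then have "feeds dst (rows (cells - {(p, q)})) t" using t by simp
  moreover have "rows (cells - {(p, q)}) \<inter> (row (p, q) - {t}) = {}"
    using rows_disjoint[of "cells - {(p, q)}" "{(p, q)}"] corner by (auto simp: rows_def)
  moreover have "rows cells - {t} = rows (cells - {(p, q)}) \<union> (row (p, q) - {t})"
  proof -
    have "t \<notin> rows (cells - {(p, q)})" using notin by (auto simp: rows_def)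
    moreover have "rows cells = rows (cells - {(p, q)}) \<union> row (p, q)"
      using corner by (auto simp: rows_def)
    ultimately show ?thesis by auto
  qed
  ultimately show ?thesis using row_t feeds_Un by metis
next
  case False
  then have c: "0 < c" by simp
  define a where "a = (c + n - 1) div n"
  have n0: "0 < n" using n36 by simp
  have a_eq: "c + n - 1 = a * n + (c + n - 1) mod n" by (simp add: a_def)
  have "(c + n - 1) mod n < n" using n0 by simp
  then have a: "c \<le> a * n" "a * n < c + n" using a_eq c by linarith+
  have a1: "1 \<le> a" using a c by (cases a) auto
  have an: "a * n = (a - 1) * n + n" using a1 by (cases a) auto
  then have a': "(a - 1) * n < c" using a by linarith
  note split = cells_split[OF a' a(1) a1]
  have cen: "centre a (p, q)" using corner a by (simp add: centre_def)
  have "feeds dst (rows cells) t"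
  proof (cases "a = 1")
    case True
    then show ?thesis using near_block_feeds_t c a(1) by simp
  next
    case False
    then have a2: "2 \<le> a" using a1 by simp
    have W: "{e \<in> cells. \<not> centre a e} = {e. centre (a + 1) e}" "{e \<in> cells. \<not> centre (a + 1) e} = {e. centre a e}"
      using split by blast+
    consider "card {e. centre (a + 1) e} < a" | "card {e. centre a e} < a" "a \<le> card {e. centre (a + 1) e}"
      | "a \<le> card {e. centre a e}" "a \<le> card {e. centre (a + 1) e}" by linarith
    then show ?thesis
    proof cases
      case 1
      then show ?thesis using constant_block_feeds_t[OF c a2 _ cen] W by simp
    next
      case 2
      then have "{e. centre (a + 1) e} \<noteq> {}" using a2 by (metis card.empty not_numeral_le_zero le_trans)
      then obtain e where "centre (a + 1) e" by blast
      then show ?thesis using constant_block_feeds_t[OF c, of "a + 1" e] W 2 a2 by simp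
    next
      case 3
      then show ?thesis using mixed_block_feeds_t[OF c a' a(1) a2] by simp
    qed
  qed
  then show ?thesis using t_notin[OF c order_refl] by simp
qed

end

section \<open>Distances in connected graphs\<close>

abbreviation walk :: "'a pair_pre_digraph \<Rightarrow> 'a \<Rightarrow> ('a \<times> 'a) list \<Rightarrow> 'a \<Rightarrow> bool" where
  "walk G \<equiv> pre_digraph.awalk (with_proj G)"

lemma walk_Nil [simp]: "walk G u [] v \<longleftrightarrow> u = v \<and> u \<in> pverts G"
  by (auto simp: pre_digraph.awalk_def cas_with_proj_eq)

lemma walk_append: "walk G x p y \<Longrightarrow> walk G y q z \<Longrightarrow> walk G x (p @ q) z"
proof -
  have "pcas x p y \<Longrightarrow> pcas y q z \<Longrightarrow> pcas x (p @ q) z" for x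
    by (induction p arbitrary: x) auto
  then show "walk G x p y \<Longrightarrow> walk G y q z \<Longrightarrow> walk G x (p @ q) z"
    by (auto simp: pre_digraph.awalk_def cas_with_proj_eq)
qed

lemma walk_map:
  assumes "walk G x p y" "\<phi> x \<in> pverts H" "\<And>a b. (a, b) \<in> parcs G \<Longrightarrow> (\<phi> a, \<phi> b) \<in> parcs H"
  shows "walk H (\<phi> x) (map (map_prod \<phi> \<phi>) p) (\<phi> y)"
proof -
  have "pcas x p y \<Longrightarrow> pcas (\<phi> x) (map (map_prod \<phi> \<phi>) p) (\<phi> y)" for x
    by (induction p arbitrary: x) auto
  then show ?thesis
    using assms by (auto simp: pre_digraph.awalk_def cas_with_proj_eq)
qed

locale connected_graph =
  fixes G :: "'a pair_pre_digraph"
  assumes arc_verts: "(x, y) \<in> parcs G \<Longrightarrow> x \<in> pverts G \<and> y \<in> pverts G"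
    and arc_sym: "(x, y) \<in> parcs G \<Longrightarrow> (y, x) \<in> parcs G"
    and walk_ex: "x \<in> pverts G \<Longrightarrow> y \<in> pverts G \<Longrightarrow> \<exists>p. walk G x p y"
begin

abbreviation "V \<equiv> pverts G"
abbreviation "d \<equiv> gdist G"

lemma walk_Cons: "walk G u (e # p) v \<longleftrightarrow> e \<in> parcs G \<and> fst e = u \<and> walk G (snd e) p v"
  using arc_verts by (cases e) (auto simp: pre_digraph.awalk_def cas_with_proj_eq)

lemma gdist_le: "walk G x p y \<Longrightarrow> d x y \<le> length p"
  unfolding gdist_def by (rule Least_le) auto

lemma gdist_walk: "x \<in> V \<Longrightarrow> y \<in> V \<Longrightarrow> \<exists>p. walk G x p y \<and> length p = d x y"
proof -
  assume "x \<in> V" "y \<in> V"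
  then obtain p where p: "walk G x p y" using walk_ex by blast
  show ?thesis
    unfolding gdist_def by (rule LeastI[of "\<lambda>n. \<exists>p. walk G x p y \<and> length p = n" "length p"]) (use p in blast)
qed

lemma gdist_refl [simp]: "x \<in> V \<Longrightarrow> d x x = 0"
  using gdist_le[of x "[]" x] by simp

lemma gdist_eq_0: "x \<in> V \<Longrightarrow> y \<in> V \<Longrightarrow> d x y = 0 \<longleftrightarrow> x = y"
  using gdist_walk[of x y] by auto

lemma lipschitz_walk:
  assumes "\<And>a b. (a, b) \<in> parcs G \<Longrightarrow> \<phi> b \<le> \<phi> a + (1::nat)"
  shows "walk G x p y \<Longrightarrow> \<phi> y \<le> \<phi> x + length p"
proof (induction p arbitrary: x)
  case (Cons e p)
  then have "\<phi> y \<le> \<phi> (snd e) + length p" "(x, snd e) \<in> parcs G" by (cases e; auto simp: walk_Cons)+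
  then show ?case using assms[of x "snd e"] by simp
qed simp

text \<open>The source of lower bounds on distances: products, bridges and subdivisions each supply
  a potential that grows by at most one along arcs.\<close>

lemma lipschitz:
  assumes "x \<in> V" "y \<in> V" "\<And>a b. (a, b) \<in> parcs G \<Longrightarrow> \<phi> b \<le> \<phi> a + (1::nat)"
  shows "\<phi> y \<le> \<phi> x + d x y"
  using gdist_walk[OF assms(1,2)] lipschitz_walk[OF assms(3)] by fastforce

lemma gdist_step_left: "(a, b) \<in> parcs G \<Longrightarrow> y \<in> V \<Longrightarrow> d b y \<le> d a y + 1"
proof -
  assume ab: "(a, b) \<in> parcs G" "y \<in> V"
  obtain p where "walk G a p y" "length p = d a y" using gdist_walk ab arc_verts by blast
  then show ?thesis using gdist_le[of b "(b, a) # p" y] arc_sym[OF ab(1)] by (auto simp: walk_Cons)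
qed

lemma gdist_sym_le: "x \<in> V \<Longrightarrow> y \<in> V \<Longrightarrow> d x y \<le> d y x"
  using lipschitz[of y x "\<lambda>b. d b y"] gdist_step_left by simp

lemma gdist_sym: "x \<in> V \<Longrightarrow> y \<in> V \<Longrightarrow> d x y = d y x"
  using gdist_sym_le by (simp add: order_antisym)

lemma gdist_step: "(a, b) \<in> parcs G \<Longrightarrow> x \<in> V \<Longrightarrow> d x b \<le> d x a + 1"
  using gdist_step_left[of a b x] gdist_sym[of x] arc_verts[of a b] by simp

lemma gdist_triangle: "x \<in> V \<Longrightarrow> y \<in> V \<Longrightarrow> z \<in> V \<Longrightarrow> d x z \<le> d x y + d y z"
  using lipschitz[of y z "d x"] gdist_step by simp

lemma gdist_arc: "(a, b) \<in> parcs G \<Longrightarrow> d a b \<le> 1"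
  using gdist_step[of a b a] arc_verts[of a b] by simp

lemma gdist_Suc_nbr:
  assumes "t \<in> V" "x \<in> V" "d t x = Suc n"
  shows "\<exists>y. (y, x) \<in> parcs G \<and> d t y = n"
proof -
  obtain p where p: "walk G x p t" "length p = Suc n"
    using gdist_walk[OF assms(2,1)] gdist_sym[OF assms(1,2)] assms(3) by auto
  then obtain e p' where e: "p = e # p'" by (cases p) auto
  then have arc: "(x, snd e) \<in> parcs G" "walk G (snd e) p' t" "length p' = n"
    using p by (cases e; auto simp: walk_Cons)+
  have "d t (snd e) \<le> n"
    using gdist_le[OF arc(2)] arc gdist_sym[of t "snd e"] arc_verts[OF arc(1)] assms(1) by simp
  moreover have "Suc n \<le> d t (snd e) + 1"
    using gdist_step[OF arc_sym[OF arc(1)] assms(1)] assms(3) by simp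
  ultimately show ?thesis using arc_sym[OF arc(1)] by (intro exI[of _ "snd e"]) simp
qed

end

section \<open>Homomorphisms and Cartesian products\<close>

lemma gdist_map_le:
  assumes "connected_graph G" "connected_graph H" "x \<in> pverts G" "y \<in> pverts G" "\<phi> x \<in> pverts H"
    "\<And>a b. (a, b) \<in> parcs G \<Longrightarrow> (\<phi> a, \<phi> b) \<in> parcs H"
  shows "gdist H (\<phi> x) (\<phi> y) \<le> gdist G x y"
proof -
  obtain p where "walk G x p y" "length p = gdist G x y"
    using connected_graph.gdist_walk assms by metis
  then show ?thesis
    using connected_graph.gdist_le[OF assms(2) walk_map[of G x p y \<phi> H]] assms by simp
qed

lemma pverts_cart_prod [simp]: "pverts (G \<box> H) = pverts G \<times> pverts H"
  by (simp add: cart_prod_def)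

lemma parcs_cart_prod: "((v, w), (v', w')) \<in> parcs (G \<box> H) \<longleftrightarrow>
  (v = v' \<and> v \<in> pverts G \<and> (w, w') \<in> parcs H \<or> (v, v') \<in> parcs G \<and> w = w' \<and> w \<in> pverts H)"
  by (auto simp: cart_prod_def)

lemma connected_cart_prod:
  assumes "connected_graph G" "connected_graph H"
  shows "connected_graph (G \<box> H)"
proof -
  interpret G: connected_graph G by fact
  interpret H: connected_graph H by fact
  show ?thesis
  proof
    fix x y assume "(x, y) \<in> parcs (G \<box> H)"
    then show "x \<in> pverts (G \<box> H) \<and> y \<in> pverts (G \<box> H)" "(y, x) \<in> parcs (G \<box> H)"
      using G.arc_verts H.arc_verts G.arc_sym H.arc_sym
      by (cases x, cases y, fastforce simp: parcs_cart_prod)+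
  next
    fix x y assume xy: "x \<in> pverts (G \<box> H)" "y \<in> pverts (G \<box> H)"
    obtain v w v' w' where eq: "x = (v, w)" "y = (v', w')" by (cases x, cases y)
    obtain p p' where "walk G v p v'" "walk H w p' w'"
      using xy eq G.walk_ex H.walk_ex by fastforce
    then have "walk (G \<box> H) (v, w) (map (map_prod (\<lambda>a. (a, w)) (\<lambda>a. (a, w))) p) (v', w)"
      "walk (G \<box> H) (v', w) (map (map_prod (Pair v') (Pair v')) p') (v', w')"
      using xy eq by (auto intro!: walk_map[of G v p v' "\<lambda>a. (a, w)"] walk_map[of H w p' w' "Pair v'"]
        simp: parcs_cart_prod)
    then show "\<exists>p. walk (G \<box> H) x p y" unfolding eq by (blast intro: walk_append)
  qed
qed

text \<open>Fixing one coordinate embeds the other factor, which gives the upper bound. For the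
  lower bound, an arc moves only one coordinate, so the sum of the coordinate distances is a
  potential.\<close>

lemma gdist_cart_prod:
  assumes "connected_graph G" "connected_graph H"
    and "v \<in> pverts G" "v' \<in> pverts G" "w \<in> pverts H" "w' \<in> pverts H"
  shows "gdist (G \<box> H) (v, w) (v', w') = gdist G v v' + gdist H w w'"
proof -
  interpret G: connected_graph G by fact
  interpret H: connected_graph H by fact
  interpret GH: connected_graph "G \<box> H" using assms by (intro connected_cart_prod)
  have "gdist (G \<box> H) (v, w) (v', w') \<le> gdist (G \<box> H) (v, w) (v', w) + gdist (G \<box> H) (v', w) (v', w')"
    using assms by (intro GH.gdist_triangle) auto
  moreover have "gdist (G \<box> H) (v, w) (v', w) \<le> gdist G v v'"
    using assms by (intro gdist_map_le[of G "G \<box> H" v v' "\<lambda>a. (a, w)"])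
      (auto simp: parcs_cart_prod GH.connected_graph_axioms)
  moreover have "gdist (G \<box> H) (v', w) (v', w') \<le> gdist H w w'"
    using assms by (intro gdist_map_le[of H "G \<box> H" w w' "Pair v'"])
      (auto simp: parcs_cart_prod GH.connected_graph_axioms)
  moreover have "gdist G v (fst (v', w')) + gdist H w (snd (v', w'))
      \<le> gdist G v (fst (v, w)) + gdist H w (snd (v, w)) + gdist (G \<box> H) (v, w) (v', w')"
  proof (rule GH.lipschitz[where \<phi> = "\<lambda>z. gdist G v (fst z) + gdist H w (snd z)"])
    fix a b assume "(a, b) \<in> parcs (G \<box> H)"
    then show "gdist G v (fst b) + gdist H w (snd b) \<le> gdist G v (fst a) + gdist H w (snd a) + 1"
      using G.gdist_step[of "fst a" "fst b" v] H.gdist_step[of "snd a" "snd b" w] assms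
      by (cases a, cases b) (auto simp: parcs_cart_prod)
  qed (use assms in auto)
  ultimately show ?thesis using assms by simp
qed

section \<open>Partitions\<close>

text \<open>Finite partitions as an inductive predicate: properties of the pieces pass to the whole
  by rule induction, without an index set.\<close>

inductive parts :: "('a set \<Rightarrow> bool) \<Rightarrow> 'a set \<Rightarrow> bool" for Q where
  parts_empty: "parts Q {}"
| parts_insert: "parts Q X \<Longrightarrow> Q Y \<Longrightarrow> X \<inter> Y = {} \<Longrightarrow> parts Q (X \<union> Y)"

lemma parts_single: "Q Y \<Longrightarrow> parts Q Y"
  using parts_insert[OF parts_empty, of Q Y] by simp

lemma parts_Un: "parts Q Y \<Longrightarrow> parts Q X \<Longrightarrow> X \<inter> Y = {} \<Longrightarrow> parts Q (X \<union> Y)"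
proof (induction rule: parts.induct)
  case (parts_insert Y Z)
  then have "parts Q (X \<union> Y)" by auto
  then have "parts Q ((X \<union> Y) \<union> Z)" by (rule parts.parts_insert) (use parts_insert in auto)
  then show ?case by (simp add: Un_assoc)
qed simp

lemma parts_UN:
  assumes "finite I" "\<And>i. i \<in> I \<Longrightarrow> parts Q (A i)"
    "\<And>i j. i \<in> I \<Longrightarrow> j \<in> I \<Longrightarrow> i \<noteq> j \<Longrightarrow> A i \<inter> A j = {}"
  shows "parts Q (\<Union>i\<in>I. A i)"
  using assms
proof (induction I rule: finite_induct)
  case (insert i I)
  have "A i \<inter> A j = {}" if "j \<in> I" for j using that insert by (metis insertCI)
  then have "parts Q (A i \<union> (\<Union>i\<in>I. A i))" using insert by (intro parts_Un) auto
  then show ?case by simp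
qed (simp add: parts_empty)

lemma parts_refine: "parts Q X \<Longrightarrow> (\<And>Y. Q Y \<Longrightarrow> parts Q' Y) \<Longrightarrow> parts Q' X"
  by (induction rule: parts.induct) (auto intro: parts_empty parts_Un)

section \<open>Rooted trees\<close>

text \<open>Acyclicity in the form that every edge is a bridge, with \<open>S\<close> the side of
  \<open>x\<close>. This form passes to subdivisions and yields exact distances.\<close>

locale bridged_graph = connected_graph +
  assumes finite_verts: "finite (pverts G)"
    and bridge: "(x, y) \<in> parcs G \<Longrightarrow> \<exists>S. x \<in> S \<and> y \<notin> S \<and>
      (\<forall>a b. (a, b) \<in> parcs G \<and> a \<in> S \<and> b \<notin> S \<longrightarrow> a = x \<and> b = y)"
begin

text \<open>A walk leaving \<open>S\<close> must use the arc \<open>(x, y)\<close>. Instead of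
  cutting walks, the lower bound uses the potential \<open>\<phi>\<close>, which the single crossing
  arc keeps from growing by more than one per step.\<close>

lemma bridge_gdist:
  assumes xy: "(x, y) \<in> parcs G" "x \<in> S" "y \<notin> S"
    and S: "\<forall>a b. (a, b) \<in> parcs G \<and> a \<in> S \<and> b \<notin> S \<longrightarrow> a = x \<and> b = y"
    and az: "a \<in> V" "a \<in> S" "z \<in> V" "z \<notin> S"
  shows "d a z = d a x + 1 + d y z"
proof -
  have v: "x \<in> V" "y \<in> V" using arc_verts[OF xy(1)] by auto
  have "d a z \<le> d a x + d x z" "d x z \<le> d x y + d y z" "d x y \<le> 1"
    using gdist_triangle az v gdist_arc[OF xy(1)] by auto
  moreover define \<phi> where "\<phi> b = (if b \<in> S then d a b else d a x + 1 + d y b)" for b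
  have "\<phi> z \<le> \<phi> a + d a z"
  proof (rule lipschitz[OF az(1,3)])
    fix b b' assume bb: "(b, b') \<in> parcs G"
    consider "b \<in> S" "b' \<in> S" | "b \<notin> S" "b' \<notin> S" | "b \<in> S" "b' \<notin> S" | "b \<notin> S" "b' \<in> S" by blast
    then show "\<phi> b' \<le> \<phi> b + 1"
    proof cases
      case 1
      then show ?thesis using gdist_step[OF bb az(1)] by (simp add: \<phi>_def)
    next
      case 2
      then show ?thesis using gdist_step[OF bb v(2)] by (simp add: \<phi>_def)
    next
      case 3
      then have "b = x" "b' = y" using S bb by auto
      then show ?thesis using 3 v by (simp add: \<phi>_def)
    next
      case 4
      then have "b' = x" "b = y" using S arc_sym[OF bb] by auto
      then show ?thesis using 4 v by (simp add: \<phi>_def)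
    qed
  qed
  ultimately show ?thesis using az by (simp add: \<phi>_def)
qed

end

locale rooted_tree = bridged_graph +
  fixes t
  assumes root: "t \<in> pverts G"
begin

definition "child x y \<longleftrightarrow> (x, y) \<in> parcs G \<and> d t y = d t x + 1"

text \<open>The bridge separates the root from one of the two ends, which is then the child.\<close>

lemma arc_child: "(x, y) \<in> parcs G \<Longrightarrow> child x y \<or> child y x"
proof -
  assume xy: "(x, y) \<in> parcs G"
  obtain S where S: "x \<in> S" "y \<notin> S" "\<forall>a b. (a, b) \<in> parcs G \<and> a \<in> S \<and> b \<notin> S \<longrightarrow> a = x \<and> b = y"
    using bridge[OF xy] by blast
  have v: "x \<in> V" "y \<in> V" using arc_verts[OF xy] by auto
  show ?thesis
  proof (cases "t \<in> S")
    case True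
    then show ?thesis
      using bridge_gdist[OF xy S root True v(2) S(2)] v xy by (simp add: child_def)
  next
    case False
    then show ?thesis
      using bridge_gdist[OF xy S v(1) S(1) root False] v xy arc_sym[OF xy] gdist_sym[OF root] root
      by (simp add: child_def)
  qed
qed

text \<open>Cut at the bridge from \<open>x\<close> to \<open>y\<close>. A second parent lies beyond
  it and so is farther from the root than \<open>x\<close>, although both are one step closer than
  \<open>y\<close>.\<close>

lemma parent_unique: "child x y \<Longrightarrow> child x' y \<Longrightarrow> x = x'"
proof (rule ccontr)
  assume c: "child x y" "child x' y" and ne: "x \<noteq> x'"
  have xy: "(x, y) \<in> parcs G" and x'y: "(x', y) \<in> parcs G" using c by (auto simp: child_def)
  obtain S where S: "x \<in> S" "y \<notin> S" "\<forall>a b. (a, b) \<in> parcs G \<and> a \<in> S \<and> b \<notin> S \<longrightarrow> a = x \<and> b = y"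
    using bridge[OF xy] by blast
  have v: "x \<in> V" "y \<in> V" "x' \<in> V" using arc_verts[OF xy] arc_verts[OF x'y] by auto
  have tS: "t \<in> S"
  proof (rule ccontr)
    assume "t \<notin> S"
    then have "d x t = d x x + 1 + d y t" by (rule bridge_gdist[OF xy S v(1) S(1) root])
    then show False using c v gdist_sym[OF root] root by (simp add: child_def)
  qed
  have "x' \<notin> S" using S(2,3) x'y ne by blast
  then have "d t x' = d t x + 1 + d y x'" by (rule bridge_gdist[OF xy S root tS v(3)])
  then show False using c by (simp add: child_def)
qed

lemma child_verts: "child x y \<Longrightarrow> x \<in> V \<and> y \<in> V"
  using arc_verts by (auto simp: child_def)

definition "desc x = {y. child\<^sup>*\<^sup>* x y}"

lemma desc_refl [simp]: "x \<in> desc x" by (simp add: desc_def)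

lemma desc_child: "z \<in> desc x \<Longrightarrow> child z y \<Longrightarrow> y \<in> desc x"
  unfolding desc_def by (simp add: rtranclp.rtrancl_into_rtrancl)

lemma desc_induct [consumes 1, case_names refl step]:
  assumes "y \<in> desc x" "P x" "\<And>z y. z \<in> desc x \<Longrightarrow> child z y \<Longrightarrow> P z \<Longrightarrow> P y"
  shows "P y"
proof -
  have "child\<^sup>*\<^sup>* x y" using assms(1) by (simp add: desc_def)
  then show ?thesis by (induction rule: rtranclp_induct) (use assms in \<open>auto simp: desc_def\<close>)
qed

lemma desc_verts: "y \<in> desc x \<Longrightarrow> x \<in> V \<Longrightarrow> y \<in> V"
  by (induction rule: desc_induct) (auto dest: child_verts)

lemma desc_dep: "y \<in> desc x \<Longrightarrow> y = x \<or> d t x < d t y"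
  by (induction rule: desc_induct) (auto simp: child_def)

lemma desc_last: "y \<in> desc x \<Longrightarrow> y = x \<or> (\<exists>z\<in>desc x. child z y)"
  by (induction rule: desc_induct) auto

lemma desc_unfold: "desc x = insert x (\<Union>y\<in>{y. child x y}. desc y)"
proof -
  have "child\<^sup>*\<^sup>* x z \<longleftrightarrow> z = x \<or> (\<exists>y. child x y \<and> child\<^sup>*\<^sup>* y z)" for z
    by (metis converse_rtranclpE converse_rtranclp_into_rtranclp rtranclp.rtrancl_refl)
  then show ?thesis by (auto simp: desc_def)
qed

text \<open>Two descents to a common vertex agree backwards, parents being unique, so they pass the
  same vertex at each depth.\<close>

lemma ancestor_unique: "z \<in> desc x \<Longrightarrow> z \<in> desc y \<Longrightarrow> d t x = d t y \<Longrightarrow> x = y"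
proof (induction rule: desc_induct)
  case refl
  then show ?case using desc_dep[of x y] by auto
next
  case (step z w)
  have "w \<noteq> y" using desc_dep[OF step.hyps(1)] step.hyps(2) step.prems by (auto simp: child_def)
  then obtain z' where "z' \<in> desc y" "child z' w" using desc_last[OF step.prems(1)] by auto
  then show ?case using parent_unique[OF step.hyps(2)] step by blast
qed

lemma siblings_disjoint: "child x y \<Longrightarrow> child x z \<Longrightarrow> y \<noteq> z \<Longrightarrow> desc y \<inter> desc z = {}"
  using ancestor_unique[of _ y z] by (auto simp: child_def)

lemma desc_root: "desc t = V"
proof
  show "desc t \<subseteq> V" using desc_verts root by blast
  show "V \<subseteq> desc t"
  proof
    fix x assume "x \<in> V"
    then show "x \<in> desc t"
    proof (induction "d t x" arbitrary: x)
      case 0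
      then have "x = t" using gdist_eq_0[OF root, of x] by simp
      then show ?case by simp
    next
      case (Suc n)
      then obtain y where y: "(y, x) \<in> parcs G" "d t y = n" using gdist_Suc_nbr[OF root, of x n] by auto
      then have "y \<in> desc t" using Suc.hyps(1) arc_verts by auto
      moreover have "child y x" using y Suc.hyps(2) by (simp add: child_def)
      ultimately show ?case by (rule desc_child)
    qed
  qed
qed

definition "chain xs \<longleftrightarrow> xs \<noteq> [] \<and> set xs \<subseteq> V \<and> (\<forall>i. Suc i < length xs \<longrightarrow> child (xs ! i) (xs ! Suc i))"

lemma chain_Cons: "chain ys \<Longrightarrow> child x (hd ys) \<Longrightarrow> chain (x # ys)"
  unfolding chain_def using child_verts
  by (auto simp: nth_Cons' hd_conv_nth split: nat.split) (metis Suc_pred less_SucE not_less_eq Suc_lessI gr0_conv_Suc diff_Suc_1)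

lemma chain_dep: "chain xs \<Longrightarrow> i < length xs \<Longrightarrow> d t (xs ! i) = d t (hd xs) + i"
proof (induction i)
  case 0
  then show ?case by (simp add: hd_conv_nth chain_def)
next
  case (Suc i)
  then have "child (xs ! i) (xs ! Suc i)" by (simp add: chain_def)
  then show ?case using Suc by (simp add: child_def)
qed

lemma chain_gdist_le: "chain xs \<Longrightarrow> i + k < length xs \<Longrightarrow> d (xs ! i) (xs ! (i + k)) \<le> k"
proof (induction k)
  case 0
  then have "xs ! i \<in> V" unfolding chain_def by (auto dest: nth_mem)
  then show ?case by simp
next
  case (Suc k)
  then have c: "child (xs ! (i + k)) (xs ! Suc (i + k))" by (simp add: chain_def)
  have "xs ! i \<in> V" using Suc.prems unfolding chain_def by (auto dest: nth_mem)
  then have "d (xs ! i) (xs ! Suc (i + k)) \<le> d (xs ! i) (xs ! (i + k)) + 1"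
    using c by (intro gdist_step) (auto simp: child_def)
  then show ?case using Suc by simp
qed

text \<open>Depth grows by one per step, and the triangle inequality at the root rules out a
  shortcut.\<close>

lemma chain_gdist:
  assumes "chain xs" "i < length xs" "j < length xs"
  shows "d (xs ! i) (xs ! j) = ad i j"
proof -
  have v: "xs ! k \<in> V" if "k < length xs" for k using assms(1) that unfolding chain_def by (auto dest: nth_mem)
  have *: "d (xs ! i) (xs ! j) = j - i" if "i \<le> j" "j < length xs" for i j
  proof -
    have "d (xs ! i) (xs ! j) \<le> j - i" using chain_gdist_le[OF assms(1), of i "j - i"] that by simp
    moreover have "d t (xs ! j) \<le> d t (xs ! i) + d (xs ! i) (xs ! j)"
      using that v root by (intro gdist_triangle) auto
    ultimately show ?thesis using chain_dep[OF assms(1)] that by simp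
  qed
  show ?thesis
    using *[of i j] *[of j i] gdist_sym[OF v v, of i j] assms by (auto simp: ad_def)
qed

text \<open>At most one neighbour, so that \<open>childless_leaf\<close> involves no degrees;
  \<open>leaf_rep\<close> makes the connection to \<open>leaves\<close>.\<close>

definition "leaf v \<longleftrightarrow> v \<in> V \<and> (\<exists>w. \<forall>u. (v, u) \<in> parcs G \<longrightarrow> u = w)"

lemma childless_leaf: "x \<in> V \<Longrightarrow> x \<noteq> t \<Longrightarrow> (\<And>y. \<not> child x y) \<Longrightarrow> leaf x"
proof -
  assume x: "x \<in> V" "x \<noteq> t" and c: "\<And>y. \<not> child x y"
  have "child u x" if "(x, u) \<in> parcs G" for u using arc_child[OF that] c by blast
  then show ?thesis using x(1) parent_unique unfolding leaf_def by metis
qed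

text \<open>The bridge from \<open>t\<close> to \<open>y\<close> has \<open>desc y\<close> on one
  side, and \<open>t\<close> with \<open>desc z\<close> on the other.\<close>

lemma cross_gdist:
  assumes c: "child t y" "child t z" "y \<noteq> z" and u: "u \<in> desc y" "v \<in> desc z"
  shows "d u v = d t u + d t v"
proof -
  have ty: "(t, y) \<in> parcs G" using c by (simp add: child_def)
  obtain S where S: "t \<in> S" "y \<notin> S" "\<forall>a b. (a, b) \<in> parcs G \<and> a \<in> S \<and> b \<notin> S \<longrightarrow> a = t \<and> b = y"
    using bridge[OF ty] by blast
  have V: "y \<in> V" "z \<in> V" "u \<in> V" "v \<in> V" using c child_verts desc_verts u by blast+
  have dep1: "d t y = 1" "d t z = 1" using c root by (simp_all add: child_def)
  have "u \<notin> S" using u(1)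
  proof (induction rule: desc_induct)
    case (step a b)
    show ?case
    proof
      assume "b \<in> S"
      then have "b = t" using S(3) step arc_sym[of a b] unfolding child_def by blast
      then show False using step(2) root by (simp add: child_def)
    qed
  qed (rule S)
  moreover have "v \<in> S" using u(2)
  proof (induction rule: desc_induct)
    case refl
    then show ?case using S c unfolding child_def by blast
  next
    case (step a b)
    have "a \<noteq> t" using desc_dep[OF step(1)] dep1 root by auto
    then show ?case using S(3) step unfolding child_def by blast
  qed
  ultimately have "d v u = d v t + 1 + d y u"
    using bridge_gdist[OF ty S] V by blast
  moreover have "d t u = d t t + 1 + d y u"
    using bridge_gdist[OF ty S root S(1) V(3)] \<open>u \<notin> S\<close> by blast
  ultimately show ?thesis using gdist_sym V root by simp
qed

definition "long_chain L Y \<longleftrightarrow> (\<exists>xs. chain xs \<and> L \<le> length xs \<and> set xs = Y)"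

context
  fixes L K :: nat
  assumes L: "2 * L \<le> K + 1" "1 \<le> K" and sep: "\<And>u v. leaf u \<Longrightarrow> leaf v \<Longrightarrow> u \<noteq> v \<Longrightarrow> K \<le> d u v"
begin

text \<open>The chain of \<open>x\<close> extends the shortest chain of its children. Any other
  child's chain forms with the shortest one a path between two leaves through \<open>x\<close>, so
  its length is at least \<open>K / 2\<close>, hence at least \<open>L\<close>, and it becomes a
  finished piece. Only the chain starting at \<open>x\<close> has no length bound yet.\<close>

lemma desc_decomposition:
  assumes "x \<in> V"
  shows "\<exists>xs Y. chain xs \<and> hd xs = x \<and> (\<forall>y. \<not> child (last xs) y) \<and> desc x = set xs \<union> Y \<and>
    set xs \<inter> Y = {} \<and> parts (long_chain L) Y"
  using assms
proof (induction "card (desc x)" arbitrary: x rule: less_induct)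
  case less
  have fin: "finite (desc x)" using desc_verts less.prems finite_subset[OF _ finite_verts] by blast
  define Ch where "Ch = {y. child x y}"
  have "Ch \<subseteq> desc x" unfolding Ch_def using desc_child desc_refl by blast
  then have fCh: "finite Ch" using fin finite_subset by blast
  note unf = desc_unfold[of x, folded Ch_def]
  have x_notin: "x \<notin> desc y" if "y \<in> Ch" for y
    using that desc_dep[of x y] by (auto simp: Ch_def child_def)
  have ChV: "y \<in> V" if "y \<in> Ch" for y using that child_verts by (auto simp: Ch_def)
  show ?case
  proof (cases "Ch = {}")
    case True
    have "chain [x]" using less.prems by (simp add: chain_def)
    moreover have "desc x = {x}" using unf True by simp
    ultimately show ?thesis
      using True parts_empty by (intro exI[of _ "[x]"] exI[of _ "{}"]) (auto simp: Ch_def)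
  next
    case False
    have "\<exists>xs Y. chain xs \<and> hd xs = y \<and> (\<forall>z. \<not> child (last xs) z) \<and> desc y = set xs \<union> Y \<and>
      set xs \<inter> Y = {} \<and> parts (long_chain L) Y" if y: "y \<in> Ch" for y
    proof (rule less.hyps[OF _ ChV[OF y]])
      have "desc y \<subset> desc x" using unf y x_notin[OF y] by auto
      then show "card (desc y) < card (desc x)" using fin psubset_card_mono by blast
    qed
    then obtain xs Y where IH: "\<And>y. y \<in> Ch \<Longrightarrow> chain (xs y) \<and> hd (xs y) = y \<and>
      (\<forall>z. \<not> child (last (xs y)) z) \<and> desc y = set (xs y) \<union> Y y \<and> set (xs y) \<inter> Y y = {} \<and>
      parts (long_chain L) (Y y)" by metis
    obtain y0 where y0: "y0 \<in> Ch" "\<And>y. y \<in> Ch \<Longrightarrow> length (xs y0) \<le> length (xs y)"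
      using arg_min_nat_lemma[of "\<lambda>y. y \<in> Ch" _ "\<lambda>y. length (xs y)"] False by blast
    have down: "chain (x # xs y)" if "y \<in> Ch" for y
      using IH[OF that] that by (intro chain_Cons) (auto simp: Ch_def)
    have lf: "leaf (last (xs y))" "d x (last (xs y)) = length (xs y)" "last (xs y) \<in> desc y" if y: "y \<in> Ch" for y
    proof -
      have ne: "xs y \<noteq> []" using IH[OF y] by (simp add: chain_def)
      then have "last (xs y) \<in> set (xs y)" by simp
      then show in_desc: "last (xs y) \<in> desc y" using IH[OF y] by blast
      have "d t x < d t y" using y by (simp add: Ch_def child_def)
      then have "last (xs y) \<noteq> t" using desc_dep[OF in_desc] root by auto
      moreover have "last (xs y) \<in> V" using desc_verts[OF in_desc ChV[OF y]] .
      ultimately show "leaf (last (xs y))" using childless_leaf IH[OF y] by blast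
      have "d ((x # xs y) ! 0) ((x # xs y) ! length (xs y)) = ad 0 (length (xs y))"
        by (rule chain_gdist[OF down[OF y]]) auto
      moreover have "(x # xs y) ! length (xs y) = last (xs y)"
        using ne by (simp add: last_conv_nth nth_Cons')
      ultimately show "d x (last (xs y)) = length (xs y)" by simp
    qed
    have sib: "desc y \<inter> desc z = {}" if "y \<in> Ch" "z \<in> Ch" "y \<noteq> z" for y z
      using that siblings_disjoint by (auto simp: Ch_def)
    have long: "L \<le> length (xs y)" if y: "y \<in> Ch" "y \<noteq> y0" for y
    proof -
      have "last (xs y) \<noteq> last (xs y0)" using lf(3)[OF y(1)] lf(3)[OF y0(1)] sib[OF y(1) y0(1) y(2)] by auto
      then have "K \<le> d (last (xs y)) (last (xs y0))" using sep lf y y0 by blast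
      also have "\<dots> \<le> d (last (xs y)) x + d x (last (xs y0))"
        using lf y y0 less.prems by (intro gdist_triangle) (auto simp: leaf_def)
      also have "\<dots> = length (xs y) + length (xs y0)"
        using lf y y0 less.prems gdist_sym by (auto simp: leaf_def)
      also have "\<dots> \<le> 2 * length (xs y)" using y0 y by simp
      finally show ?thesis using L by simp
    qed
    have parts_desc: "parts (long_chain L) (desc y)" if y: "y \<in> Ch" "y \<noteq> y0" for y
    proof -
      have "long_chain L (set (xs y))" using IH[OF y(1)] long[OF y] by (auto simp: long_chain_def)
      then have "parts (long_chain L) (Y y \<union> set (xs y))"
        using IH[OF y(1)] by (intro parts.parts_insert) auto
      then show ?thesis using IH[OF y(1)] by (simp add: Un_commute)
    qed
    define Z where "Z = Y y0 \<union> (\<Union>y\<in>Ch - {y0}. desc y)"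
    have disjY: "Y y0 \<inter> (\<Union>y\<in>Ch - {y0}. desc y) = {}" "set (xs y0) \<inter> (\<Union>y\<in>Ch - {y0}. desc y) = {}"
      using IH[OF y0(1)] sib[OF y0(1)] by blast+
    have "parts (long_chain L) (\<Union>y\<in>Ch - {y0}. desc y)"
      using fCh parts_desc sib by (intro parts_UN) auto
    then have "parts (long_chain L) Z" unfolding Z_def using IH[OF y0(1)] disjY by (intro parts_Un) auto
    moreover have "desc x = set (x # xs y0) \<union> Z"
    proof -
      have "desc x = insert x (desc y0 \<union> (\<Union>y\<in>Ch - {y0}. desc y))" using unf y0(1) by auto
      then show ?thesis using IH[OF y0(1)] by (auto simp: Z_def)
    qed
    moreover have "set (x # xs y0) \<inter> Z = {}"
      using x_notin y0(1) IH[OF y0(1)] disjY by (auto simp: Z_def)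
    moreover have "\<forall>z. \<not> child (last (x # xs y0)) z"
      using IH[OF y0(1)] by (auto simp: chain_def)
    ultimately show ?thesis
      using down[OF y0(1)] by (intro exI[of _ "x # xs y0"] exI[of _ Z]) auto
  qed
qed

text \<open>If the shortest chain below the root is long enough with the root added, it is a piece
  like the others. Otherwise it is joined across the root to another child's chain: the result has
  at least \<open>K + 1\<close> vertices, with the root among the first \<open>L\<close>.\<close>

lemma root_decomposition:
  assumes ne: "\<exists>u\<in>V. u \<noteq> t"
  shows "parts (long_chain L) V \<or>
    (\<exists>xs m. set xs \<subseteq> V \<and> 2 * L \<le> length xs \<and> m < L \<and> xs ! m = t \<and>
      geodesic d (nth xs) {0..<length xs} \<and> parts (long_chain L) (V - set xs))"
proof -
  define Ch where "Ch = {y. child t y}"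
  have ChV: "y \<in> V" if "y \<in> Ch" for y using that child_verts by (auto simp: Ch_def)
  have fCh: "finite Ch" using ChV finite_subset[OF _ finite_verts] by blast
  have V_eq: "V = insert t (\<Union>y\<in>Ch. desc y)" using desc_unfold[of t] desc_root by (simp add: Ch_def)
  have Ch_ne: "Ch \<noteq> {}" using ne V_eq by auto
  have t_notin: "t \<notin> desc y" if "y \<in> Ch" for y
    using that desc_dep[of t y] root by (auto simp: Ch_def child_def)
  have "\<exists>xs Y. chain xs \<and> hd xs = y \<and> (\<forall>z. \<not> child (last xs) z) \<and> desc y = set xs \<union> Y \<and>
      set xs \<inter> Y = {} \<and> parts (long_chain L) Y" if "y \<in> Ch" for y
    using desc_decomposition[OF ChV[OF that]] .
  then obtain xs Y where D: "\<And>y. y \<in> Ch \<Longrightarrow> chain (xs y) \<and> hd (xs y) = y \<and>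
      (\<forall>z. \<not> child (last (xs y)) z) \<and> desc y = set (xs y) \<union> Y y \<and> set (xs y) \<inter> Y y = {} \<and>
      parts (long_chain L) (Y y)" by metis
  obtain y0 where y0: "y0 \<in> Ch" "\<And>y. y \<in> Ch \<Longrightarrow> length (xs y0) \<le> length (xs y)"
    using arg_min_nat_lemma[of "\<lambda>y. y \<in> Ch" _ "\<lambda>y. length (xs y)"] Ch_ne by blast
  have down: "chain (t # xs y)" if "y \<in> Ch" for y
    using D[OF that] that by (intro chain_Cons) (auto simp: Ch_def)
  have lf: "leaf (last (xs y))" "d t (last (xs y)) = length (xs y)" "last (xs y) \<in> desc y"
    "last (xs y) \<noteq> t" if y: "y \<in> Ch" for y
  proof -
    have ne: "xs y \<noteq> []" using D[OF y] by (simp add: chain_def)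
    then have "last (xs y) \<in> set (xs y)" by simp
    then show in_desc: "last (xs y) \<in> desc y" using D[OF y] by blast
    then show "last (xs y) \<noteq> t" using t_notin[OF y] by auto
    moreover have "last (xs y) \<in> V" using desc_verts[OF in_desc ChV[OF y]] .
    ultimately show "leaf (last (xs y))" using childless_leaf D[OF y] by blast
    have "d ((t # xs y) ! 0) ((t # xs y) ! length (xs y)) = ad 0 (length (xs y))"
      by (rule chain_gdist[OF down[OF y]]) auto
    moreover have "(t # xs y) ! length (xs y) = last (xs y)"
      using ne by (simp add: last_conv_nth nth_Cons')
    ultimately show "d t (last (xs y)) = length (xs y)" by simp
  qed
  have sib: "desc y \<inter> desc z = {}" if "y \<in> Ch" "z \<in> Ch" "y \<noteq> z" for y z
    using that siblings_disjoint by (auto simp: Ch_def)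
  have sum_len: "K \<le> length (xs y) + length (xs y0)" if y: "y \<in> Ch" "y \<noteq> y0" for y
  proof -
    have "last (xs y) \<noteq> last (xs y0)" using lf(3)[OF y(1)] lf(3)[OF y0(1)] sib[OF y(1) y0(1) y(2)] by auto
    then have "K \<le> d (last (xs y)) (last (xs y0))" using sep lf(1) y y0 by blast
    also have "\<dots> = length (xs y) + length (xs y0)"
      using cross_gdist[of y y0 "last (xs y)" "last (xs y0)"] lf(2,3) y y0 by (auto simp: Ch_def)
    finally show ?thesis .
  qed
  have parts_desc: "parts (long_chain L) (desc y)" if y: "y \<in> Ch" "y \<noteq> y0" for y
  proof -
    have "L \<le> length (xs y)" using sum_len[OF y] y0(2)[OF y(1)] L by linarith
    then have "long_chain L (set (xs y))" using D[OF y(1)] by (auto simp: long_chain_def)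
    then have "parts (long_chain L) (Y y \<union> set (xs y))"
      using D[OF y(1)] by (intro parts.parts_insert) auto
    then show ?thesis using D[OF y(1)] by (simp add: Un_commute)
  qed
  show ?thesis
  proof (cases "L \<le> Suc (length (xs y0))")
    case True
    define Z where "Z = Y y0 \<union> (\<Union>y\<in>Ch - {y0}. desc y)"
    have "parts (long_chain L) (\<Union>y\<in>Ch - {y0}. desc y)"
      using fCh parts_desc sib by (intro parts_UN) auto
    moreover have disjY: "Y y0 \<inter> (\<Union>y\<in>Ch - {y0}. desc y) = {}" "set (xs y0) \<inter> (\<Union>y\<in>Ch - {y0}. desc y) = {}"
      using D[OF y0(1)] sib[OF y0(1)] by blast+
    ultimately have "parts (long_chain L) Z" unfolding Z_def using D[OF y0(1)] by (intro parts_Un) auto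
    moreover have "long_chain L (set (t # xs y0))"
      using down[OF y0(1)] True unfolding long_chain_def by (intro exI[of _ "t # xs y0"]) simp
    moreover have "Z \<inter> set (t # xs y0) = {}"
      using t_notin y0(1) D[OF y0(1)] disjY by (auto simp: Z_def)
    ultimately have "parts (long_chain L) (Z \<union> set (t # xs y0))" by (rule parts.parts_insert)
    moreover have "Z \<union> set (t # xs y0) = V"
    proof -
      have "V = insert t (desc y0 \<union> (\<Union>y\<in>Ch - {y0}. desc y))" using V_eq y0(1) by auto
      then show ?thesis using D[OF y0(1)] by (auto simp: Z_def)
    qed
    ultimately show ?thesis by simp
  next
    case False
    \<comment> \<open>With a single child the root would itself be a leaf, and the chain below it
      would end in a leaf at distance at least \<open>K\<close>, too long for this case.\<close>
    have "Ch \<noteq> {y0}"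
    proof
      assume one: "Ch = {y0}"
      have "u = y0" if "(t, u) \<in> parcs G" for u
        using arc_child[OF that] one root by (auto simp: Ch_def child_def)
      then have "leaf t" using root by (auto simp: leaf_def)
      then have "K \<le> length (xs y0)" using sep[of t "last (xs y0)"] lf[OF y0(1)] by auto
      then show False using False L by linarith
    qed
    then obtain y1 where y1: "y1 \<in> Ch" "y1 \<noteq> y0" using y0(1) by blast
    define m where "m = length (xs y0)"
    define C where "C = rev (xs y0) @ t # xs y1"
    have len: "length C = m + 1 + length (xs y1)" by (simp add: C_def m_def)
    have C_nth: "C ! i = (if i < m then xs y0 ! (m - Suc i) else (t # xs y1) ! (i - m))" if "i < length C" for i
      using that by (auto simp: C_def m_def nth_append rev_nth)
    have C0: "C ! i = (t # xs y0) ! (m - i)" if "i \<le> m" for i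
      using that C_nth[of i] len by (cases "i = m") (auto simp: nth_Cons')
    have C1: "C ! i = (t # xs y1) ! (i - m)" if "m \<le> i" "i < length C" for i
      using that C_nth[of i] by auto
    have in_desc: "C ! i \<in> desc y0" "d t (C ! i) = m - i" if "i < m" for i
    proof -
      have "C ! i \<in> set (xs y0)" using that C_nth[of i] len by (auto simp: m_def)
      then show "C ! i \<in> desc y0" using D[OF y0(1)] by blast
      show "d t (C ! i) = m - i"
        using chain_dep[OF down[OF y0(1)], of "m - i"] C0[of i] that root by (simp add: m_def)
    qed
    have in_desc1: "C ! j \<in> desc y1" "d t (C ! j) = j - m" if "m < j" "j < length C" for j
    proof -
      have "C ! j = xs y1 ! (j - m - 1)" using that C1[of j] by simp
      then have "C ! j \<in> set (xs y1)" using that len by (metis Suc_eq_plus1 Suc_leI add_Suc_shift diff_diff_left less_diff_conv2 nth_mem add.commute less_imp_le_nat)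
      then show "C ! j \<in> desc y1" using D[OF y1(1)] by blast
      show "d t (C ! j) = j - m"
        using chain_dep[OF down[OF y1(1)], of "j - m"] C1[of j] that root len by simp
    qed
    have Cm: "C ! m = t" using C0[of m] by simp
    have CV: "set C \<subseteq> V"
      using D[OF y0(1)] D[OF y1(1)] root by (auto simp: C_def chain_def)
    have lt: "d (C ! i) (C ! j) = j - i" if ij: "i \<le> j" "j < length C" for i j
    proof -
      consider "j \<le> m" | "m \<le> i" | "i < m" "m < j" by linarith
      then show ?thesis
      proof cases
        case 1
        then show ?thesis
          using chain_gdist[OF down[OF y0(1)], of "m - i" "m - j"] C0[of i] C0[of j] ij
          by (auto simp: m_def ad_def)
      next
        case 2
        then show ?thesis
          using chain_gdist[OF down[OF y1(1)], of "i - m" "j - m"] C1[of i] C1[of j] ij len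
          by (auto simp: ad_def)
      next
        case 3
        then show ?thesis
          using cross_gdist[of y0 y1 "C ! i" "C ! j"] in_desc[of i] in_desc1[of j] y0(1) y1 ij by (auto simp: Ch_def)
      qed
    qed
    have "geodesic d (nth C) {0..<length C}"
      unfolding geodesic_def
    proof (intro ballI)
      fix i j assume ij: "i \<in> {0..<length C}" "j \<in> {0..<length C}"
      have v: "C ! i \<in> V" "C ! j \<in> V" using ij CV nth_mem by auto
      show "d (C ! i) (C ! j) = ad i j"
        using lt[of i j] lt[of j i] gdist_sym[OF v] ij by (auto simp: ad_def)
    qed
    moreover have "2 * L \<le> length C" using sum_len[OF y1] len L by (simp add: m_def)
    moreover have "parts (long_chain L) (V - set C)"
    proof -
      define W where "W = (\<Union>y\<in>Ch - {y0, y1}. desc y)"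
      have "parts (long_chain L) W"
        unfolding W_def using fCh parts_desc sib by (intro parts_UN) auto
      moreover have dW: "desc y0 \<inter> W = {}" "desc y1 \<inter> W = {}" "desc y0 \<inter> desc y1 = {}"
        using sib y0(1) y1 unfolding W_def by blast+
      moreover have dY: "Y y0 \<subseteq> desc y0" "Y y1 \<subseteq> desc y1" using D[OF y0(1)] D[OF y1(1)] by auto
      ultimately have "parts (long_chain L) (Y y0 \<union> (Y y1 \<union> W))"
        using D[OF y0(1)] D[OF y1(1)] by (intro parts_Un) auto
      moreover have "V - set C = Y y0 \<union> (Y y1 \<union> W)"
      proof -
        have V2: "V = insert t (desc y0 \<union> (desc y1 \<union> W))" using V_eq y0(1) y1(1) by (auto simp: W_def)
        have tW: "t \<notin> W" using t_notin by (auto simp: W_def)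
        have sC: "set C = insert t (set (xs y0) \<union> set (xs y1))" by (auto simp: C_def)
        have e: "desc y0 = set (xs y0) \<union> Y y0" "set (xs y0) \<inter> Y y0 = {}"
          "desc y1 = set (xs y1) \<union> Y y1" "set (xs y1) \<inter> Y y1 = {}" using D[OF y0(1)] D[OF y1(1)] by auto
        have "t \<notin> Y y0" "t \<notin> Y y1" using t_notin[OF y0(1)] t_notin[OF y1(1)] e by auto
        then show ?thesis using dW tW e(2,4) unfolding V2 sC e(1,3) by auto
      qed
      ultimately show ?thesis by simp
    qed
    ultimately show ?thesis using CV Cm False by (intro disjI2 exI[of _ C] exI[of _ m]) (auto simp: m_def)
  qed
qed

end

end

section \<open>Subdivisions of trees\<close>

lemma size_filter_subdiv_point:
  "i \<le> s \<Longrightarrow> size (filter_mset P (subdiv_point s u v i)) = (if P u then s - i else 0) + (if P v then i else 0)"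
proof -
  have "size (filter_mset P (replicate_mset n w)) = (if P w then n else 0)" for n w
    by (induction n) auto
  then show ?thesis by (simp add: subdiv_point_def)
qed

lemma subdiv_point_0 [simp]: "subdiv_point s u v 0 = replicate_mset s u"
  by (simp add: subdiv_point_def)

lemma subdiv_point_s [simp]: "subdiv_point s u v s = replicate_mset s v"
  by (simp add: subdiv_point_def)

text \<open>Summing over the barycentric coordinates extends a function on \<open>T\<close> to the
  subdivision by linear interpolation, scaled by \<open>s\<close>.\<close>

lemma sum_subdiv_point:
  "i \<le> s \<Longrightarrow> (\<Sum>w\<in>#subdiv_point s u v i. \<phi> w) = (s - i) * \<phi> u + i * (\<phi> v :: nat)"
  by (simp add: subdiv_point_def)

lemma tree_connected: "is_tree T \<Longrightarrow> connected_graph T"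
proof -
  assume T: "is_tree T"
  then interpret pair_graph T by (simp add: is_tree_def)
  have sc: "strongly_connected (mk_symmetric (with_proj T))" using T by (simp add: is_tree_def connected_def)
  \<comment> \<open>\<open>T\<close> is symmetric already, so \<open>mk_symmetric\<close> changes
    nothing.\<close>
  have eq: "parcs (mk_symmetric (with_proj T)) = parcs T" "pverts (mk_symmetric (with_proj T)) = pverts T"
    using pair_sym_arcs by (auto simp: mk_symmetric_def symmetric_def sym_def)
  show ?thesis
  proof
    fix x y assume "(x, y) \<in> parcs T"
    then show "x \<in> pverts T \<and> y \<in> pverts T" "(y, x) \<in> parcs T"
      using wellformed' pair_sym_arcs by (auto simp: symmetric_def sym_def)
  next
    fix x y assume xy: "x \<in> pverts T" "y \<in> pverts T"
    have "x \<rightarrow>\<^sup>*\<^bsub>mk_symmetric (with_proj T)\<^esub> y" using sc xy eq by (auto simp: strongly_connected_def)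
    then have "x \<rightarrow>\<^sup>*\<^bsub>with_proj T\<^esub> y" using eq by (simp add: reachable_def)
    then show "\<exists>p. walk T x p y" using reachable_awalk by blast
  qed
qed

text \<open>\<open>S\<close> is what paths from \<open>x\<close> reach without the arc
  \<open>(x, y)\<close>. If it contained \<open>y\<close>, such a path and the arc back would form a
  cycle.\<close>

lemma tree_bridge:
  assumes T: "is_tree T" and xy: "(x, y) \<in> parcs T"
  shows "\<exists>S. x \<in> S \<and> y \<notin> S \<and> (\<forall>a b. (a, b) \<in> parcs T \<and> a \<in> S \<and> b \<notin> S \<longrightarrow> a = x \<and> b = y)"
proof -
  interpret pair_graph T using T by (simp add: is_tree_def)
  interpret C: connected_graph T using tree_connected[OF T] .
  define S where "S = {w. \<exists>p. apath x p w \<and> (x, y) \<notin> set p}"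
  have xV: "x \<in> pverts T" "y \<in> pverts T" "x \<noteq> y" using C.arc_verts[OF xy] pair_no_loops[OF xy] by auto
  have "x \<in> S" using xV by (auto simp: S_def apath_Nil_iff intro!: exI[of _ "[]"])
  moreover have "y \<notin> S"
  proof
    assume "y \<in> S"
    then obtain p where p: "apath x p y" "(x, y) \<notin> set p" by (auto simp: S_def)
    then have w: "walk T x p y" and dist: "distinct (pawalk_verts x p)" by (auto simp: apath_def)
    \<comment> \<open>With two arcs in the path, the cycle reaches the length 3 demanded in
      \<open>is_tree\<close>.\<close>
    have len: "2 \<le> length p"
    proof (rule ccontr)
      assume "\<not> 2 \<le> length p"
      then consider "p = []" | e where "p = [e]" by (cases p; cases "tl p") auto
      then show False
      proof cases
        case 1
        then show False using w xV by simp
      next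
        case (2 e)
        then show False using w p(2) by (cases e) (auto simp: C.walk_Cons)
      qed
    qed
    have cyc: "walk T y ((y, x) # p) y" using w C.arc_sym[OF xy] by (simp add: C.walk_Cons)
    have "cycle ((y, x) # p)" unfolding cycle_def
      by (rule exI[of _ y]) (use cyc dist in auto)
    then show False using T len by (auto simp: is_tree_def intro!: exI[of _ "(y, x) # p"])
  qed
  moreover have "a = x \<and> b = y" if ab: "(a, b) \<in> parcs T" "a \<in> S" "b \<notin> S" for a b
  proof (rule ccontr)
    assume ne: "\<not> (a = x \<and> b = y)"
    obtain p where p: "apath x p a" "(x, y) \<notin> set p" using ab(2) by (auto simp: S_def)
    have w: "walk T x (p @ [(a, b)]) b"
    proof (rule walk_append)
      show "walk T x p a" using p by (simp add: apath_def)
      show "walk T a [(a, b)] b" using ab(1) C.arc_verts[OF ab(1)] by (simp add: C.walk_Cons)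
    qed
    have "apath x (awalk_to_apath (p @ [(a, b)])) b" using apath_awalk_to_apath[OF w] .
    moreover have "set (awalk_to_apath (p @ [(a, b)])) \<subseteq> set (p @ [(a, b)])" using awalk_to_apath_subset[OF w] .
    ultimately have "b \<in> S" using p(2) ne by (auto simp: S_def intro!: exI[of _ "awalk_to_apath (p @ [(a, b)])"])
    then show False using ab by simp
  qed
  ultimately show ?thesis by blast
qed

context
  fixes T :: "'a pair_pre_digraph" and s :: nat and T'
  assumes T: "is_tree T" and s: "s > 0" and T'_def: "T' = s_subdivision s T"
begin

interpretation pair_graph T using T by (simp add: is_tree_def)
interpretation C: connected_graph T using tree_connected[OF T] .

lemma verts': "pverts T' = {replicate_mset s v | v. v \<in> pverts T}
    \<union> {subdiv_point s u v i | u v i. (u, v) \<in> parcs T \<and> i \<le> s}"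
  by (simp add: T'_def s_subdivision_def)

text \<open>Reversing the edge turns the second kind of arc into the first, so later proofs treat
  one orientation only.\<close>

lemma arcs'D:
  assumes "(x, y) \<in> parcs T'"
  shows "\<exists>u v i. (u, v) \<in> parcs T \<and> i < s \<and> x = subdiv_point s u v i \<and> y = subdiv_point s u v (Suc i)"
proof -
  consider u v i where "(u, v) \<in> parcs T" "i < s" "x = subdiv_point s u v i" "y = subdiv_point s u v (Suc i)"
    | u v i where "(u, v) \<in> parcs T" "i < s" "y = subdiv_point s u v i" "x = subdiv_point s u v (Suc i)"
    using assms unfolding T'_def s_subdivision_def by auto
  then show ?thesis
  proof cases
    case 1
    then show ?thesis by blast
  next
    case (2 u v i)
    have "x = subdiv_point s v u (s - Suc i)" "y = subdiv_point s v u (s - i)"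
      using 2 subdiv_point_commute[of "Suc i" s v u] subdiv_point_commute[of i s v u] by auto
    moreover have "s - i = Suc (s - Suc i)" using 2(2) by simp
    ultimately show ?thesis
      using 2 C.arc_sym[OF 2(1)] by (intro exI[of _ v] exI[of _ u] exI[of _ "s - Suc i"]) simp
  qed
qed

lemma arcs'I:
  assumes "(u, v) \<in> parcs T" "i < s"
  shows "(subdiv_point s u v i, subdiv_point s u v (Suc i)) \<in> parcs T'"
    "(subdiv_point s u v (Suc i), subdiv_point s u v i) \<in> parcs T'"
  using assms unfolding T'_def s_subdivision_def by auto

lemma rep_in: "v \<in> pverts T \<Longrightarrow> replicate_mset s v \<in> pverts T'"
  by (auto simp: verts')

lemma walk_along:
  assumes uv: "(u, v) \<in> parcs T" and ij: "i + k \<le> s"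
  shows "\<exists>p. walk T' (subdiv_point s u v i) p (subdiv_point s u v (i + k)) \<and> length p = k"
  using ij
proof (induction k)
  case 0
  have "subdiv_point s u v i \<in> pverts T'" using uv 0 by (auto simp: verts')
  then show ?case by (intro exI[of _ "[]"]) simp
next
  case (Suc k)
  then obtain p where p: "walk T' (subdiv_point s u v i) p (subdiv_point s u v (i + k))" "length p = k" by auto
  have "walk T' (subdiv_point s u v (i + k)) [(subdiv_point s u v (i + k), subdiv_point s u v (Suc (i + k)))]
      (subdiv_point s u v (Suc (i + k)))"
  proof -
    have "i + k \<le> s" using Suc.prems by simp
    then have "subdiv_point s u v (i + k) \<in> pverts T'" using uv unfolding verts' by blast
    then show ?thesis
      using arcs'I(1)[OF uv, of "i + k"] Suc.prems by (simp add: pre_digraph.awalk_def cas_with_proj_eq)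
  qed
  then show ?case using walk_append[OF p(1)] p(2) by (intro exI) auto
qed

lemma walk_rep:
  assumes "walk T u p v"
  shows "\<exists>q. walk T' (replicate_mset s u) q (replicate_mset s v) \<and> length q = s * length p"
  using assms
proof (induction p arbitrary: u)
  case Nil
  then show ?case using rep_in by (intro exI[of _ "[]"]) auto
next
  case (Cons e p)
  have e: "(u, snd e) \<in> parcs T" "walk T (snd e) p v" using Cons.prems by (cases e; auto simp: C.walk_Cons)+
  obtain q where q: "walk T' (replicate_mset s (snd e)) q (replicate_mset s v)" "length q = s * length p"
    using Cons.IH[OF e(2)] by auto
  obtain q' where q': "walk T' (replicate_mset s u) q' (replicate_mset s (snd e))" "length q' = s"
    using walk_along[OF e(1), of 0 s] by auto
  show ?case using walk_append[OF q'(1) q(1)] q(2) q'(2) by (intro exI[of _ "q' @ q"]) auto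
qed

lemma connected': "connected_graph T'"
proof
  fix x y assume xy: "(x, y) \<in> parcs T'"
  obtain u v i where *: "(u, v) \<in> parcs T" "i < s" "x = subdiv_point s u v i" "y = subdiv_point s u v (Suc i)"
    using arcs'D[OF xy] by blast
  have "i \<le> s" "Suc i \<le> s" using *(2) by auto
  then show "x \<in> pverts T' \<and> y \<in> pverts T'" using * unfolding verts' by blast
  show "(y, x) \<in> parcs T'" using arcs'I[OF *(1,2)] * by simp
next
  fix x y assume xy: "x \<in> pverts T'" "y \<in> pverts T'"
  have to: "\<exists>v\<in>pverts T. (\<exists>p. walk T' x p (replicate_mset s v)) \<and> (\<exists>p. walk T' (replicate_mset s v) p x)"
    if x: "x \<in> pverts T'" for x
  proof -
    consider v where "v \<in> pverts T" "x = replicate_mset s v"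
      | u v i where "(u, v) \<in> parcs T" "i \<le> s" "x = subdiv_point s u v i"
      using x by (auto simp: verts')
    then show ?thesis
    proof cases
      case 1
      then have "walk T' x [] (replicate_mset s v)" "walk T' (replicate_mset s v) [] x" using rep_in by auto
      then show ?thesis using 1 by blast
    next
      case (2 u v i)
      have "\<exists>p. walk T' x p (replicate_mset s v)"
        using walk_along[OF 2(1), of i "s - i"] 2 by auto
      moreover have "\<exists>p. walk T' (replicate_mset s v) p x"
        using walk_along[OF C.arc_sym[OF 2(1)], of 0 "s - i"] 2 subdiv_point_commute[of i s v u] by auto
      ultimately show ?thesis using C.arc_verts[OF 2(1)] by blast
    qed
  qed
  obtain u p where u: "u \<in> pverts T" "walk T' x p (replicate_mset s u)" using to[OF xy(1)] by blast
  obtain v q where v: "v \<in> pverts T" "walk T' (replicate_mset s v) q y" using to[OF xy(2)] by blast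
  obtain r where "walk T' (replicate_mset s u) r (replicate_mset s v)"
    using C.walk_ex[OF u(1) v(1)] walk_rep by blast
  then show "\<exists>p. walk T' x p y" using walk_append[OF walk_append[OF u(2)] v(2)] by blast
qed

interpretation C': connected_graph T' using connected' .

lemma gdist_rep_le: "u \<in> pverts T \<Longrightarrow> v \<in> pverts T \<Longrightarrow>
    gdist T' (replicate_mset s u) (replicate_mset s v) \<le> s * gdist T u v"
  using C.gdist_walk[of u v] walk_rep C'.gdist_le by metis

text \<open>The potential is the interpolated distance from \<open>u\<close>. It is 0 at the copy of
  \<open>u\<close>, and an arc replaces one barycentric coordinate by a neighbour of it, which adds
  at most one.\<close>

lemma gdist_rep_ge:
  assumes "u \<in> pverts T" "v \<in> pverts T"
  shows "s * gdist T u v \<le> gdist T' (replicate_mset s u) (replicate_mset s v)"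
proof -
  have "(\<Sum>w\<in>#replicate_mset s v. gdist T u w)
      \<le> (\<Sum>w\<in>#replicate_mset s u. gdist T u w) + gdist T' (replicate_mset s u) (replicate_mset s v)"
  proof (rule C'.lipschitz[where \<phi> = "\<lambda>x. \<Sum>w\<in>#x. gdist T u w"])
    fix x y assume "(x, y) \<in> parcs T'"
    then obtain a b i where *: "(a, b) \<in> parcs T" "i < s" "x = subdiv_point s a b i" "y = subdiv_point s a b (Suc i)"
      using arcs'D by blast
    have "gdist T u b \<le> gdist T u a + 1" using C.gdist_step *(1) assms(1) by blast
    moreover have "s - i = Suc (s - Suc i)" using *(2) by simp
    ultimately show "(\<Sum>w\<in>#y. gdist T u w) \<le> (\<Sum>w\<in>#x. gdist T u w) + 1"
      using *(2) unfolding *(3,4) by (simp add: sum_subdiv_point)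
  qed (use assms rep_in in auto)
  then show ?thesis using assms by simp
qed

lemma finite': "finite (pverts T')"
proof -
  have "{subdiv_point s u v i | u v i. (u, v) \<in> parcs T \<and> i \<le> s}
      = (\<lambda>((u, v), i). subdiv_point s u v i) ` (parcs T \<times> {..s})" by force
  moreover have "{replicate_mset s v | v. v \<in> pverts T} = replicate_mset s ` pverts T" by auto
  ultimately show ?thesis using pair_finite_verts pair_finite_arcs by (simp add: verts')
qed

text \<open>Let \<open>S\<close> cut \<open>T\<close> at the edge \<open>uv\<close>. The number
  \<open>N\<close> of coordinates outside \<open>S\<close> is constantly 0 or \<open>s\<close> on
  edges that do not cross the cut, and climbs from 0 to \<open>s\<close> along \<open>uv\<close>;
  cutting between heights \<open>i\<close> and \<open>i + 1\<close> isolates the given arc.\<close>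

lemma bridged': "bridged_graph T'"
proof unfold_locales
  show "finite (pverts T')" by (rule finite')
  fix x y assume "(x, y) \<in> parcs T'"
  then obtain u v i where *: "(u, v) \<in> parcs T" "i < s" "x = subdiv_point s u v i" "y = subdiv_point s u v (Suc i)"
    using arcs'D by blast
  obtain S where S: "u \<in> S" "v \<notin> S" "\<forall>a b. (a, b) \<in> parcs T \<and> a \<in> S \<and> b \<notin> S \<longrightarrow> a = u \<and> b = v"
    using tree_bridge[OF T *(1)] by blast
  define N where "N z = size (filter_mset (\<lambda>w. w \<notin> S) z)" for z
  have N: "N (subdiv_point s a b j) = (if a \<notin> S then s - j else 0) + (if b \<notin> S then j else 0)" if "j \<le> s" for a b j
    using size_filter_subdiv_point[OF that, of "\<lambda>w. w \<notin> S"] by (simp add: N_def)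
  show "\<exists>S'. x \<in> S' \<and> y \<notin> S' \<and> (\<forall>a b. (a, b) \<in> parcs T' \<and> a \<in> S' \<and> b \<notin> S' \<longrightarrow> a = x \<and> b = y)"
  proof (intro exI conjI allI impI)
    show "x \<in> {z. N z \<le> i}" "y \<notin> {z. N z \<le> i}"
      using N[of i u v] N[of "Suc i" u v] *(2-4) S(1,2) by auto
    fix a b assume ab: "(a, b) \<in> parcs T' \<and> a \<in> {z. N z \<le> i} \<and> b \<notin> {z. N z \<le> i}"
    then obtain u' v' j where j: "(u', v') \<in> parcs T" "j < s" "a = subdiv_point s u' v' j" "b = subdiv_point s u' v' (Suc j)"
      using arcs'D by blast
    have "N a = (if u' \<notin> S then s - j else 0) + (if v' \<notin> S then j else 0)"
      "N b = (if u' \<notin> S then s - Suc j else 0) + (if v' \<notin> S then Suc j else 0)"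
      using N j by auto
    then have "u' \<in> S" "v' \<notin> S" "N a = j" "N b = Suc j" using ab j(2) by (auto split: if_splits)
    moreover from this have "u' = u" "v' = v" using S(3) j(1) by auto
    moreover have "j = i" using calculation(3,4) ab by auto
    ultimately show "a = x" "b = y" using j * by auto
  qed
qed

end

section \<open>Cubes of trees\<close>

definition rowpiece :: "('v \<Rightarrow> 'v \<Rightarrow> nat) \<Rightarrow> 'v set \<Rightarrow> nat \<Rightarrow> 'v \<Rightarrow> 'v set \<Rightarrow> bool" where
  "rowpiece \<delta> V L t Y \<longleftrightarrow> (\<exists>x n c. Y = x ` {0..<n} \<and> Y \<subseteq> V \<and> L \<le> n \<and> geodesic \<delta> x {0..<n} \<and>
    (\<forall>i<n. \<delta> (x i) t = c + i))"

text \<open>A short side of a block. It may bend at \<open>p\<close>, its index nearest to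
  \<open>t\<close>; the last condition provides the rays in \<open>grid_block\<close>.\<close>

definition tile :: "('v \<Rightarrow> 'v \<Rightarrow> nat) \<Rightarrow> 'v set \<Rightarrow> nat \<Rightarrow> 'v \<Rightarrow> 'v set \<Rightarrow> bool" where
  "tile \<delta> V f t Y \<longleftrightarrow> (\<exists>x n c p. Y = x ` {0..<n} \<and> Y \<subseteq> V \<and> geodesic \<delta> x {0..<n} \<and>
    (\<forall>i<n. \<delta> (x i) t = c + ad i p) \<and> p < n \<and> f \<le> n \<and> n < 2 * f \<and> (f \<le> p + 1 \<or> p + f \<le> n))"

lemma geodesic_shift: "geodesic \<delta> x {a..<b} \<Longrightarrow> geodesic \<delta> (\<lambda>i. x (a + i)) {0..<b - a}"
  unfolding geodesic_def by (auto simp: ad_def)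

lemma image_shift: "x ` {a..<b} = (\<lambda>i. x (a + i)) ` {0..<b - a}" for x :: "nat \<Rightarrow> 'v"
proof -
  have "{a..<b} = (\<lambda>i. a + i) ` {0..<b - a}"
    by (cases "a \<le> b") (auto simp: image_add_atLeastLessThan)
  then have "x ` {a..<b} = x ` (\<lambda>i. a + i) ` {0..<b - a}" by (rule arg_cong)
  then show ?thesis by (simp only: image_image)
qed

section \<open>Cutting rows into tiles\<close>

context
  fixes \<delta> :: "'v \<Rightarrow> 'v \<Rightarrow> nat" and V :: "'v set" and t :: 'v and x :: "nat \<Rightarrow> 'v" and N c p f :: nat
  assumes geo: "geodesic \<delta> x {0..<N}" and xV: "x ` {0..<N} \<subseteq> V"
    and dep: "\<And>i. i < N \<Longrightarrow> \<delta> (x i) t = c + ad i p" and f: "1 \<le> f"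
begin

lemma tile_around:
  assumes "a \<le> p" "p < b" "b \<le> N" "f \<le> b - a" "b - a < 2 * f" "f + a \<le> p + 1 \<or> p + f \<le> b"
  shows "tile \<delta> V f t (x ` {a..<b})"
  unfolding tile_def
proof (intro exI conjI)
  show "x ` {a..<b} = (\<lambda>i. x (a + i)) ` {0..<b - a}" by (rule image_shift)
  show "geodesic \<delta> (\<lambda>i. x (a + i)) {0..<b - a}"
    using assms by (intro geodesic_shift geodesic_subset[OF geo]) auto
  show "\<forall>i<b - a. \<delta> (x (a + i)) t = c + ad i (p - a)" using dep assms by (auto simp: ad_def)
  show "x ` {a..<b} \<subseteq> V" using xV assms(3) by auto
qed (use assms in auto)

lemma tile_monotone:
  assumes "b \<le> N" "f \<le> b - a" "b - a < 2 * f" "p \<le> a \<or> b \<le> p + 1"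
  shows "tile \<delta> V f t (x ` {a..<b})"
  unfolding tile_def
proof (intro exI conjI)
  show "x ` {a..<b} = (\<lambda>i. x (a + i)) ` {0..<b - a}" by (rule image_shift)
  show "geodesic \<delta> (\<lambda>i. x (a + i)) {0..<b - a}"
    using assms by (intro geodesic_shift geodesic_subset[OF geo]) auto
  \<comment> \<open>A segment on one side of \<open>p\<close> is nearest to \<open>t\<close> at one
    of its ends.\<close>
  define c' where "c' = (if p \<le> a then c + (a - p) else c + (p - (b - 1)))"
  define p' where "p' = (if p \<le> a then 0 else b - a - 1)"
  show "\<forall>i<b - a. \<delta> (x (a + i)) t = c' + ad i p'"
    using dep assms by (auto simp: ad_def c'_def p'_def)
  show "x ` {a..<b} \<subseteq> V" using xV assms(1) by auto
  show "p' < b - a" "f \<le> p' + 1 \<or> p' + f \<le> b - a" using assms f by (auto simp: p'_def)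
qed (use assms in auto)

text \<open>Tiles of length \<open>f\<close> are cut off until fewer than \<open>2 * f\<close>
  vertices remain.\<close>

lemma tiles_monotone:
  assumes "b \<le> N" "f \<le> b - a" "p \<le> a \<or> b \<le> p + 1"
  shows "parts (tile \<delta> V f t) (x ` {a..<b})"
  using assms
proof (induction "b - a" arbitrary: a rule: less_induct)
  case less
  show ?case
  proof (cases "b - a < 2 * f")
    case True
    then show ?thesis using less.prems by (intro parts_single tile_monotone)
  next
    case False
    have tl: "parts (tile \<delta> V f t) (x ` {a + f..<b})"
      by (rule less.hyps) (use less.prems False f in auto)
    have hd: "parts (tile \<delta> V f t) (x ` {a..<a + f})"
      by (intro parts_single tile_monotone) (use less.prems False f in auto)
    have "x ` {a..<a + f} \<inter> x ` {a + f..<b} = {}"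
      using less.prems(1) False by (subst inj_on_image_Int[OF geodesic_inj[OF geo], symmetric]) auto
    then have "parts (tile \<delta> V f t) (x ` {a..<a + f} \<union> x ` {a + f..<b})"
      using hd tl by (intro parts_Un) auto
    moreover have "{a..<b} = {a..<a + f} \<union> {a + f..<b}" using False by auto
    ultimately show ?thesis by (simp add: image_Un)
  qed
qed

lemma tiles_ivl_Un:
  assumes "parts Q (x ` {0..<a})" "parts Q (x ` {a..<N})" "a \<le> N"
  shows "parts Q (x ` {0..<N})"
proof -
  have "x ` {0..<a} \<inter> x ` {a..<N} = {}"
    using assms(3) by (subst inj_on_image_Int[OF geodesic_inj[OF geo], symmetric]) auto
  then have "parts Q (x ` {0..<a} \<union> x ` {a..<N})" using assms by (intro parts_Un)
  moreover have "{0..<N} = {0..<a} \<union> {a..<N}" using assms(3) by auto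
  ultimately show ?thesis by (simp add: image_Un)
qed

text \<open>If \<open>p\<close> is close to an end, one tile takes that end and reaches
  \<open>f\<close> steps beyond the bend; \<open>3 * f \<le> N\<close> leaves at least
  \<open>f\<close> vertices for the rest. Otherwise a cut at \<open>p\<close> removes the
  bend.\<close>

lemma tiles_bent:
  assumes p: "p < N" and N: "3 * f \<le> N"
  shows "parts (tile \<delta> V f t) (x ` {0..<N})"
proof -
  consider "p < f" | "f \<le> p" "f \<le> N - p" | "N - p < f" "f \<le> p" by linarith
  then show ?thesis
  proof cases
    case 1
    have "parts (tile \<delta> V f t) (x ` {0..<p + f})"
      by (intro parts_single tile_around) (use 1 assms f in auto)
    moreover have "parts (tile \<delta> V f t) (x ` {p + f..<N})"
      by (intro tiles_monotone) (use 1 assms f in auto)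
    ultimately show ?thesis by (rule tiles_ivl_Un) (use 1 assms in simp)
  next
    case 2
    show ?thesis
      by (rule tiles_ivl_Un[of _ p]) (use 2 assms f in \<open>auto intro!: tiles_monotone\<close>)
  next
    case 3
    have "parts (tile \<delta> V f t) (x ` {0..<p - f})"
      by (intro tiles_monotone) (use 3 assms f in auto)
    moreover have "parts (tile \<delta> V f t) (x ` {p - f..<N})"
      by (intro parts_single tile_around) (use 3 assms f in auto)
    ultimately show ?thesis by (rule tiles_ivl_Un) (use 3 assms in simp)
  qed
qed

end

lemma rowpiece_tiles:
  assumes "rowpiece \<delta> V L t Y" "3 * f \<le> L" "1 \<le> f"
  shows "parts (tile \<delta> V f t) Y"
proof -
  obtain x n c where x: "Y = x ` {0..<n}" "Y \<subseteq> V" "L \<le> n" "geodesic \<delta> x {0..<n}" "\<And>i. i < n \<Longrightarrow> \<delta> (x i) t = c + i"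
    using assms(1) unfolding rowpiece_def by blast
  show ?thesis unfolding x(1)
    by (rule tiles_bent[of \<delta> x n V t c 0]) (use x assms(2,3) in auto)
qed

text \<open>\<open>F\<close> stands for a box in which one factor varies and two are fixed.\<close>

lemma parts_feeds:
  assumes "parts Q X" "\<And>Y. Q Y \<Longrightarrow> feeds dst (F Y - {t}) t" "F {} = {}"
    "\<And>X Y. F (X \<union> Y) = F X \<union> F Y" "\<And>X Y. X \<inter> Y = {} \<Longrightarrow> F X \<inter> F Y = {}"
  shows "feeds dst (F X - {t}) t"
  using assms(1)
proof (induction rule: parts.induct)
  case parts_empty
  then show ?case using assms(3) by (simp add: feeds_empty)
next
  case (parts_insert X Y)
  have "feeds dst ((F X - {t}) \<union> (F Y - {t})) t"
    using parts_insert assms(2)[of Y] assms(5)[of X Y] by (intro feeds_Un) auto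
  then show ?case by (simp add: assms(4) Un_Diff)
qed

text \<open>The first argument of \<open>emb\<close> is the row direction. Permuting coordinates
  inside \<open>emb\<close> lets one argument serve all three directions.\<close>

definition box :: "('v \<Rightarrow> 'v \<Rightarrow> 'v \<Rightarrow> 'w) \<Rightarrow> 'v set \<Rightarrow> 'v set \<Rightarrow> 'v set \<Rightarrow> 'w set" where
  "box emb X A B = {emb r a b | r a b. r \<in> X \<and> a \<in> A \<and> b \<in> B}"

lemma boxI: "r \<in> X \<Longrightarrow> a \<in> A \<Longrightarrow> b \<in> B \<Longrightarrow> emb r a b \<in> box emb X A B"
  unfolding box_def by blast

lemma box_Un: "box emb (X \<union> X') A B = box emb X A B \<union> box emb X' A B"
  "box emb X (A \<union> A') B = box emb X A B \<union> box emb X A' B"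
  "box emb X A (B \<union> B') = box emb X A B \<union> box emb X A B'"
  by (auto simp: box_def)

lemma box_empty: "box emb {} A B = {}" "box emb X {} B = {}" "box emb X A {} = {}"
  by (simp_all add: box_def)

lemma box_coordinates:
  "box (\<lambda>r a b. ((r, a), b)) X A B = (X \<times> A) \<times> B"
  "box (\<lambda>r a b. ((a, r), b)) X A B = (A \<times> X) \<times> B"
  "box (\<lambda>r a b. ((a, b), r)) X A B = (A \<times> B) \<times> X"
  by (auto simp: box_def)

section \<open>Blocks and core of the cube\<close>

locale cube_metric =
  fixes \<delta> :: "'v \<Rightarrow> 'v \<Rightarrow> nat" and V :: "'v set" and L f D :: nat
  assumes zero: "x \<in> V \<Longrightarrow> y \<in> V \<Longrightarrow> \<delta> x y = 0 \<longleftrightarrow> x = y"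
    and diam: "x \<in> V \<Longrightarrow> y \<in> V \<Longrightarrow> \<delta> x y \<le> D"
    and f: "10 \<le> f" "4 * f \<le> L + 4" "L < 4 * f"
    and DL: "(3 * D) * (3 * D) \<le> L * (L * L)"
begin

lemma f3: "3 * f \<le> L" "1 \<le> f" using f by linarith+

context
  fixes dst :: "'w \<Rightarrow> 'w \<Rightarrow> nat" and emb :: "'v \<Rightarrow> 'v \<Rightarrow> 'v \<Rightarrow> 'w" and r0 a0 b0 :: 'v
  assumes emb_dst: "\<lbrakk>r \<in> V; a \<in> V; b \<in> V; r' \<in> V; a' \<in> V; b' \<in> V\<rbrakk> \<Longrightarrow>
      dst (emb r a b) (emb r' a' b') = \<delta> r r' + \<delta> a a' + \<delta> b b'"
    and emb_inj: "emb r a b = emb r' a' b' \<Longrightarrow> r = r' \<and> a = a' \<and> b = b'"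
    and roots: "r0 \<in> V" "a0 \<in> V" "b0 \<in> V"
begin

lemma box_feeds:
  assumes "rowpiece \<delta> V L r0 X" "tile \<delta> V f a0 A" "tile \<delta> V f b0 B"
  shows "feeds dst (box emb X A B - {emb r0 a0 b0}) (emb r0 a0 b0)"
proof -
  obtain x n c where x: "X = x ` {0..<n}" "X \<subseteq> V" "L \<le> n" "geodesic \<delta> x {0..<n}"
    "\<And>i. i < n \<Longrightarrow> \<delta> (x i) r0 = c + i"
    using assms(1) unfolding rowpiece_def by blast
  obtain y n1 c1 p where y: "A = y ` {0..<n1}" "A \<subseteq> V" "geodesic \<delta> y {0..<n1}"
    "\<And>i. i < n1 \<Longrightarrow> \<delta> (y i) a0 = c1 + ad i p" "p < n1" "f \<le> n1" "n1 < 2 * f" "f \<le> p + 1 \<or> p + f \<le> n1"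
    using assms(2) unfolding tile_def by blast
  obtain z n2 c2 q where z: "B = z ` {0..<n2}" "B \<subseteq> V" "geodesic \<delta> z {0..<n2}"
    "\<And>i. i < n2 \<Longrightarrow> \<delta> (z i) b0 = c2 + ad i q" "q < n2" "f \<le> n2" "n2 < 2 * f" "f \<le> q + 1 \<or> q + f \<le> n2"
    using assms(3) unfolding tile_def by blast
  have mem: "x i \<in> V" if "i < n" for i using that x(1,2) by auto
  have memy: "y i \<in> V" if "i < n1" for i using that y(1,2) by auto
  have memz: "z i \<in> V" if "i < n2" for i using that z(1,2) by auto
  define rho where "rho e k = emb (x k) (y (fst e)) (z (snd e))" for e k
  have "grid_block dst (emb r0 a0 b0) rho n1 n2 n (c + c1 + c2) p q f (3 * D)"
  proof
    show "dst (rho (i, j) k) (rho (i', j') k') = ad i i' + ad j j' + ad k k'"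
      if "i < n1" "j < n2" "k < n" "i' < n1" "j' < n2" "k' < n" for i j k i' j' k'
      using that emb_dst mem memy memz geodesicD[OF x(4)] geodesicD[OF y(3)] geodesicD[OF z(3)]
      by (simp add: rho_def)
    show "dst (rho (i, j) k) (emb r0 a0 b0) = c + c1 + c2 + ad i p + ad j q + k"
      if "i < n1" "j < n2" "k < n" for i j k
      using that emb_dst mem memy memz x(5) y(4) z(4) roots by (simp add: rho_def)
    show "dst (rho (i, j) k) (emb r0 a0 b0) = 0 \<longleftrightarrow> rho (i, j) k = emb r0 a0 b0"
      if "i < n1" "j < n2" "k < n" for i j k
    proof -
      have "dst (rho (i, j) k) (emb r0 a0 b0) = \<delta> (x k) r0 + \<delta> (y i) a0 + \<delta> (z j) b0"
        using that emb_dst mem memy memz roots by (simp add: rho_def)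
      then have "dst (rho (i, j) k) (emb r0 a0 b0) = 0 \<longleftrightarrow> x k = r0 \<and> y i = a0 \<and> z j = b0"
        using zero that mem memy memz roots by simp
      then show ?thesis using emb_inj unfolding rho_def by auto
    qed
    show "dst (rho (i, j) k) (emb r0 a0 b0) \<le> 3 * D" if "i < n1" "j < n2" "k < n" for i j k
      using that emb_dst mem memy memz roots diam[OF mem[OF that(3)] roots(1)]
        diam[OF memy[OF that(1)] roots(2)] diam[OF memz[OF that(2)] roots(3)] by (simp add: rho_def)
    \<comment> \<open>A row may be much longer than \<open>L\<close>, which only improves the bound:
      \<open>L * (L * L) \<le> L * (n * n)\<close>.\<close>
    have "L * L \<le> n * n" using x(3) by (intro mult_le_mono)
    then have "L * (L * L) \<le> L * (n * n)" by simp
    also have "\<dots> < 4 * f * (n * n)" using f x(3) by (intro mult_less_mono1) auto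
    finally show "3 * D * (3 * D) < 4 * f * (n * n)" using DL by linarith
  qed (use y z x f in auto)
  then interpret grid_block dst "emb r0 a0 b0" rho n1 n2 n "c + c1 + c2" p q f "3 * D" .
  have "rows cells = box emb X A B"
  proof
    show "rows cells \<subseteq> box emb X A B"
    proof
      fix w assume "w \<in> rows cells"
      then obtain i j k where "i < n1" "j < n2" "k < n" "w = emb (x k) (y i) (z j)"
        unfolding rows_def row_def cells_def by (auto simp: rho_def)
      then show "w \<in> box emb X A B" unfolding x(1) y(1) z(1) by (auto intro!: boxI)
    qed
    show "box emb X A B \<subseteq> rows cells"
    proof
      fix w assume "w \<in> box emb X A B"
      then obtain k i j where "k < n" "i < n1" "j < n2" "w = emb (x k) (y i) (z j)"
        unfolding box_def x(1) y(1) z(1) by auto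
      then have "(i, j) \<in> cells" "w \<in> row (i, j)" by (auto simp: cells_def row_def rho_def)
      then show "w \<in> rows cells" unfolding rows_def by blast
    qed
  qed
  then show ?thesis using block_feeds_t by simp
qed

lemma box_disjoint: "X \<inter> X' = {} \<or> A \<inter> A' = {} \<or> B \<inter> B' = {} \<Longrightarrow> box emb X A B \<inter> box emb X' A' B' = {}"
  by (auto simp: box_def dest!: emb_inj)

lemma boxes_feed:
  assumes "parts (rowpiece \<delta> V L r0) X" "parts (tile \<delta> V f a0) A" "parts (tile \<delta> V f b0) B"
  shows "feeds dst (box emb X A B - {emb r0 a0 b0}) (emb r0 a0 b0)"
  using assms(1)
proof (rule parts_feeds[where F = "\<lambda>X. box emb X A B"])
  fix X assume X: "rowpiece \<delta> V L r0 X"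
  show "feeds dst (box emb X A B - {emb r0 a0 b0}) (emb r0 a0 b0)"
    using assms(2)
  proof (rule parts_feeds[where F = "\<lambda>A. box emb X A B"])
    fix A assume A: "tile \<delta> V f a0 A"
    show "feeds dst (box emb X A B - {emb r0 a0 b0}) (emb r0 a0 b0)"
      using assms(3)
      by (rule parts_feeds[where F = "\<lambda>B. box emb X A B"]) (simp_all add: box_feeds[OF X A] box_disjoint box_Un box_empty)
  qed (simp_all add: box_disjoint box_Un box_empty)
qed (simp_all add: box_disjoint box_Un box_empty)

text \<open>Near the target in two coordinates, a bent row has distance
  \<open>h \<le> 2 * L \<le> n\<close>, so \<open>row_feeds\<close> applies without clusters. Its
  exception would force \<open>n = 2 * m + 1\<close>, impossible for \<open>m < L\<close> and
  \<open>2 * L \<le> n\<close>.\<close>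

lemma core_feeds:
  assumes x: "geodesic \<delta> x {0..<n}" "x ` {0..<n} \<subseteq> V" "2 * L \<le> n" "m < L" "x m = r0"
    and A: "finite A" "A \<subseteq> V" "\<And>a. a \<in> A \<Longrightarrow> \<delta> a a0 \<le> L"
    and B: "finite B" "B \<subseteq> V" "\<And>b. b \<in> B \<Longrightarrow> \<delta> b b0 \<le> L"
  shows "feeds dst (box emb (x ` {0..<n}) A B - {emb r0 a0 b0}) (emb r0 a0 b0)"
proof -
  let ?t = "emb r0 a0 b0"
  define row where "row e = (\<lambda>i. emb (x i) (fst e) (snd e))" for e
  have mn: "m < n" using x f by linarith
  have mem: "x i \<in> V" if "i < n" for i using that x(2) by auto
  have geo: "geodesic dst (row e) {0..<n}" if "e \<in> A \<times> B" for e
    unfolding geodesic_def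
  proof (intro ballI)
    fix i j assume ij: "i \<in> {0..<n}" "j \<in> {0..<n}"
    have ab: "fst e \<in> V" "snd e \<in> V" using that A B by auto
    show "dst (row e i) (row e j) = ad i j"
      using emb_dst[OF mem ab mem ab, of i j] ij zero[OF ab(1) ab(1)] zero[OF ab(2) ab(2)] geodesicD[OF x(1) ij]
      by (simp add: row_def)
  qed
  have "feeds dst (row e ` {0..<n} - {?t}) ?t" if e: "e \<in> A \<times> B" for e
  proof (cases "e = (a0, b0)")
    case True
    then have "row e m = ?t" using x(5) by (simp add: row_def)
    then show ?thesis using geodesic_feeds[OF geo[OF e], of m] mn by simp
  next
    case False
    have ab: "fst e \<in> V" "snd e \<in> V" using e A B by auto
    have nt: "?t \<notin> row e ` {0..<n}"
    proof
      assume "?t \<in> row e ` {0..<n}"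
      then obtain i where "emb (x i) (fst e) (snd e) = ?t" by (auto simp: row_def)
      from emb_inj[OF this] show False using False by (simp add: prod_eq_iff)
    qed
    have "feeds dst (row e ` {0..<n}) ?t"
    proof (rule row_feeds[OF geo[OF e] nt, of "\<delta> (fst e) a0 + \<delta> (snd e) b0" m])
      show "dst (row e i) ?t = \<delta> (fst e) a0 + \<delta> (snd e) b0 + ad i m" if "i < n" for i
        using emb_dst[OF mem[OF that] ab roots] geodesicD[OF x(1), of i m] that mn x(5) by (simp add: row_def)
      show "1 \<le> \<delta> (fst e) a0 + \<delta> (snd e) b0"
        using False zero[OF ab(1) roots(2)] zero[OF ab(2) roots(3)] by (cases e) auto
      show "\<delta> (fst e) a0 + \<delta> (snd e) b0 \<le> n"
        using A(3)[of "fst e"] B(3)[of "snd e"] e x(3) by auto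
      show "\<not> (n = 2 * (\<delta> (fst e) a0 + \<delta> (snd e) b0) + 1 \<and> m = \<delta> (fst e) a0 + \<delta> (snd e) b0)"
        using x(3,4) by auto
    qed (rule mn)
    then show ?thesis using nt by simp
  qed
  moreover have "(row e ` {0..<n} - {?t}) \<inter> (row e' ` {0..<n} - {?t}) = {}"
    if "e \<noteq> e'" for e e'
  proof -
    have "row e i \<noteq> row e' j" for i j
    proof
      assume "row e i = row e' j"
      then have "emb (x i) (fst e) (snd e) = emb (x j) (fst e') (snd e')" by (simp add: row_def)
      from emb_inj[OF this] show False using that by (simp add: prod_eq_iff)
    qed
    then show ?thesis by blast
  qed
  ultimately have "feeds dst (\<Union>e\<in>A \<times> B. row e ` {0..<n} - {?t}) ?t"
    using A(1) B(1) by (intro feeds_UN) auto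
  moreover have "(\<Union>e\<in>A \<times> B. row e ` {0..<n} - {?t}) = box emb (x ` {0..<n}) A B - {?t}"
  proof -
    have "(\<Union>e\<in>A \<times> B. row e ` {0..<n}) = box emb (x ` {0..<n}) A B"
    proof
      show "(\<Union>e\<in>A \<times> B. row e ` {0..<n}) \<subseteq> box emb (x ` {0..<n}) A B"
        unfolding row_def by (auto intro!: boxI)
      show "box emb (x ` {0..<n}) A B \<subseteq> (\<Union>e\<in>A \<times> B. row e ` {0..<n})"
      proof
        fix w assume "w \<in> box emb (x ` {0..<n}) A B"
        then obtain k a b where "k < n" "a \<in> A" "b \<in> B" "w = emb (x k) a b"
          unfolding box_def by auto
        then have "(a, b) \<in> A \<times> B" "w \<in> row (a, b) ` {0..<n}" by (auto simp: row_def)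
        then show "w \<in> (\<Union>e\<in>A \<times> B. row e ` {0..<n})" by blast
      qed
    qed
    then show ?thesis by blast
  qed
  ultimately show ?thesis by simp
qed

end

definition "bent_row t x n m \<longleftrightarrow> geodesic \<delta> x {0..<n} \<and> x ` {0..<n} \<subseteq> V \<and> 2 * L \<le> n \<and> m < L \<and> x m = t \<and>
  parts (rowpiece \<delta> V L t) (V - x ` {0..<n})"

text \<open>The first \<open>L\<close> vertices contain the root and stay within distance
  \<open>L\<close> of it; the others, again at least \<open>L\<close> of them, run away from the
  root. So the bent row can be shortened to \<open>L\<close> vertices, the remainder becoming a
  straight row.\<close>

lemma bent_row_tiles:
  assumes "bent_row t x n m" "t \<in> V"
  shows "parts (tile \<delta> V f t) (x ` {0..<n})" "parts (tile \<delta> V f t) (x ` {0..<L})"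
    "parts (tile \<delta> V f t) V" "parts (rowpiece \<delta> V L t) (V - x ` {0..<L})"
    "i < L \<Longrightarrow> \<delta> (x i) t \<le> L"
proof -
  have x: "geodesic \<delta> x {0..<n}" "x ` {0..<n} \<subseteq> V" "2 * L \<le> n" "m < L" "x m = t"
    and rest: "parts (rowpiece \<delta> V L t) (V - x ` {0..<n})"
    using assms(1) by (auto simp: bent_row_def)
  have dep: "\<delta> (x i) t = 0 + ad i m" if "i < n" for i
    using geodesicD[OF x(1), of i m] that x by simp
  have xL: "x ` {0..<L} \<subseteq> V" using x(2,3) by auto
  have geoL: "geodesic \<delta> x {0..<L}" using x(3) by (intro geodesic_subset[OF x(1)]) auto
  show tn: "parts (tile \<delta> V f t) (x ` {0..<n})"
    by (rule tiles_bent[OF x(1,2) dep]) (use x f3 in auto)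
  show "parts (tile \<delta> V f t) (x ` {0..<L})"
    by (rule tiles_bent[OF geoL xL dep]) (use x f3 in auto)
  have "parts (tile \<delta> V f t) (V - x ` {0..<n})"
    using rest by (rule parts_refine) (rule rowpiece_tiles[OF _ f3])
  then have "parts (tile \<delta> V f t) ((V - x ` {0..<n}) \<union> x ` {0..<n})"
    using tn by (intro parts_Un) auto
  then show "parts (tile \<delta> V f t) V" using x(2) by (simp add: Un_absorb2)
  have "rowpiece \<delta> V L t (x ` {L..<n})"
    unfolding rowpiece_def
  proof (intro exI conjI)
    show "x ` {L..<n} = (\<lambda>i. x (L + i)) ` {0..<n - L}" by (rule image_shift)
    show "x ` {L..<n} \<subseteq> V" using x(2) by auto
    show "L \<le> n - L" using x(3) by simp
    show "geodesic \<delta> (\<lambda>i. x (L + i)) {0..<n - L}"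
      by (intro geodesic_shift geodesic_subset[OF x(1)]) auto
    show "\<forall>i<n - L. \<delta> (x (L + i)) t = (L - m) + i" using dep x(4) by (auto simp: ad_def)
  qed
  then have "parts (rowpiece \<delta> V L t) ((V - x ` {0..<n}) \<union> x ` {L..<n})"
    using rest by (intro parts.parts_insert) auto
  moreover have "V - x ` {0..<L} = (V - x ` {0..<n}) \<union> x ` {L..<n}"
  proof -
    have "x ` {0..<L} \<inter> x ` {L..<n} = {}"
      using x(3) by (subst inj_on_image_Int[OF geodesic_inj[OF x(1)], symmetric]) auto
    moreover have "x ` {0..<n} = x ` {0..<L} \<union> x ` {L..<n}"
      using x(3) by (simp add: image_Un[symmetric] ivl_disj_un)
    ultimately show ?thesis using x(2) by blast
  qed
  ultimately show "parts (rowpiece \<delta> V L t) (V - x ` {0..<L})" by simp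
  show "\<delta> (x i) t \<le> L" if "i < L" using dep[of i] that x by (auto simp: ad_def)
qed

lemma parts_rowpiece_tiles: "parts (rowpiece \<delta> V L t) X \<Longrightarrow> parts (tile \<delta> V f t) X"
  by (erule parts_refine) (rule rowpiece_tiles[OF _ f3])

text \<open>If some coordinate of \<open>t\<close> has only straight rows, all rows are taken in that direction.
  Otherwise each coordinate contributes its straight rows, which leaves the core.\<close>

theorem cube_feeds:
  fixes dst :: "('v \<times> 'v) \<times> 'v \<Rightarrow> ('v \<times> 'v) \<times> 'v \<Rightarrow> nat"
  assumes dst: "\<And>a b c a' b' c'. \<lbrakk>a \<in> V; b \<in> V; c \<in> V; a' \<in> V; b' \<in> V; c' \<in> V\<rbrakk> \<Longrightarrow>
      dst ((a, b), c) ((a', b'), c') = \<delta> a a' + \<delta> b b' + \<delta> c c'"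
    and decomp: "\<And>t. t \<in> V \<Longrightarrow> parts (rowpiece \<delta> V L t) V \<or> (\<exists>x n m. bent_row t x n m)"
    and t: "t1 \<in> V" "t2 \<in> V" "t3 \<in> V"
  shows "feeds dst ((V \<times> V) \<times> V - {((t1, t2), t3)}) ((t1, t2), t3)"
proof -
  let ?t = "((t1, t2), t3)"
  have tiles: "parts (tile \<delta> V f u) V" if "u \<in> V" for u
    using decomp[OF that] parts_rowpiece_tiles bent_row_tiles(3) that by blast
  have dir1: "feeds dst ((X \<times> A) \<times> B - {?t}) ?t"
    if "parts (rowpiece \<delta> V L t1) X" "parts (tile \<delta> V f t2) A" "parts (tile \<delta> V f t3) B" for X A B
    using boxes_feed[of dst "\<lambda>r a b. ((r, a), b)" t1 t2 t3 X A B] that dst t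
    by (simp add: box_coordinates)
  have dir2: "feeds dst ((A \<times> X) \<times> B - {?t}) ?t"
    if "parts (rowpiece \<delta> V L t2) X" "parts (tile \<delta> V f t1) A" "parts (tile \<delta> V f t3) B" for X A B
    using boxes_feed[of dst "\<lambda>r a b. ((a, r), b)" t2 t1 t3 X A B] that dst t
    by (simp add: box_coordinates)
  have dir3: "feeds dst ((A \<times> B) \<times> X - {?t}) ?t"
    if "parts (rowpiece \<delta> V L t3) X" "parts (tile \<delta> V f t1) A" "parts (tile \<delta> V f t2) B" for X A B
    using boxes_feed[of dst "\<lambda>r a b. ((a, b), r)" t3 t1 t2 X A B] that dst t
    by (simp add: box_coordinates)
  consider "parts (rowpiece \<delta> V L t1) V" | "parts (rowpiece \<delta> V L t2) V" | "parts (rowpiece \<delta> V L t3) V"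
    | x1 n1 m1 x2 n2 m2 x3 n3 m3 where "bent_row t1 x1 n1 m1" "bent_row t2 x2 n2 m2" "bent_row t3 x3 n3 m3"
    using decomp t by metis
  then show ?thesis
  proof cases
    case 1
    then show ?thesis using dir1 tiles t by blast
  next
    case 2
    then show ?thesis using dir2 tiles t by blast
  next
    case 3
    then show ?thesis using dir3 tiles t by blast
  next
    case 4
    \<comment> \<open>The first coordinate keeps its whole bent row, along which the core is moved;
      the other two keep \<open>L\<close> vertices each, so that the distances in
      \<open>core_feeds\<close> are at most \<open>L\<close>.\<close>
    define C1 where "C1 = x1 ` {0..<n1}"
    define C2 where "C2 = x2 ` {0..<L}"
    define C3 where "C3 = x3 ` {0..<L}"
    have sub: "C1 \<subseteq> V" "C2 \<subseteq> V" "C3 \<subseteq> V"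
      using 4 by (auto simp: bent_row_def C1_def C2_def C3_def image_subset_iff)
    note tiles1 = bent_row_tiles[OF 4(1) t(1), folded C1_def]
    note tiles2 = bent_row_tiles[OF 4(2) t(2), folded C2_def]
    note tiles3 = bent_row_tiles[OF 4(3) t(3), folded C3_def]
    have "parts (rowpiece \<delta> V L t1) (V - C1)" using 4(1) by (simp add: bent_row_def C1_def)
    then have f1: "feeds dst (((V - C1) \<times> V) \<times> V - {?t}) ?t" using dir1 tiles t by blast
    have f2: "feeds dst ((C1 \<times> (V - C2)) \<times> V - {?t}) ?t" using dir2 tiles1(1) tiles2(4) tiles t by blast
    have f3: "feeds dst ((C1 \<times> C2) \<times> (V - C3) - {?t}) ?t" using dir3 tiles1(1) tiles2(2) tiles3(4) by blast
    have x1: "geodesic \<delta> x1 {0..<n1}" "x1 ` {0..<n1} \<subseteq> V" "2 * L \<le> n1" "m1 < L" "x1 m1 = t1"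
      using 4(1) by (auto simp: bent_row_def)
    have "feeds dst (box (\<lambda>r a b. ((r, a), b)) (x1 ` {0..<n1}) C2 C3 - {?t}) ?t"
      by (rule core_feeds[OF _ _ t x1])
        (use dst sub tiles2(5) tiles3(5) in \<open>auto simp: C2_def C3_def\<close>)
    then have f4: "feeds dst ((C1 \<times> C2) \<times> C3 - {?t}) ?t" by (simp add: box_coordinates C1_def)
    have "feeds dst ((((V - C1) \<times> V) \<times> V - {?t}) \<union> (((C1 \<times> (V - C2)) \<times> V - {?t}) \<union>
        (((C1 \<times> C2) \<times> (V - C3) - {?t}) \<union> ((C1 \<times> C2) \<times> C3 - {?t})))) ?t"
      by (intro feeds_Un f1 f2 f3 f4) auto
    moreover have "(((V - C1) \<times> V) \<times> V - {?t}) \<union> (((C1 \<times> (V - C2)) \<times> V - {?t}) \<union>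
        (((C1 \<times> C2) \<times> (V - C3) - {?t}) \<union> ((C1 \<times> C2) \<times> C3 - {?t}))) = (V \<times> V) \<times> V - {?t}"
      using sub by blast
    ultimately show ?thesis by simp
  qed
qed

end

section \<open>The cube of a subdivided tree\<close>

context rooted_tree
begin

lemma long_chain_rowpiece: "long_chain L Y \<Longrightarrow> rowpiece d V L t Y"
proof -
  assume "long_chain L Y"
  then obtain xs where xs: "chain xs" "L \<le> length xs" "set xs = Y" by (auto simp: long_chain_def)
  show ?thesis unfolding rowpiece_def
  proof (intro exI conjI allI impI)
    show "Y = nth xs ` {0..<length xs}" using xs(3) by (simp add: nth_image)
    show "Y \<subseteq> V" using xs by (auto simp: chain_def)
    show "L \<le> length xs" by fact
    show "geodesic d (nth xs) {0..<length xs}" using chain_gdist[OF xs(1)] by (simp add: geodesic_def)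
    fix i assume i: "i < length xs"
    have "xs ! i \<in> V" using i xs(1) by (auto simp: chain_def)
    then show "d (xs ! i) t = d t (hd xs) + i" using chain_dep[OF xs(1) i] gdist_sym root by simp
  qed
qed

text \<open>A vertex farthest from the root has no child. Applied twice, this reduces distances
  between arbitrary vertices to distances between leaves.\<close>

lemma farthest_leaf:
  assumes "\<exists>u\<in>V. u \<noteq> t"
  shows "\<exists>z. leaf z \<and> z \<noteq> t \<and> (\<forall>x\<in>V. d t x \<le> d t z)"
proof -
  have "finite (d t ` V)" "d t ` V \<noteq> {}" using finite_verts root by auto
  then have "Max (d t ` V) \<in> d t ` V" by (rule Max_in)
  then obtain z where z: "z \<in> V" "d t z = Max (d t ` V)" by auto
  then have max: "d t x \<le> d t z" if "x \<in> V" for x using that finite_verts by simp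
  obtain u where u: "u \<in> V" "u \<noteq> t" using assms by blast
  then have "0 < d t u" using gdist_eq_0[OF root u(1)] by auto
  then have "z \<noteq> t" using max[OF u(1)] root by auto
  moreover have "\<not> child z y" for y using max[of y] child_verts[of z y] by (auto simp: child_def)
  ultimately show ?thesis using z max childless_leaf by blast
qed

end

context
  fixes T :: "'a pair_pre_digraph" and s :: nat and T'
  assumes T: "is_tree T" and s: "s > 0" and T'_def: "T' = s_subdivision s T"
    and two: "\<exists>u\<in>pverts T. \<exists>v\<in>pverts T. u \<noteq> v"
begin

interpretation pair_graph T using T by (simp add: is_tree_def)
interpretation C: connected_graph T using tree_connected[OF T] .
interpretation B: bridged_graph T' using bridged'[OF T s T'_def] .

lemma rep_eq: "replicate_mset s u = replicate_mset s v \<longleftrightarrow> u = v"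
  using s by (metis set_mset_replicate_mset_subset singleton_inject not_less_zero)

lemma two': "x \<in> pverts T' \<Longrightarrow> \<exists>u\<in>pverts T'. u \<noteq> x"
  using two rep_in[OF T s T'_def] rep_eq by metis

text \<open>An inner point of a subdivided edge has two neighbours, told apart by the multiplicity
  of \<open>v\<close>. At an original vertex, different edges begin with different points, so a
  single neighbour in \<open>T'\<close> means a single one in \<open>T\<close>.\<close>

lemma leaf_rep:
  assumes "x \<in> pverts T'" "\<exists>w. \<forall>u. (x, u) \<in> parcs T' \<longrightarrow> u = w"
  shows "\<exists>v\<in>leaves T. x = replicate_mset s v"
proof -
  obtain w where w: "\<And>u. (x, u) \<in> parcs T' \<Longrightarrow> u = w" using assms(2) by blast
  have "\<exists>v\<in>pverts T. x = replicate_mset s v"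
  proof -
    consider v where "v \<in> pverts T" "x = replicate_mset s v"
      | u v i where "(u, v) \<in> parcs T" "i \<le> s" "x = subdiv_point s u v i"
      using assms(1) by (auto simp: verts'[OF T s T'_def])
    then show ?thesis
    proof cases
      case 1
      then show ?thesis by blast
    next
      case (2 u v i)
      have uv: "u \<in> pverts T" "v \<in> pverts T" "u \<noteq> v" using C.arc_verts[OF 2(1)] pair_no_loops[OF 2(1)] by auto
      consider "i = 0" | "i = s" | "0 < i" "i < s" using 2(2) by linarith
      then show ?thesis
      proof cases
        case 3
        have "(x, subdiv_point s u v (Suc i)) \<in> parcs T'" "(x, subdiv_point s u v (i - 1)) \<in> parcs T'"
          using arcs'I[OF T s T'_def 2(1), of i] arcs'I[OF T s T'_def 2(1), of "i - 1"] 3 2(3) by auto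
        from w[OF this(1)] w[OF this(2)] have "subdiv_point s u v (Suc i) = subdiv_point s u v (i - 1)" by simp
        then have "count (subdiv_point s u v (Suc i)) v = count (subdiv_point s u v (i - 1)) v" by simp
        then show ?thesis using uv by (simp add: subdiv_point_def)
      qed (use 2 uv in auto)
    qed
  qed
  then obtain v where v: "v \<in> pverts T" "x = replicate_mset s v" by blast
  \<comment> \<open>A second vertex of \<open>T\<close> guarantees a neighbour of \<open>v\<close>,
    so the degree is exactly 1.\<close>
  obtain u where u: "u \<in> pverts T" "u \<noteq> v" using two by metis
  then obtain n where n: "gdist T u v = Suc n" using C.gdist_eq_0[OF u(1) v(1)] by (cases "gdist T u v") auto
  obtain y where y: "(y, v) \<in> parcs T" using C.gdist_Suc_nbr[OF u(1) v(1) n] by blast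
  have one: "subdiv_point s v y' (Suc 0) = w" if "(v, y') \<in> parcs T" for y'
    using w arcs'I(1)[OF T s T'_def that, of 0] s v(2) by simp
  have vy: "(v, y) \<in> parcs T" using C.arc_sym[OF y] .
  have only: "y' = y" if y': "(v, y') \<in> parcs T" for y'
  proof -
    have "subdiv_point s v y' (Suc 0) = subdiv_point s v y (Suc 0)" using one[OF y'] one[OF vy] by simp
    then show ?thesis by (simp add: subdiv_point_def)
  qed
  have "out_arcs (with_proj T) v = {(v, y)}"
  proof
    show "{(v, y)} \<subseteq> out_arcs (with_proj T) v" using vy by (simp add: out_arcs_def)
    show "out_arcs (with_proj T) v \<subseteq> {(v, y)}"
    proof
      fix e assume "e \<in> out_arcs (with_proj T) v"
      then have e: "e = (v, snd e)" "(v, snd e) \<in> parcs T" by (cases e; simp add: out_arcs_def)+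
      show "e \<in> {(v, y)}" using e(1) only[OF e(2)] by simp
    qed
  qed
  then have "v \<in> leaves T" using v by (simp add: leaves_def out_degree_def)
  then show ?thesis using v by blast
qed

text \<open>Two distinct leaves are given because \<open>spread\<close> is a \<open>Min\<close> over
  such pairs, unspecified if there are none.\<close>

lemma leaves_sep:
  assumes "u \<in> leaves T" "v \<in> leaves T" "u \<noteq> v"
  shows "1 \<le> spread T" "spread T \<le> gdist T u v" "gdist T u v \<le> graph_diameter T"
proof -
  let ?S = "{gdist T u v | u v. u \<in> leaves T \<and> v \<in> leaves T \<and> u \<noteq> v}"
  let ?D = "{gdist T u v | u v. u \<in> pverts T \<and> v \<in> pverts T}"
  have fD: "finite ?D"
  proof -
    have "?D = (\<lambda>(u, v). gdist T u v) ` (pverts T \<times> pverts T)" by auto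
    then show ?thesis using pair_finite_verts by simp
  qed
  have lv: "leaves T \<subseteq> pverts T" by (auto simp: leaves_def)
  have sub: "?S \<subseteq> ?D" using lv by blast
  have fS: "finite ?S" using finite_subset[OF sub fD] .
  have mem: "gdist T u v \<in> ?S" using assms by blast
  show "spread T \<le> gdist T u v" unfolding spread_def using fS mem by (rule Min_le)
  have "spread T \<in> ?S" unfolding spread_def using fS mem by (intro Min_in) auto
  then obtain a b where ab: "spread T = gdist T a b" "a \<in> pverts T" "b \<in> pverts T" "a \<noteq> b"
    using lv by blast
  then show "1 \<le> spread T" using C.gdist_eq_0[of a b] by (cases "gdist T a b") auto
  show "gdist T u v \<le> graph_diameter T" unfolding graph_diameter_def
    using fD by (rule Max_ge) (use mem sub in blast)
qed

text \<open>Distances in \<open>T'\<close> are known between original vertices only, so the diameter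
  is bounded through leaves, which are original vertices. The same argument shows that
  \<open>T\<close> has two leaves.\<close>

lemma subdivision_facts:
  shows subdivision_leaves: "\<lbrakk>x \<in> pverts T'; \<exists>w. \<forall>u. (x, u) \<in> parcs T' \<longrightarrow> u = w;
      y \<in> pverts T'; \<exists>w. \<forall>u. (y, u) \<in> parcs T' \<longrightarrow> u = w; x \<noteq> y\<rbrakk> \<Longrightarrow> s * spread T \<le> gdist T' x y"
    and subdivision_diam: "\<lbrakk>x \<in> pverts T'; y \<in> pverts T'\<rbrakk> \<Longrightarrow> gdist T' x y \<le> s * graph_diameter T"
    and spread_bounds: "1 \<le> spread T" "spread T \<le> graph_diameter T"
proof -
  show "s * spread T \<le> gdist T' x y"
    if x: "x \<in> pverts T'" "\<exists>w. \<forall>u. (x, u) \<in> parcs T' \<longrightarrow> u = w"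
      and y: "y \<in> pverts T'" "\<exists>w. \<forall>u. (y, u) \<in> parcs T' \<longrightarrow> u = w" and ne: "x \<noteq> y" for x y
  proof -
    obtain u v where uv: "u \<in> leaves T" "v \<in> leaves T" "x = replicate_mset s u" "y = replicate_mset s v"
      using leaf_rep[OF x] leaf_rep[OF y] by blast
    then have "s * spread T \<le> s * gdist T u v" using leaves_sep(2)[of u v] ne by auto
    also have "\<dots> \<le> gdist T' x y"
      unfolding uv(3,4) using uv(1,2) by (intro gdist_rep_ge[OF T s T'_def]) (auto simp: leaves_def)
    finally show ?thesis .
  qed
  have far: "\<exists>z\<in>leaves T. z' = replicate_mset s z"
    if r: "rooted_tree T' t" and l: "rooted_tree.leaf T' z'" for z' t
  proof -
    interpret R: rooted_tree T' t by (rule r)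
    show ?thesis using leaf_rep[of z'] l by (simp add: R.leaf_def)
  qed
  have root: "rooted_tree T' t" if "t \<in> pverts T'" for t
    using that by unfold_locales
  \<comment> \<open>Go from \<open>x\<close> to a farthest \<open>z\<close>, then from
    \<open>z\<close> to a farthest \<open>w\<close>: both are leaves, and the distance never
    decreases.\<close>
  have main: "\<exists>u\<in>leaves T. \<exists>v\<in>leaves T. u \<noteq> v \<and> gdist T' x y \<le> s * gdist T u v"
    if x: "x \<in> pverts T'" and y: "y \<in> pverts T'" for x y
  proof -
    interpret R: rooted_tree T' x using root[OF x] .
    obtain z where z: "R.leaf z" "gdist T' x y \<le> gdist T' x z" using R.farthest_leaf two'[OF x] y by blast
    have zV: "z \<in> pverts T'" using z(1) by (simp add: R.leaf_def)
    interpret Z: rooted_tree T' z using root[OF zV] .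
    obtain w where w: "Z.leaf w" "w \<noteq> z" "gdist T' z x \<le> gdist T' z w"
      using Z.farthest_leaf two'[OF zV] x by blast
    obtain u where u: "u \<in> leaves T" "z = replicate_mset s u" using far[OF root[OF x] z(1)] by blast
    obtain v where v: "v \<in> leaves T" "w = replicate_mset s v" using far[OF root[OF zV] w(1)] by blast
    have "gdist T' x y \<le> gdist T' z w" using z(2) w(3) B.gdist_sym[OF x zV] by simp
    also have "\<dots> \<le> s * gdist T u v"
      unfolding u(2) v(2) using u v by (intro gdist_rep_le[OF T s T'_def]) (auto simp: leaves_def)
    finally have "gdist T' x y \<le> s * gdist T u v" .
    moreover have "u \<noteq> v" using u(2) v(2) w(2) by auto
    ultimately show ?thesis using u(1) v(1) by blast
  qed
  show "gdist T' x y \<le> s * graph_diameter T" if xy: "x \<in> pverts T'" "y \<in> pverts T'" for x y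
  proof -
    obtain u v where uv: "u \<in> leaves T" "v \<in> leaves T" "u \<noteq> v" "gdist T' x y \<le> s * gdist T u v"
      using main[OF xy] by blast
    have "s * gdist T u v \<le> s * graph_diameter T" using leaves_sep(3)[OF uv(1-3)] by simp
    then show ?thesis using uv(4) by linarith
  qed
  obtain w where "w \<in> pverts T" using two by blast
  then have w: "replicate_mset s w \<in> pverts T'" by (rule rep_in[OF T s T'_def])
  then obtain u v where uv: "u \<in> leaves T" "v \<in> leaves T" "u \<noteq> v" using main[OF w w] by blast
  show "1 \<le> spread T" by (rule leaves_sep(1)[OF uv])
  show "spread T \<le> graph_diameter T" using leaves_sep(2,3)[OF uv] by linarith
qed

lemma stackable_cube:
  assumes real: "real s \<ge> 72 * (real (graph_diameter T))\<^sup>2 / (real (spread T))^3"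
  shows "stackable (T' \<box> T' \<box> T')"
proof -
  define K where "K = s * spread T"
  define D where "D = s * graph_diameter T"
  define L where "L = (K + 1) div 2"
  define f where "f = L div 4 + 1"
  have k: "1 \<le> spread T" "spread T \<le> graph_diameter T" using spread_bounds by auto
  have "72 * (real (graph_diameter T))\<^sup>2 \<le> real s * (real (spread T))^3"
    using real k by (simp add: divide_le_eq)
  then have "real (72 * (graph_diameter T)\<^sup>2) \<le> real (s * (spread T)^3)" by simp
  then have "72 * (graph_diameter T)\<^sup>2 \<le> s * (spread T)^3" by (simp only: of_nat_le_iff)
  \<comment> \<open>Multiplying by the square of \<open>s\<close> turns the hypothesis into one on
    \<open>K\<close> and \<open>D\<close>.\<close>
  then have "s\<^sup>2 * (72 * (graph_diameter T)\<^sup>2) \<le> s\<^sup>2 * (s * (spread T)^3)" by simp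
  then have KD: "72 * (D * D) \<le> K * (K * K)"
    by (simp add: K_def D_def power2_eq_square power3_eq_cube mult.assoc mult.left_commute)
  have KleD: "K \<le> D" using k(2) by (simp add: K_def D_def)
  have K1: "1 \<le> K" using k(1) s by (simp add: K_def)
  \<comment> \<open>As \<open>K \<le> D\<close>, the hypothesis forces \<open>72 \<le> K\<close>,
    whence \<open>36 \<le> L\<close> and \<open>10 \<le> f\<close>.\<close>
  have "72 * (K * K) \<le> K * (K * K)" using KD mult_le_mono[OF KleD KleD] by linarith
  then have K72: "72 \<le> K" using K1 by simp
  have L36: "36 \<le> L" "K \<le> 2 * L" "2 * L \<le> K + 1" using K72 by (auto simp: L_def)
  have "K * (K * K) \<le> (2 * L) * ((2 * L) * (2 * L))" using L36(2) by (intro mult_le_mono)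
  then have DL: "(3 * D) * (3 * D) \<le> L * (L * L)" using KD by simp
  interpret cube_metric "gdist T'" "pverts T'" L f D
  proof
    show "gdist T' x y = 0 \<longleftrightarrow> x = y" if "x \<in> pverts T'" "y \<in> pverts T'" for x y
      by (rule B.gdist_eq_0[OF that])
    show "gdist T' x y \<le> D" if "x \<in> pverts T'" "y \<in> pverts T'" for x y
      using subdivision_diam that by (simp add: D_def)
  qed (use L36 DL in \<open>auto simp: f_def\<close>)
  have conn: "connected_graph T'" by (rule connected'[OF T s T'_def])
  have conn2: "connected_graph (T' \<box> T')" using conn by (intro connected_cart_prod)
  show ?thesis
  proof (rule stackable_if_feeds)
    show "finite (pverts (T' \<box> T' \<box> T'))" using B.finite_verts by simp
    fix t assume "t \<in> pverts (T' \<box> T' \<box> T')"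
    then obtain t1 t2 t3 where t: "t = ((t1, t2), t3)" "t1 \<in> pverts T'" "t2 \<in> pverts T'" "t3 \<in> pverts T'" by auto
    have "feeds (gdist (T' \<box> T' \<box> T')) ((pverts T' \<times> pverts T') \<times> pverts T' - {((t1, t2), t3)}) ((t1, t2), t3)"
    proof (rule cube_feeds[OF _ _ t(2-4)])
      show "gdist (T' \<box> T' \<box> T') ((a, b), c) ((a', b'), c') = gdist T' a a' + gdist T' b b' + gdist T' c c'"
        if "a \<in> pverts T'" "b \<in> pverts T'" "c \<in> pverts T'" "a' \<in> pverts T'" "b' \<in> pverts T'" "c' \<in> pverts T'"
        for a b c a' b' c'
        using that gdist_cart_prod[OF conn2 conn] gdist_cart_prod[OF conn conn] by simp
      fix r assume r: "r \<in> pverts T'"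
      interpret R: rooted_tree T' r using r by unfold_locales
      have "parts (R.long_chain L) (pverts T') \<or>
        (\<exists>xs m. set xs \<subseteq> pverts T' \<and> 2 * L \<le> length xs \<and> m < L \<and> xs ! m = r \<and>
          geodesic (gdist T') (nth xs) {0..<length xs} \<and> parts (R.long_chain L) (pverts T' - set xs))"
        by (rule R.root_decomposition[OF L36(3) K1 _ two'[OF r]])
          (use subdivision_leaves in \<open>auto simp: R.leaf_def K_def\<close>)
      then show "parts (rowpiece (gdist T') (pverts T') L r) (pverts T') \<or> (\<exists>x n m. bent_row r x n m)"
      proof
        assume "parts (R.long_chain L) (pverts T')"
        then show ?thesis by (intro disjI1) (erule parts_refine, intro parts_single R.long_chain_rowpiece)
      next
        assume "\<exists>xs m. set xs \<subseteq> pverts T' \<and> 2 * L \<le> length xs \<and> m < L \<and> xs ! m = r \<and>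
          geodesic (gdist T') (nth xs) {0..<length xs} \<and> parts (R.long_chain L) (pverts T' - set xs)"
        then obtain xs m where xs: "set xs \<subseteq> pverts T'" "2 * L \<le> length xs" "m < L" "xs ! m = r"
          "geodesic (gdist T') (nth xs) {0..<length xs}" "parts (R.long_chain L) (pverts T' - set xs)" by blast
        have img: "nth xs ` {0..<length xs} = set xs" by (simp add: nth_image)
        have "parts (rowpiece (gdist T') (pverts T') L r) (pverts T' - set xs)"
          using xs(6) by (rule parts_refine) (intro parts_single R.long_chain_rowpiece)
        then have "bent_row r (nth xs) (length xs) m" using xs img by (simp add: bent_row_def)
        then show ?thesis by blast
      qed
    qed
    then show "feeds (gdist (T' \<box> T' \<box> T')) (pverts (T' \<box> T' \<box> T') - {t}) t" using t by simp
  qed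
qed

end

theorem theorem3p9:
  fixes T :: "'a pair_pre_digraph" and T' :: "'a multiset pair_pre_digraph"
    and s k d :: nat
  assumes "is_tree T"
    and "spread T = k"
    and "graph_diameter T = d"
    and "s > 0"
    and "real s \<ge> 72 * (real d)\<^sup>2 / (real k)^3"
    and "T' = s_subdivision s T"
  shows "stackable (T' \<box> T' \<box> T')"
proof (cases "\<exists>u\<in>pverts T. \<exists>v\<in>pverts T. u \<noteq> v")
  case True
  then show ?thesis using stackable_cube[OF assms(1,4,6) True] assms(2,3,5) by simp
next
  \<comment> \<open>Without two vertices there are no leaves, and \<open>spread T\<close> is the
    unspecified \<open>Min {}\<close>. The cube then has at most one vertex, so there is nothing to
    move.\<close>
  case False
  have sub: "pverts T' \<subseteq> replicate_mset s ` pverts T"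
  proof -
    have "u \<noteq> v" "u \<in> pverts T" "v \<in> pverts T" if "(u, v) \<in> parcs T" for u v
    proof -
      interpret pair_graph T using assms(1) by (simp add: is_tree_def)
      show "u \<noteq> v" "u \<in> pverts T" "v \<in> pverts T" using pair_no_loops[OF that] wellformed' that by auto
    qed
    then have "parcs T = {}" using False by auto
    then show ?thesis by (auto simp: assms(6) s_subdivision_def)
  qed
  show ?thesis
  proof (rule stackable_if_feeds)
    have eq: "x = y" if xy: "x \<in> pverts T'" "y \<in> pverts T'" for x y
    proof -
      obtain u v where "u \<in> pverts T" "v \<in> pverts T" "x = replicate_mset s u" "y = replicate_mset s v"
        using xy sub by (meson imageE subsetD)
      then show ?thesis using False by (cases "u = v") auto
    qed
    have "finite (pverts T')"
    proof (cases "pverts T' = {}")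
      case nonempty: False
      then obtain x where "x \<in> pverts T'" by blast
      then have "pverts T' \<subseteq> {x}" using eq by blast
      then show ?thesis by (rule finite_subset) simp
    qed simp
    then show "finite (pverts (T' \<box> T' \<box> T'))" by simp
    fix t assume "t \<in> pverts (T' \<box> T' \<box> T')"
    then have "pverts (T' \<box> T' \<box> T') - {t} = {}" using eq by auto
    then show "feeds (gdist (T' \<box> T' \<box> T')) (pverts (T' \<box> T' \<box> T') - {t}) t" by (simp only: feeds_empty)
  qed
qed

end
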